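(* Suppose $\alpha\in(0,\alpha_* )$. Let $c=\alpha F'(0)$. Then, as $n\to\infty$, $$R_n\xrightarrow{d}\tau:=\max\{j:S_j<0\},$$ the last time of excursion into $(-\infty,0)$ (with $\tau=0$ if there is no such $j$) by the random walk $S_0=0$, $S_j=S_{j-1}+\gamma_j-c$, $j\ge 1$, where $\gamma_1,\gamma_2,\ldots$ are i.i.d. $\mathrm{Exp}(1)$ with density $e^{-x}$, $x>0$. The distribution of $\tau$ is $$\Pr\{\tau=k\}=\frac{k^k}{k!}(1-c)c^ke^{-kc},\qquad k=0,1,2,\ldots\quad(\text{with }0^0=1).$$ Consequently, the power of the BH procedure is of order $O_p(1/n)$, i.e. $\mathrm{power}_n=O_p(1/n)$. Furthermore, $$\mathrm{pFDR}=E[V_n/R_n\mid R_n\ge 1]\to\beta_*$$ and $$\sum_{k=1}^\infty d_{\mathrm{TV}}\bigl(\mathcal L(V_n\mid R_n=k),\ \mathrm{Binomial}(k,\beta_* )\bigr)\Pr\{R_n=k\}\to 0,$$ where $\beta_*=(1-\pi)\alpha_*$, $d_{\mathrm{TV}}(\mu,\nu):=\sum_k|\mu_k-\nu_k|$ denotes the total variation distance of two distributions $\mu$ and $\nu$ on $0,1,2,\ldots$, and $\mathcal L(V_n\mid R_n=k)$ is the conditional distribution of $V_n$ given $R_n=k$.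
   Context: Random effects model: $\pi\in(0,1)$ is fixed; $(p_1,\theta_1),(p_2,\theta_2),\ldots$ are i.i.d., $\theta_j\in\{0,1\}$ with $\Pr\{\theta_j=1\}=\pi$ ($\theta_j=1$ means that the $j$th null hypothesis is false), and for $u\in[0,1]$, $\Pr\{p_j\le u\mid\theta_j=0\}=u$ and $\Pr\{p_j\le u\mid\theta_j=1\}=G(u)$. The common distribution function of the $p$-values is $F(u)=(1-\pi)u+\pi G(u)$; it is assumed that $F$ is continuous on $[0,1]$ with $F(0)=0$, and $F'(0)$ denotes its (one-sided) derivative at $0$, assumed to exist. Put $\alpha_*=\inf_{u>0}u/F(u)\le 1$ and $\beta_*=(1-\pi)\alpha_*$. Note that $1-\pi\le F'(0)\le 1/\alpha_*$. Benjamini–Hochberg (BH) procedure at target level $\alpha\in(0,1)$ applied to $p_1,\ldots,p_n$: let $p_{n:1}\le\cdots\le p_{n:n}$ be the order statistics, $p_{n:0}=0$, and $R_n=\max\{j\in\{0,\ldots,n\}:p_{n:j}\le\alpha j/n\}$. The nulls with $p$-values $\le p_{n:R_n}$ are rejected, so $R_n$ is the number of rejections. $V_n=\#\{j\le n:p_j\le p_{n:R_n},\ \theta_j=0\}$ is the number of false rejections. With $N=\#\{j\le n:\theta_j=0\}$ the number of true nulls, $\mathrm{power}_n=(R_n-V_n)/((n-N)\vee 1)$.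
   Formalization: The limits of pFDR and of the total variation sum are claimed only when F'(0)=1/α_*; otherwise they fail, since the null proportion among rejections tends to (1−π)/F'(0) (e.g. G(u)=max(0,2u−1), α<1/2, where pFDR=1 but β_*=1−π). *)

theory Defs
  imports "HOL-Probability.Probability"
begin

text \<open>
  The pairs \<open>(p\<^sub>1, \<theta>\<^sub>1), (p\<^sub>2, \<theta>\<^sub>2), \<dots>\<close> are indexed from 0, so that \<open>p\<^sub>1, \<dots>, p\<^sub>n\<close> are
  \<open>p 0, \<dots>, p (n - 1)\<close>; \<open>\<theta> j \<omega>\<close> holds iff the null hypothesis with index \<open>j\<close> is false.
  That the pairs are identically distributed follows from \<open>prob_false_null\<close>,
  \<open>cdf_true_null\<close> and \<open>cdf_false_null\<close>, none of which depends on \<open>j\<close>.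
\<close>

locale random_effects_model = prob_space M
  for M :: "'a measure" and p :: "nat \<Rightarrow> 'a \<Rightarrow> real" and \<theta> :: "nat \<Rightarrow> 'a \<Rightarrow> bool"
    and \<pi> :: real and G :: "real \<Rightarrow> real" +
  assumes \<pi>_range: "0 < \<pi>" "\<pi> < 1"
    and indep: "indep_vars (\<lambda>_. borel \<Otimes>\<^sub>M count_space UNIV) (\<lambda>j \<omega>. (p j \<omega>, \<theta> j \<omega>)) UNIV"
    and p_range: "\<And>j \<omega>. \<omega> \<in> space M \<Longrightarrow> p j \<omega> \<in> {0..1}"
    and prob_false_null: "\<And>j. \<P>(\<omega> in M. \<theta> j \<omega>) = \<pi>"
    and cdf_true_null: "\<And>j u. u \<in> {0..1} \<Longrightarrow> \<P>(\<omega> in M. p j \<omega> \<le> u \<bar> \<not> \<theta> j \<omega>) = u"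
    and cdf_false_null: "\<And>j u. u \<in> {0..1} \<Longrightarrow> \<P>(\<omega> in M. p j \<omega> \<le> u \<bar> \<theta> j \<omega>) = G u"

definition mixture_cdf :: "real \<Rightarrow> (real \<Rightarrow> real) \<Rightarrow> real \<Rightarrow> real" where
  "mixture_cdf \<pi> G u = (1 - \<pi>) * u + \<pi> * G u"

definition alpha_star :: "(real \<Rightarrow> real) \<Rightarrow> real" where
  "alpha_star F = (INF u\<in>{0<..1}. u / F u)"

definition beta_star :: "real \<Rightarrow> (real \<Rightarrow> real) \<Rightarrow> real" where
  "beta_star \<pi> F = (1 - \<pi>) * alpha_star F"

text \<open>
  In the subcritical regime the rejected \<open>p\<close>-values are near 0, where the proportion of true nulls
  is \<open>(1 - \<pi>) / F'(0)\<close>. This equals \<open>beta_star \<pi> F\<close> iff \<open>F'(0) = 1 / alpha_star F\<close>, which holds for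
  concave \<open>F\<close> but not in general: for \<open>G u = max 0 (2 * u - 1)\<close> one has \<open>alpha_star F = 1\<close>,
  \<open>F'(0) = 1 - \<pi>\<close>, and at levels below 1/2 every rejection is false.
\<close>

text \<open>In the next four definitions \<open>x\<close> and \<open>t\<close> are realisations of the sequences \<open>p\<close> and \<open>\<theta>\<close>.\<close>

definition order_stat :: "(nat \<Rightarrow> real) \<Rightarrow> nat \<Rightarrow> nat \<Rightarrow> real" where
  "order_stat x n j = (if j = 0 then 0 else sort (map x [0..<n]) ! (j - 1))"

definition BH_rejections :: "real \<Rightarrow> (nat \<Rightarrow> real) \<Rightarrow> nat \<Rightarrow> nat" where
  "BH_rejections \<alpha> x n = Max {j \<in> {0..n}. order_stat x n j \<le> \<alpha> * real j / real n}"

definition BH_false_rejections ::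
    "real \<Rightarrow> (nat \<Rightarrow> real) \<Rightarrow> (nat \<Rightarrow> bool) \<Rightarrow> nat \<Rightarrow> nat" where
  "BH_false_rejections \<alpha> x t n =
     card {j \<in> {..<n}. x j \<le> order_stat x n (BH_rejections \<alpha> x n) \<and> \<not> t j}"

definition BH_power :: "real \<Rightarrow> (nat \<Rightarrow> real) \<Rightarrow> (nat \<Rightarrow> bool) \<Rightarrow> nat \<Rightarrow> real" where
  "BH_power \<alpha> x t n =
     (real (BH_rejections \<alpha> x n) - real (BH_false_rejections \<alpha> x t n)) /
     real (max (n - card {j \<in> {..<n}. \<not> t j}) 1)"

text \<open>The steps \<open>\<gamma>\<^sub>1, \<gamma>\<^sub>2, \<dots>\<close> of the random walk are likewise indexed from 0.\<close>

definition walk :: "real \<Rightarrow> (nat \<Rightarrow> real) \<Rightarrow> nat \<Rightarrow> real" where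
  "walk c g j = (\<Sum>i<j. g i - c)"

definition last_negative_time :: "real \<Rightarrow> (nat \<Rightarrow> real) \<Rightarrow> nat" where
  "last_negative_time c g =
     (if {j. walk c g j < 0} = {} then 0 else Max {j. walk c g j < 0})"

text \<open>\<open>X\<^sub>n = O\<^sub>p(a\<^sub>n)\<close>: the sequence \<open>X\<^sub>n / a\<^sub>n\<close> is bounded in probability.\<close>

definition bigo_prob :: "'a measure \<Rightarrow> (nat \<Rightarrow> 'a \<Rightarrow> real) \<Rightarrow> (nat \<Rightarrow> real) \<Rightarrow> bool" where
  "bigo_prob M X a \<longleftrightarrow>
     (\<forall>\<epsilon>>0. \<exists>K. \<forall>\<^sub>F n in sequentially. \<P>(\<omega> in M. \<bar>X n \<omega>\<bar> > K * \<bar>a n\<bar>) < \<epsilon>)"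

text \<open>
  Conditioning on an event of positive probability is \<open>uniform_measure\<close>, whose measure of a set
  \<open>B\<close> is \<open>measure M (A \<inter> B) / measure M A\<close>.
\<close>

definition cond_expectation :: "'a measure \<Rightarrow> ('a \<Rightarrow> real) \<Rightarrow> ('a \<Rightarrow> bool) \<Rightarrow> real" where
  "cond_expectation M X P = integral\<^sup>L (uniform_measure M {\<omega> \<in> space M. P \<omega>}) X"

definition cond_law :: "'a measure \<Rightarrow> ('a \<Rightarrow> nat) \<Rightarrow> ('a \<Rightarrow> bool) \<Rightarrow> nat measure" where
  "cond_law M X P = distr (uniform_measure M {\<omega> \<in> space M. P \<omega>}) (count_space UNIV) X"

text \<open>Total variation distance without the factor 1/2.\<close>

definition d_TV :: "nat measure \<Rightarrow> nat measure \<Rightarrow> real" where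
  "d_TV \<mu> \<nu> = (\<Sum>k. \<bar>measure \<mu> {k} - measure \<nu> {k}\<bar>)"

end

theory Submission imports Defs begin

text \<open>
  Put \<open>t\<^sub>j = \<alpha> j / n\<close>. The number \<open>R\<^sub>n\<close> is the last \<open>j\<close> for which at least \<open>j\<close> of the \<open>p\<close>-values
  are \<open>\<le> t\<^sub>j\<close>, so \<open>R\<^sub>n = k\<close> means that exactly \<open>k\<close> of them are \<open>\<le> t\<^sub>k\<close> and that, for every
  \<open>l \<ge> 1\<close>, fewer than \<open>k + l\<close> are \<open>\<le> t\<^bsub>k+l\<^esub>\<close>. Once the \<open>k\<close> rejected indices are given, the second
  part is a staircase condition on the other \<open>n - k\<close> points alone. Hence
  \<open>P(R\<^sub>n = k) = (n choose k) F(t\<^sub>k)\<^sup>k w\<close>, where the staircase probability \<open>w\<close> is computed cell by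
  cell (\<open>prob_stays_below\<close>). As \<open>w\<close> does not see the marks \<open>\<theta>\<close> of the rejected points,
  \<open>V\<^sub>n\<close> given \<open>R\<^sub>n = k \<ge> 1\<close> is exactly binomial with parameters \<open>k\<close> and
  \<open>(1 - \<pi>) t\<^sub>k / F(t\<^sub>k)\<close> (\<open>prob_R_V_binomial\<close>), and the latter tends to \<open>(1 - \<pi>) / F'(0)\<close>, which
  is \<open>\<beta>\<^sub>*\<close> if \<open>F'(0) = 1 / \<alpha>\<^sub>*\<close>.

  The limit of \<open>P(R\<^sub>n = k)\<close> rests on three facts. Since \<open>n F(t\<^sub>i) \<longlonglongrightarrow> c i\<close>, the numbers of points
  in the first cells become independent Poisson variables with mean \<open>c\<close>
  (\<open>stays_below_prob_tendsto\<close>). Later cells are negligible uniformly in \<open>n\<close>: \<open>\<alpha> F(u) \<le> r u\<close> with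
  \<open>r = \<alpha> / \<alpha>\<^sub>* < 1\<close>, and Chernoff's bound gives a geometric tail
  (\<open>prob_late_crossing_le\<close>). As Poisson counts beyond \<open>t\<^sub>k\<close> start afresh, the two facts yield
  \<open>P(R\<^sub>n = k) - A\<^sub>k P(R\<^sub>n = 0) \<longlonglongrightarrow> 0\<close> with \<open>A\<^sub>k = (c k)\<^sup>k exp (- c k) / k!\<close>. The constant comes from the
  leave-one-out identity behind Simes' inequality: \<open>P(R\<^sub>n = k) = (n F(t\<^sub>k) / k) \<psi>\<^sub>n(k)\<close> for \<open>k \<ge> 1\<close>, where
  \<open>\<psi>\<^sub>n(k)\<close> is the probability of \<open>k\<close> rejections after one \<open>p\<close>-value has been replaced by 0.
  The \<open>\<psi>\<^sub>n(k)\<close> add up to 1 and \<open>n F(t\<^sub>k) / k \<longlonglongrightarrow> c\<close>, so \<open>P(R\<^sub>n \<ge> 1) \<longlonglongrightarrow> c\<close>. Thus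
  \<open>P(R\<^sub>n = k) \<longlonglongrightarrow> (1 - c) A\<^sub>k\<close>, and by tightness these limits add up to 1.

  For the random walk, \<open>\<tau> = k\<close> means that \<open>S\<^sub>k < 0\<close> and that the walk restarted at time \<open>k\<close> stays
  at or above \<open>- S\<^sub>k\<close>. Its first step is exponential, hence memoryless, so staying above a level
  \<open>x \<ge> 0\<close> costs a factor \<open>exp (- x)\<close> compared with staying above 0 (\<open>stay_memoryless\<close>).
  Therefore \<open>P(\<tau> = k) = h E[exp S\<^sub>k; S\<^sub>k < 0]\<close> with \<open>h = P(S\<^sub>j \<ge> 0 for all j \<ge> 1)\<close>, and the Erlang
  density of \<open>\<gamma>\<^sub>1 + \<dots> + \<gamma>\<^sub>k\<close> turns the expectation into the same weight \<open>A\<^sub>k\<close>. Both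
  \<open>h A\<^sub>k\<close> and \<open>(1 - c) A\<^sub>k\<close> add up to 1, so \<open>h = 1 - c\<close>, which is the law of \<open>\<tau>\<close> and the limit law
  of \<open>R\<^sub>n\<close>.

  The other claims follow from tightness of \<open>R\<^sub>n\<close>. The power has a tight numerator, while its
  denominator grows like \<open>\<pi> n\<close>. The pFDR and the averaged total variation distance are averages
  over the law of \<open>R\<^sub>n\<close> of bounded quantities that converge for each fixed value of \<open>R\<^sub>n\<close>
  (\<open>tendsto_tight_sum\<close>).
\<close>

section \<open>The number of rejections as a last crossing\<close>

lemma order_stat_le_iff:
  assumes "1 \<le> j" "j \<le> n"
  shows "order_stat x n j \<le> u \<longleftrightarrow> j \<le> card {i\<in>{..<n}. x i \<le> u}"
proof -
  define ys where "ys = sort (map x [0..<n])"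
  have len: "length ys = n" and srt: "sorted ys" by (auto simp: ys_def)
  have "card {i\<in>{..<n}. x i \<le> u} = length (filter (\<lambda>y. y \<le> u) (map x [0..<n]))"
    by (subst length_filter_conv_card) (auto intro!: arg_cong[where f=card])
  also have "\<dots> = length (filter (\<lambda>y. y \<le> u) ys)"
    unfolding ys_def by (metis mset_filter mset_sort size_mset)
  also have "\<dots> = card {i. i < n \<and> ys ! i \<le> u}"
    by (subst length_filter_conv_card) (auto simp: len)
  finally have c: "card {i\<in>{..<n}. x i \<le> u} = card {i. i < n \<and> ys ! i \<le> u}" .
  have os: "order_stat x n j = ys ! (j - 1)"
    using assms by (simp add: order_stat_def ys_def)
  show ?thesis
  proof
    assume "order_stat x n j \<le> u"
    hence u: "ys ! (j - 1) \<le> u" by (simp add: os)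
    have "{..<j} \<subseteq> {i. i < n \<and> ys ! i \<le> u}"
    proof safe
      fix i assume "i < j"
      thus "i < n" using assms by simp
      have "ys ! i \<le> ys ! (j - 1)" using \<open>i < j\<close> assms len by (intro sorted_nth_mono srt) auto
      thus "ys ! i \<le> u" using u by simp
    qed
    from card_mono[OF _ this] show "j \<le> card {i\<in>{..<n}. x i \<le> u}" unfolding c by simp
  next
    assume j: "j \<le> card {i\<in>{..<n}. x i \<le> u}"
    note j = j[unfolded c]
    show "order_stat x n j \<le> u"
    proof (rule ccontr)
      assume "\<not> order_stat x n j \<le> u"
      hence u: "u < ys ! (j - 1)" by (simp add: os)
      have "{i. i < n \<and> ys ! i \<le> u} \<subseteq> {..<j-1}"
      proof safe
        fix i assume i: "i < n" "ys ! i \<le> u"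
        show "i < j - 1"
        proof (rule ccontr)
          assume "\<not> i < j - 1"
          hence "ys ! (j - 1) \<le> ys ! i" using i len by (intro sorted_nth_mono srt) auto
          thus False using u i by simp
        qed
      qed
      from card_mono[OF _ this] j assms show False by simp
    qed
  qed
qed

text \<open>
  The parameter \<open>m\<close> counts additional points at 0, which lie below every threshold: \<open>m = 0\<close> is
  the procedure itself and \<open>m = 1\<close> the procedure with one \<open>p\<close>-value replaced by 0. Only the \<open>J\<close>
  thresholds after the \<open>k\<close>th are inspected, so that the condition can be truncated.
\<close>
definition crosses_last :: "(nat \<Rightarrow> real) \<Rightarrow> (nat \<Rightarrow> real) \<Rightarrow> nat set \<Rightarrow> nat \<Rightarrow> nat \<Rightarrow> nat \<Rightarrow> bool" where
  "crosses_last t x A m k J \<longleftrightarrow>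
     card {a\<in>A. x a \<le> t k} + m = k \<and> (\<forall>l\<in>{1..J}. card {a\<in>A. x a \<le> t (k + l)} + m < k + l)"

text \<open>
  The last \<open>k\<close> at which the counting function is \<open>\<ge> k\<close> meets the line exactly: a count above
  \<open>k\<close> at the \<open>k\<close>th threshold would be a count \<open>\<ge> k + 1\<close> at the next one.
\<close>
lemma ex1_crosses_last:
  assumes A: "finite A" "card A + m = n" and t: "mono t"
  shows "\<exists>!k. k \<in> {m..n} \<and> crosses_last t x A m k (n - k)"
proof -
  let ?N = "\<lambda>k. card {a\<in>A. x a \<le> t k}"
  define S where "S = {k\<in>{..n}. k \<le> ?N k + m}"
  have S: "finite S" "m \<in> S" using A by (auto simp: S_def)
  define k where "k = Max S"
  have k: "k \<in> S" "m \<le> k" unfolding k_def using S by (auto intro: Max_in Max_ge)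
  have mx: "?N j + m < j" if "j \<in> {k<..n}" for j
  proof (rule ccontr)
    assume "\<not> ?N j + m < j"
    hence "j \<in> S" using that by (auto simp: S_def)
    hence "j \<le> k" unfolding k_def using S by auto
    thus False using that by auto
  qed
  have mono_N: "?N i \<le> ?N j" if "i \<le> j" for i j
    using A monoD[OF t that] by (intro card_mono) auto
  have eq: "?N k + m = k"
  proof (cases "k = n")
    case True
    have "?N k \<le> card A" using A by (intro card_mono) auto
    thus ?thesis using k A True by (auto simp: S_def)
  next
    case False
    hence "?N (Suc k) + m < Suc k" using k by (intro mx) (auto simp: S_def)
    moreover have "?N k \<le> ?N (Suc k)" by (intro mono_N) auto
    ultimately show ?thesis using k by (auto simp: S_def)
  qed
  show ?thesis
  proof (rule ex1I[of _ k])
    show "k \<in> {m..n} \<and> crosses_last t x A m k (n - k)"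
      using k eq mx by (auto simp: crosses_last_def S_def)
  next
    fix j assume j: "j \<in> {m..n} \<and> crosses_last t x A m j (n - j)"
    have "\<not> j > k" using mx[of j] j by (auto simp: crosses_last_def)
    moreover have "\<not> j < k"
    proof
      assume "j < k"
      hence "k - j \<in> {1..n - j}" using k by (auto simp: S_def)
      hence "?N (j + (k - j)) + m < j + (k - j)"
        using j unfolding crosses_last_def by blast
      thus False using eq \<open>j < k\<close> by simp
    qed
    ultimately show "j = k" by simp
  qed
qed

definition threshold :: "real \<Rightarrow> nat \<Rightarrow> nat \<Rightarrow> real" where
  "threshold \<alpha> n j = \<alpha> * real j / real n"

lemma mono_threshold: "0 \<le> \<alpha> \<Longrightarrow> mono (threshold \<alpha> n)"
  by (auto simp: threshold_def mono_def intro!: divide_right_mono mult_left_mono)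

lemma BH_rejections_eq_iff:
  assumes "0 \<le> \<alpha>"
  shows "BH_rejections \<alpha> x n = k \<longleftrightarrow> k \<le> n \<and> crosses_last (threshold \<alpha> n) x {..<n} 0 k (n - k)"
proof -
  let ?N = "\<lambda>k. card {a\<in>{..<n}. x a \<le> threshold \<alpha> n k}"
  define S where "S = {j \<in> {0..n}. order_stat x n j \<le> \<alpha> * real j / real n}"
  have S_iff: "j \<in> S \<longleftrightarrow> j \<le> n \<and> j \<le> ?N j" for j
    using order_stat_le_iff[of j n x "\<alpha> * real j / real n"]
    by (cases "j = 0") (auto simp: S_def order_stat_def threshold_def)
  have S: "finite S" "0 \<in> S" by (auto simp: S_def order_stat_def)
  have R: "BH_rejections \<alpha> x n = Max S" by (simp add: BH_rejections_def S_def)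
  have *: "BH_rejections \<alpha> x n = k" if "k \<le> n" "crosses_last (threshold \<alpha> n) x {..<n} 0 k (n - k)" for k
    unfolding R
  proof (rule Max_eqI)
    show "finite S" "k \<in> S" using S that by (auto simp: S_iff crosses_last_def)
    fix j assume j: "j \<in> S"
    show "j \<le> k"
    proof (rule ccontr)
      assume "\<not> j \<le> k"
      hence "j - k \<in> {1..n - k}" using j by (auto simp: S_iff)
      hence "?N (k + (j - k)) + 0 < k + (j - k)"
        using that(2) unfolding crosses_last_def by blast
      thus False using j \<open>\<not> j \<le> k\<close> by (simp add: S_iff)
    qed
  qed
  show ?thesis
    using ex1_crosses_last[of "{..<n}" 0 n "threshold \<alpha> n" x] mono_threshold[OF assms, of n] *
    by auto
qed

lemma BH_rejections_le: "0 \<le> \<alpha> \<Longrightarrow> BH_rejections \<alpha> x n \<le> n"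
  using BH_rejections_eq_iff[of \<alpha> x n "BH_rejections \<alpha> x n"] by simp

text \<open>
  The procedure rejects up to the \<open>k\<close>th order statistic, which may be strictly below the \<open>k\<close>th
  threshold, but no \<open>p\<close>-value lies between the two because exactly \<open>k\<close> of them are below the threshold.
\<close>
lemma BH_false_rejections_eq:
  assumes "0 \<le> \<alpha>" and k: "BH_rejections \<alpha> x n = k"
  shows "BH_false_rejections \<alpha> x t n = card {j\<in>{..<n}. x j \<le> threshold \<alpha> n k \<and> \<not> t j}"
proof -
  have kn: "k \<le> n" and card: "card {a\<in>{..<n}. x a \<le> threshold \<alpha> n k} = k"
    using BH_rejections_eq_iff[OF assms(1), of x n k] k by (auto simp: crosses_last_def)
  have "{j\<in>{..<n}. x j \<le> order_stat x n k} = {j\<in>{..<n}. x j \<le> threshold \<alpha> n k}"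
  proof (cases "k = 0")
    case False
    have "order_stat x n k \<le> threshold \<alpha> n k"
      using False kn card by (subst order_stat_le_iff) auto
    hence sub: "{j\<in>{..<n}. x j \<le> order_stat x n k} \<subseteq> {j\<in>{..<n}. x j \<le> threshold \<alpha> n k}"
      by auto
    have "k \<le> card {j\<in>{..<n}. x j \<le> order_stat x n k}"
      using order_stat_le_iff[of k n x "order_stat x n k"] False kn by auto
    thus ?thesis using card by (intro card_seteq[OF _ sub]) auto
  qed (auto simp: order_stat_def threshold_def)
  hence "{j\<in>{..<n}. x j \<le> order_stat x n k \<and> \<not> t j} = {j\<in>{..<n}. x j \<le> threshold \<alpha> n k \<and> \<not> t j}"
    by blast
  thus ?thesis by (simp add: BH_false_rejections_def k)
qed

section \<open>Points below a staircase\<close>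

text \<open>
  All points lie beyond \<open>t i\<close>, and their counts stay strictly below a staircase that starts
  at height \<open>s + 1\<close> after one cell and rises by 1 with every further cell.
\<close>
definition stays_below :: "(nat \<Rightarrow> real) \<Rightarrow> (nat \<Rightarrow> real) \<Rightarrow> nat set \<Rightarrow> nat \<Rightarrow> nat \<Rightarrow> nat \<Rightarrow> bool" where
  "stays_below t x A i J s \<longleftrightarrow>
     (\<forall>a\<in>A. t i < x a) \<and> (\<forall>l\<in>{1..J}. card {a\<in>A. x a \<le> t (i + l)} < s + l)"

text \<open>
  The probability of the staircase condition for \<open>m\<close> independent points with distribution
  function \<open>H\<close> at the thresholds. In the recursion \<open>y\<close> of the points fall into the first cell,
  which lowers the remaining slack from \<open>s\<close> to \<open>s - y\<close> and then raises it by 1.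
\<close>
fun stays_below_prob :: "(nat \<Rightarrow> real) \<Rightarrow> nat \<Rightarrow> nat \<Rightarrow> nat \<Rightarrow> nat \<Rightarrow> real" where
  "stays_below_prob H m i 0 s = (1 - H i) ^ m"
| "stays_below_prob H m i (Suc J) s =
     (\<Sum>y\<le>s. real (m choose y) * (H (Suc i) - H i) ^ y * stays_below_prob H (m - y) (Suc i) J (Suc (s - y)))"

lemma stays_below_Suc_iff:
  assumes "finite A" "mono t"
  shows "stays_below t x A i (Suc J) s \<longleftrightarrow>
    (\<exists>B. B \<subseteq> A \<and> card B \<le> s \<and> (\<forall>a\<in>B. t i < x a \<and> x a \<le> t (Suc i)) \<and>
         stays_below t x (A - B) (Suc i) J (Suc (s - card B)))" (is "?L \<longleftrightarrow> ?R")
proof -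
  have split: "card {a\<in>A. x a \<le> t (i + Suc l)} = card B + card {a\<in>A - B. x a \<le> t (Suc i + l)}"
    if "B \<subseteq> A" "\<forall>a\<in>B. x a \<le> t (Suc i)" for B l
  proof -
    have "t (Suc i) \<le> t (i + Suc l)" using assms by (intro monoD[of t]) auto
    hence "{a\<in>A. x a \<le> t (i + Suc l)} = B \<union> {a\<in>A - B. x a \<le> t (Suc i + l)}"
      using that by force
    thus ?thesis using assms that finite_subset[of B A] by (auto intro!: card_Un_disjoint)
  qed
  show ?thesis
  proof
    assume L: ?L
    define B where "B = {a\<in>A. x a \<le> t (Suc i)}"
    have B: "B \<subseteq> A" "\<forall>a\<in>B. t i < x a \<and> x a \<le> t (Suc i)" using L by (auto simp: B_def stays_below_def)
    have cB: "card B \<le> s" using L unfolding stays_below_def B_def by (auto dest: bspec[of _ _ 1])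
    have "stays_below t x (A - B) (Suc i) J (Suc (s - card B))"
      unfolding stays_below_def
    proof (intro conjI ballI)
      fix a assume "a \<in> A - B" thus "t (Suc i) < x a" by (auto simp: B_def)
    next
      fix l assume "l \<in> {1..J}"
      hence "Suc l \<in> {1..Suc J}" by auto
      hence "card {a\<in>A. x a \<le> t (i + Suc l)} < s + Suc l" using L unfolding stays_below_def by blast
      thus "card {a\<in>A - B. x a \<le> t (Suc i + l)} < Suc (s - card B) + l"
        using split[OF B(1), of l] B(2) cB by (auto simp del: Collect_conj_eq)
    qed
    thus ?R using B cB by blast
  next
    assume ?R
    then obtain B where B: "B \<subseteq> A" "card B \<le> s" "\<forall>a\<in>B. t i < x a \<and> x a \<le> t (Suc i)"
      and sp: "stays_below t x (A - B) (Suc i) J (Suc (s - card B))" by blast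
    have ti: "t i \<le> t (Suc i)" using assms by (intro monoD[of t]) auto
    show ?L unfolding stays_below_def
    proof (intro conjI ballI)
      fix a assume a: "a \<in> A"
      show "t i < x a"
      proof (cases "a \<in> B")
        case False
        hence "t (Suc i) < x a" using a sp by (simp add: stays_below_def)
        thus ?thesis using ti by simp
      qed (use B in blast)
    next
      fix l assume l: "l \<in> {1..Suc J}"
      then obtain l' where l': "l = Suc l'" by (cases l) auto
      have "card {a\<in>A - B. x a \<le> t (Suc i + l')} < Suc (s - card B) + l'"
      proof (cases "l' = 0")
        case True
        have "\<forall>a\<in>A - B. \<not> x a \<le> t (Suc i)" using sp by (auto simp: stays_below_def not_le)
        hence "{a\<in>A - B. x a \<le> t (Suc i + l')} = {}" using True by auto
        thus ?thesis by (simp only: card.empty)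
      next
        case False
        thus ?thesis using sp l l' unfolding stays_below_def by auto
      qed
      thus "card {a\<in>A. x a \<le> t (i + l)} < s + l"
        using split[OF B(1), of l'] B(2,3) unfolding l' by auto
    qed
  qed
qed

text \<open>
  The set of points in the first cell is determined by the configuration. This makes the
  decompositions over that set below disjoint.
\<close>
lemma stays_below_unique:
  assumes "B \<subseteq> A" "\<forall>a\<in>B. x a \<le> t i" "stays_below t x (A - B) i J s"
  shows "B = {a\<in>A. x a \<le> t i}"
proof -
  have "\<forall>a\<in>A - B. \<not> x a \<le> t i" using assms(3) by (auto simp: stays_below_def not_le)
  thus ?thesis using assms(1,2) by blast
qed

lemma crosses_last_iff_stays_below:
  assumes "finite A" "m \<le> k" and t: "mono t"
  shows "crosses_last t x A m k J \<longleftrightarrow>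
    (\<exists>B. B \<subseteq> A \<and> card B = k - m \<and> (\<forall>a\<in>B. x a \<le> t k) \<and> stays_below t x (A - B) k J 0)" (is "?L \<longleftrightarrow> ?R")
proof -
  have split: "card {a\<in>A. x a \<le> t (k + l)} = card B + card {a\<in>A - B. x a \<le> t (k + l)}"
    if "B \<subseteq> A" "\<forall>a\<in>B. x a \<le> t k" for B l
  proof -
    have "t k \<le> t (k + l)" using t by (intro monoD[of t]) auto
    hence "{a\<in>A. x a \<le> t (k + l)} = B \<union> {a\<in>A - B. x a \<le> t (k + l)}"
      using that by force
    thus ?thesis using assms that finite_subset[of B A] by (auto intro!: card_Un_disjoint)
  qed
  show ?thesis
  proof
    assume L: ?L
    define B where "B = {a\<in>A. x a \<le> t k}"
    have B: "B \<subseteq> A" "\<forall>a\<in>B. x a \<le> t k" "card B = k - m"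
      using L by (auto simp: B_def crosses_last_def)
    have "stays_below t x (A - B) k J 0"
      unfolding stays_below_def
    proof (intro conjI ballI)
      fix a assume "a \<in> A - B" thus "t k < x a" by (auto simp: B_def)
    next
      fix l assume "l \<in> {1..J}"
      hence "card {a\<in>A. x a \<le> t (k + l)} + m < k + l" using L unfolding crosses_last_def by auto
      thus "card {a\<in>A - B. x a \<le> t (k + l)} < 0 + l"
        using split[OF B(1,2), of l] B(3) assms by linarith
    qed
    thus ?R using B by blast
  next
    assume ?R
    then obtain B where B: "B \<subseteq> A" "card B = k - m" "\<forall>a\<in>B. x a \<le> t k"
      and sp: "stays_below t x (A - B) k J 0" by blast
    have "\<forall>a\<in>A - B. \<not> x a \<le> t k" using sp by (auto simp: stays_below_def not_le)
    hence "{a\<in>A - B. x a \<le> t k} = {}" by auto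
    hence cB: "card {a\<in>A. x a \<le> t k} = card B"
      using split[OF B(1,3), of 0] by (simp only: add_0_right card.empty)
    show ?L unfolding crosses_last_def
    proof (intro conjI ballI)
      show "card {a\<in>A. x a \<le> t k} + m = k" using cB B assms by simp
      fix l assume "l \<in> {1..J}"
      hence "card {a\<in>A - B. x a \<le> t (k + l)} < l" using sp by (simp add: stays_below_def)
      thus "card {a\<in>A. x a \<le> t (k + l)} + m < k + l"
        using split[OF B(1,3), of l] B(2) assms by linarith
    qed
  qed
qed

section \<open>Counting events in the random effects model\<close>

lemma sum_card_subsets:
  fixes \<phi> :: "nat \<Rightarrow> real"
  assumes "finite A"
  shows "(\<Sum>D | D \<subseteq> A \<and> card D \<le> s. \<phi> (card D)) = (\<Sum>y\<le>s. real (card A choose y) * \<phi> y)"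
proof -
  have "(\<Sum>D | D \<subseteq> A \<and> card D \<le> s. \<phi> (card D)) = (\<Sum>y\<le>s. \<Sum>D | D \<subseteq> A \<and> card D = y. \<phi> (card D))"
    using assms
    by (subst sum.UNION_disjoint[symmetric]) (auto intro!: sum.cong)
  also have "\<dots> = (\<Sum>y\<le>s. real (card A choose y) * \<phi> y)"
    using n_subsets[OF assms] by (intro sum.cong) (auto simp: sum_constant)
  finally show ?thesis .
qed

lemma measurable_card_Collect:
  assumes "finite A" "\<And>a. a \<in> A \<Longrightarrow> Measurable.pred M (P a)"
  shows "(\<lambda>\<omega>. card {a\<in>A. P a \<omega>}) \<in> measurable M (count_space UNIV)"
proof -
  have "card {a\<in>A. P a \<omega>} = (\<Sum>a\<in>A. if P a \<omega> then 1 else 0)" for \<omega>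
    using assms(1) by (simp add: sum.If_cases Int_def)
  moreover have "(\<lambda>\<omega>. \<Sum>a\<in>A. if P a \<omega> then 1 else (0::nat)) \<in> measurable M (count_space UNIV)"
    using assms by (intro measurable_sum_nat measurable_If) auto
  ultimately show ?thesis by simp
qed

context random_effects_model
begin

lemma p_\<theta>_measurable:
  "(\<lambda>\<omega>. (p j \<omega>, \<theta> j \<omega>)) \<in> M \<rightarrow>\<^sub>M borel \<Otimes>\<^sub>M count_space UNIV"
  using indep by (simp add: indep_vars_def)

lemma p_measurable [measurable]: "p j \<in> borel_measurable M"
  using measurable_compose[OF p_\<theta>_measurable measurable_fst] by simp

lemma \<theta>_measurable [measurable]: "Measurable.pred M (\<theta> j)"
  using measurable_compose[OF p_\<theta>_measurable measurable_snd] by simp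

lemma prob_not_false_null: "prob {\<omega>\<in>space M. \<not> \<theta> j \<omega>} = 1 - \<pi>"
  using prob_neg[of "\<theta> j"] prob_false_null[of j] by simp

lemma prob_p_le_true_null:
  assumes "u \<in> {0..1}" shows "prob {\<omega>\<in>space M. p j \<omega> \<le> u \<and> \<not> \<theta> j \<omega>} = (1 - \<pi>) * u"
  using cdf_true_null[OF assms, of j] \<pi>_range prob_not_false_null[of j]
  by (simp add: cond_prob_def field_simps)

lemma prob_p_le_false_null:
  assumes "u \<in> {0..1}" shows "prob {\<omega>\<in>space M. p j \<omega> \<le> u \<and> \<theta> j \<omega>} = \<pi> * G u"
  using cdf_false_null[OF assms, of j] \<pi>_range prob_false_null[of j]
  by (simp add: cond_prob_def field_simps)

lemma prob_p_le:
  assumes "u \<in> {0..1}" shows "prob {\<omega>\<in>space M. p j \<omega> \<le> u} = mixture_cdf \<pi> G u"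
proof -
  have "prob {\<omega>\<in>space M. p j \<omega> \<le> u} = prob ({\<omega>\<in>space M. p j \<omega> \<le> u \<and> \<not> \<theta> j \<omega>} \<union> {\<omega>\<in>space M. p j \<omega> \<le> u \<and> \<theta> j \<omega>})"
    by (rule arg_cong[where f=prob]) auto
  also have "\<dots> = mixture_cdf \<pi> G u"
    by (subst finite_measure_Union)
       (auto simp: mixture_cdf_def prob_p_le_true_null[OF assms] prob_p_le_false_null[OF assms])
  finally show ?thesis .
qed

lemma G_nonneg: "u \<in> {0..1} \<Longrightarrow> 0 \<le> G u"
  using cdf_false_null[of u 0] by (metis cond_prob_def divide_nonneg_nonneg measure_nonneg)

lemma mixture_cdf_ge: "u \<in> {0..1} \<Longrightarrow> (1 - \<pi>) * u \<le> mixture_cdf \<pi> G u"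
  using G_nonneg[of u] \<pi>_range by (simp add: mixture_cdf_def)

lemma mixture_cdf_1: "mixture_cdf \<pi> G 1 = 1"
proof -
  have "{\<omega>\<in>space M. p 0 \<omega> \<le> 1} = space M" using p_range[of _ 0] by auto
  thus ?thesis using prob_p_le[of 1 0] by (simp add: prob_space)
qed

lemma prob_all_in:
  assumes "finite B" "\<And>b. b \<in> B \<Longrightarrow> C b \<in> sets (borel \<Otimes>\<^sub>M count_space UNIV)"
  shows "prob {\<omega>\<in>space M. \<forall>b\<in>B. (p b \<omega>, \<theta> b \<omega>) \<in> C b} =
         (\<Prod>b\<in>B. prob {\<omega>\<in>space M. (p b \<omega>, \<theta> b \<omega>) \<in> C b})"
proof (cases "B = {}")
  case False
  have "prob (\<Inter>b\<in>B. (\<lambda>\<omega>. (p b \<omega>, \<theta> b \<omega>)) -` C b \<inter> space M) =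
        (\<Prod>b\<in>B. prob ((\<lambda>\<omega>. (p b \<omega>, \<theta> b \<omega>)) -` C b \<inter> space M))"
    using assms False by (intro indep_varsD[OF indep]) auto
  moreover have "(\<Inter>b\<in>B. (\<lambda>\<omega>. (p b \<omega>, \<theta> b \<omega>)) -` C b \<inter> space M) = {\<omega>\<in>space M. \<forall>b\<in>B. (p b \<omega>, \<theta> b \<omega>) \<in> C b}"
    using False by auto
  moreover have "(\<lambda>\<omega>. (p b \<omega>, \<theta> b \<omega>)) -` C b \<inter> space M = {\<omega>\<in>space M. (p b \<omega>, \<theta> b \<omega>) \<in> C b}" for b
    by auto
  ultimately show ?thesis by simp
qed (simp add: prob_space)

lemma pred_in_cell:
  "C \<in> sets (borel \<Otimes>\<^sub>M count_space UNIV) \<Longrightarrow> Measurable.pred M (\<lambda>\<omega>. (p b \<omega>, \<theta> b \<omega>) \<in> C)"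
  using pred_sets2[OF _ p_\<theta>_measurable[of b]] by simp

lemma pred_stays_below:
  assumes "finite A"
  shows "Measurable.pred M (\<lambda>\<omega>. stays_below t (\<lambda>j. p j \<omega>) A i J s)"
proof -
  have [measurable]: "(\<lambda>\<omega>. card {a\<in>A. p a \<omega> \<le> u}) \<in> measurable M (count_space UNIV)" for u
    using assms by (intro measurable_card_Collect) auto
  have [measurable]: "Measurable.pred M (\<lambda>\<omega>. card {a\<in>A. p a \<omega> \<le> u} < w)" for u w
    by measurable
  have "countable A" using assms by (simp add: countable_finite)
  thus ?thesis unfolding stays_below_def using assms
    by (intro pred_intros_logic pred_intros_countable_bounded pred_intros_finite) auto
qed

text \<open>
  The staircase probabilities are computed together with arbitrary events \<open>C b\<close> for finitely many
  other indices \<open>b \<in> B\<close>. This extra factor is what makes the recursion work: the points found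
  in one cell join \<open>B\<close>, and independence is used only for events of product form.
\<close>
lemma prob_stays_below_0:
  assumes t: "mono t" and A: "finite A" and B: "finite B" and AB: "A \<inter> B = {}"
    and C: "\<And>b. b \<in> B \<Longrightarrow> C b \<in> sets (borel \<Otimes>\<^sub>M count_space UNIV)"
    and H: "\<And>l j. l \<le> i + 0 \<Longrightarrow> prob {\<omega>\<in>space M. p j \<omega> \<le> t l} = H l"
  shows "prob {\<omega>\<in>space M. (\<forall>b\<in>B. (p b \<omega>, \<theta> b \<omega>) \<in> C b) \<and> stays_below t (\<lambda>j. p j \<omega>) A i 0 s} =
    (\<Prod>b\<in>B. prob {\<omega>\<in>space M. (p b \<omega>, \<theta> b \<omega>) \<in> C b}) * stays_below_prob H (card A) i 0 s"
proof -
  define C' where "C' b = (if b \<in> B then C b else {t i<..} \<times> UNIV)" for b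
  have "(\<forall>b\<in>B \<union> A. (p b \<omega>, \<theta> b \<omega>) \<in> C' b) \<longleftrightarrow>
     (\<forall>b\<in>B. (p b \<omega>, \<theta> b \<omega>) \<in> C b) \<and> (\<forall>a\<in>A. t i < p a \<omega>)" for \<omega>
    unfolding ball_Un C'_def using AB by (intro arg_cong2[where f="(\<and>)"] ball_cong) auto
  hence "{\<omega>\<in>space M. (\<forall>b\<in>B. (p b \<omega>, \<theta> b \<omega>) \<in> C b) \<and> stays_below t (\<lambda>j. p j \<omega>) A i 0 s} =
        {\<omega>\<in>space M. \<forall>b\<in>B \<union> A. (p b \<omega>, \<theta> b \<omega>) \<in> C' b}"
    by (simp add: stays_below_def)
  also have "prob \<dots> = (\<Prod>b\<in>B \<union> A. prob {\<omega>\<in>space M. (p b \<omega>, \<theta> b \<omega>) \<in> C' b})"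
    using A B C by (intro prob_all_in) (auto simp: C'_def)
  also have "\<dots> = (\<Prod>b\<in>B. prob {\<omega>\<in>space M. (p b \<omega>, \<theta> b \<omega>) \<in> C' b}) * (\<Prod>b\<in>A. prob {\<omega>\<in>space M. (p b \<omega>, \<theta> b \<omega>) \<in> C' b})"
    using A B AB by (intro prod.union_disjoint) auto
  also have "(\<Prod>b\<in>B. prob {\<omega>\<in>space M. (p b \<omega>, \<theta> b \<omega>) \<in> C' b}) = (\<Prod>b\<in>B. prob {\<omega>\<in>space M. (p b \<omega>, \<theta> b \<omega>) \<in> C b})"
    by (intro prod.cong) (auto simp: C'_def)
  also have "(\<Prod>b\<in>A. prob {\<omega>\<in>space M. (p b \<omega>, \<theta> b \<omega>) \<in> C' b}) = (\<Prod>b\<in>A. 1 - H i)"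
  proof (intro prod.cong refl)
    fix b assume b: "b \<in> A"
    hence "{\<omega>\<in>space M. (p b \<omega>, \<theta> b \<omega>) \<in> C' b} = {\<omega>\<in>space M. \<not> p b \<omega> \<le> t i}"
      using AB by (auto simp: C'_def)
    also have "prob \<dots> = 1 - prob {\<omega>\<in>space M. p b \<omega> \<le> t i}" by (rule prob_neg) measurable
    finally show "prob {\<omega>\<in>space M. (p b \<omega>, \<theta> b \<omega>) \<in> C' b} = 1 - H i"
      using H[of i b] by simp
  qed
  finally show ?thesis by (simp only: prod_constant stays_below_prob.simps)
qed

lemma prob_stays_below_Suc:
  assumes t: "mono t" and A: "finite A" and B: "finite B" and AB: "A \<inter> B = {}"
    and C: "\<And>b. b \<in> B \<Longrightarrow> C b \<in> sets (borel \<Otimes>\<^sub>M count_space UNIV)"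
    and H: "\<And>l j. l \<le> i + Suc J \<Longrightarrow> prob {\<omega>\<in>space M. p j \<omega> \<le> t l} = H l"
    and IH: "\<And>A B C i s. finite A \<Longrightarrow> finite B \<Longrightarrow> A \<inter> B = {} \<Longrightarrow>
      (\<And>b. b \<in> B \<Longrightarrow> C b \<in> sets (borel \<Otimes>\<^sub>M count_space UNIV)) \<Longrightarrow>
      (\<And>l j. l \<le> i + J \<Longrightarrow> prob {\<omega>\<in>space M. p j \<omega> \<le> t l} = H l) \<Longrightarrow>
      prob {\<omega>\<in>space M. (\<forall>b\<in>B. (p b \<omega>, \<theta> b \<omega>) \<in> C b) \<and> stays_below t (\<lambda>j. p j \<omega>) A i J s} =
    (\<Prod>b\<in>B. prob {\<omega>\<in>space M. (p b \<omega>, \<theta> b \<omega>) \<in> C b}) * stays_below_prob H (card A) i J s"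
  shows "prob {\<omega>\<in>space M. (\<forall>b\<in>B. (p b \<omega>, \<theta> b \<omega>) \<in> C b) \<and> stays_below t (\<lambda>j. p j \<omega>) A i (Suc J) s} =
    (\<Prod>b\<in>B. prob {\<omega>\<in>space M. (p b \<omega>, \<theta> b \<omega>) \<in> C b}) * stays_below_prob H (card A) i (Suc J) s"
proof -
  define U where "U = {D. D \<subseteq> A \<and> card D \<le> s}"
  define C' where "C' b = (if b \<in> B then C b else {t i<..t (Suc i)} \<times> UNIV)" for b
  define E where "E D = {\<omega>\<in>space M. (\<forall>b\<in>B \<union> D. (p b \<omega>, \<theta> b \<omega>) \<in> C' b) \<and>
    stays_below t (\<lambda>j. p j \<omega>) (A - D) (Suc i) J (Suc (s - card D))}" for D
  have finU: "finite U" unfolding U_def using A by simp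
  have fin: "finite D" if "D \<in> U" for D using that A finite_subset by (auto simp: U_def)
  have C': "C' b \<in> sets (borel \<Otimes>\<^sub>M count_space UNIV)" for b
    using C by (auto simp: C'_def)
  have E_sets: "E D \<in> sets M" if "D \<in> U" for D
  proof -
    have "Measurable.pred M (\<lambda>\<omega>. (\<forall>b\<in>B \<union> D. (p b \<omega>, \<theta> b \<omega>) \<in> C' b) \<and>
      stays_below t (\<lambda>j. p j \<omega>) (A - D) (Suc i) J (Suc (s - card D)))"
      using A B fin[OF that]
      by (intro pred_intros_logic pred_intros_finite pred_in_cell C' pred_stays_below) auto
    thus ?thesis by (auto simp: E_def pred_def)
  qed
  have C'_iff: "(\<forall>b\<in>B \<union> D. (p b \<omega>, \<theta> b \<omega>) \<in> C' b) \<longleftrightarrow>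
     (\<forall>b\<in>B. (p b \<omega>, \<theta> b \<omega>) \<in> C b) \<and> (\<forall>a\<in>D. t i < p a \<omega> \<and> p a \<omega> \<le> t (Suc i))" if "D \<in> U" for D \<omega>
    unfolding ball_Un C'_def using that AB
    by (intro arg_cong2[where f="(\<and>)"] ball_cong) (auto simp: U_def)
  have E_eq: "E D = {\<omega>\<in>space M. ((\<forall>b\<in>B. (p b \<omega>, \<theta> b \<omega>) \<in> C b) \<and> (\<forall>a\<in>D. t i < p a \<omega> \<and> p a \<omega> \<le> t (Suc i))) \<and>
    stays_below t (\<lambda>j. p j \<omega>) (A - D) (Suc i) J (Suc (s - card D))}" if "D \<in> U" for D
    unfolding E_def C'_iff[OF that] ..
  have disj: "disjoint_family_on E U"
    unfolding disjoint_family_on_def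
  proof (intro ballI impI)
    fix D D' assume D: "D \<in> U" "D' \<in> U" "D \<noteq> D'"
    show "E D \<inter> E D' = {}"
    proof (rule ccontr)
      assume "E D \<inter> E D' \<noteq> {}"
      then obtain \<omega> where w: "\<omega> \<in> E D" "\<omega> \<in> E D'" by auto
      have "D = {a\<in>A. p a \<omega> \<le> t (Suc i)}"
        using D(1) w(1) unfolding E_eq[OF D(1)]
        by (intro stays_below_unique[of _ _ "\<lambda>j. p j \<omega>"]) (auto simp: U_def)
      moreover have "D' = {a\<in>A. p a \<omega> \<le> t (Suc i)}"
        using D(2) w(2) unfolding E_eq[OF D(2)]
        by (intro stays_below_unique[of _ _ "\<lambda>j. p j \<omega>"]) (auto simp: U_def)
      ultimately show False using D by simp
    qed
  qed
  have "{\<omega>\<in>space M. (\<forall>b\<in>B. (p b \<omega>, \<theta> b \<omega>) \<in> C b) \<and> stays_below t (\<lambda>j. p j \<omega>) A i (Suc J) s} = (\<Union>D\<in>U. E D)"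
    unfolding stays_below_Suc_iff[OF A t] using E_eq by (auto simp: U_def)
  also have "prob \<dots> = (\<Sum>D\<in>U. prob (E D))"
    using finU disj E_sets by (intro finite_measure_finite_Union) auto
  also have "\<dots> = (\<Sum>D\<in>U. (\<Prod>b\<in>B. prob {\<omega>\<in>space M. (p b \<omega>, \<theta> b \<omega>) \<in> C b}) *
     ((H (Suc i) - H i) ^ card D * stays_below_prob H (card A - card D) (Suc i) J (Suc (s - card D))))"
  proof (intro sum.cong refl)
    fix D assume D: "D \<in> U"
    have "prob (E D) = (\<Prod>b\<in>B \<union> D. prob {\<omega>\<in>space M. (p b \<omega>, \<theta> b \<omega>) \<in> C' b}) *
        stays_below_prob H (card (A - D)) (Suc i) J (Suc (s - card D))"
      unfolding E_def
    proof (rule IH)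
      show "(A - D) \<inter> (B \<union> D) = {}" using AB by blast
    qed (use A B fin[OF D] C' in auto, rule H, simp)
    also have "(\<Prod>b\<in>B \<union> D. prob {\<omega>\<in>space M. (p b \<omega>, \<theta> b \<omega>) \<in> C' b}) =
      (\<Prod>b\<in>B. prob {\<omega>\<in>space M. (p b \<omega>, \<theta> b \<omega>) \<in> C' b}) * (\<Prod>b\<in>D. prob {\<omega>\<in>space M. (p b \<omega>, \<theta> b \<omega>) \<in> C' b})"
      using A B AB fin[OF D] D by (intro prod.union_disjoint) (auto simp: U_def)
    also have "(\<Prod>b\<in>B. prob {\<omega>\<in>space M. (p b \<omega>, \<theta> b \<omega>) \<in> C' b}) = (\<Prod>b\<in>B. prob {\<omega>\<in>space M. (p b \<omega>, \<theta> b \<omega>) \<in> C b})"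
      by (intro prod.cong) (auto simp: C'_def)
    also have "(\<Prod>b\<in>D. prob {\<omega>\<in>space M. (p b \<omega>, \<theta> b \<omega>) \<in> C' b}) = (\<Prod>b\<in>D. H (Suc i) - H i)"
    proof (intro prod.cong refl)
      fix b assume "b \<in> D"
      hence b: "b \<notin> B" using D AB by (auto simp: U_def)
      have ti: "t i \<le> t (Suc i)" using t by (intro monoD[of t]) auto
      have "{\<omega>\<in>space M. (p b \<omega>, \<theta> b \<omega>) \<in> C' b} = {\<omega>\<in>space M. p b \<omega> \<le> t (Suc i)} - {\<omega>\<in>space M. p b \<omega> \<le> t i}"
        using b by (auto simp: C'_def)
      also have "prob \<dots> = prob {\<omega>\<in>space M. p b \<omega> \<le> t (Suc i)} - prob {\<omega>\<in>space M. p b \<omega> \<le> t i}"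
        using ti by (intro finite_measure_Diff) auto
      also have "\<dots> = H (Suc i) - H i" using H[of "Suc i" b] H[of i b] by simp
      finally show "prob {\<omega>\<in>space M. (p b \<omega>, \<theta> b \<omega>) \<in> C' b} = H (Suc i) - H i" .
    qed
    also have "card (A - D) = card A - card D"
      using D fin[OF D] by (intro card_Diff_subset) (auto simp: U_def)
    finally show "prob (E D) = (\<Prod>b\<in>B. prob {\<omega>\<in>space M. (p b \<omega>, \<theta> b \<omega>) \<in> C b}) *
     ((H (Suc i) - H i) ^ card D * stays_below_prob H (card A - card D) (Suc i) J (Suc (s - card D)))"
      by simp
  qed
  also have "\<dots> = (\<Prod>b\<in>B. prob {\<omega>\<in>space M. (p b \<omega>, \<theta> b \<omega>) \<in> C b}) * 
     (\<Sum>D\<in>U. (H (Suc i) - H i) ^ card D * stays_below_prob H (card A - card D) (Suc i) J (Suc (s - card D)))"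
    by (simp add: sum_distrib_left)
  also have "(\<Sum>D\<in>U. (H (Suc i) - H i) ^ card D * stays_below_prob H (card A - card D) (Suc i) J (Suc (s - card D)))
      = stays_below_prob H (card A) i (Suc J) s"
    unfolding U_def using sum_card_subsets[OF A, where s = s and
      \<phi> = "\<lambda>y. (H (Suc i) - H i) ^ y * stays_below_prob H (card A - y) (Suc i) J (Suc (s - y))"]
    by (simp add: mult.assoc)
  finally show ?thesis .
qed

lemma prob_stays_below:
  assumes t: "mono t" and A: "finite A" and B: "finite B" and AB: "A \<inter> B = {}"
    and C: "\<And>b. b \<in> B \<Longrightarrow> C b \<in> sets (borel \<Otimes>\<^sub>M count_space UNIV)"
    and H: "\<And>l j. l \<le> i + J \<Longrightarrow> prob {\<omega>\<in>space M. p j \<omega> \<le> t l} = H l"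
  shows "prob {\<omega>\<in>space M. (\<forall>b\<in>B. (p b \<omega>, \<theta> b \<omega>) \<in> C b) \<and> stays_below t (\<lambda>j. p j \<omega>) A i J s} =
    (\<Prod>b\<in>B. prob {\<omega>\<in>space M. (p b \<omega>, \<theta> b \<omega>) \<in> C b}) * stays_below_prob H (card A) i J s"
  using A B AB C H
proof (induction J arbitrary: A B C i s)
  case 0
  show ?case by (rule prob_stays_below_0[OF t]) (use 0 in auto)
next
  case (Suc J)
  show ?case by (rule prob_stays_below_Suc[OF t Suc.prems Suc.IH])
qed

text \<open>
  For a fixed set of points below \<open>t k\<close> and a fixed subset of true nulls among them, the event has
  product form, and its probability depends on the two cardinalities only.
\<close>
lemma prob_crosses_last_joint:
  assumes t: "mono t" and A: "finite A" and mk: "m \<le> k"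
    and H: "\<And>l j. l \<le> k + J \<Longrightarrow> prob {\<omega>\<in>space M. p j \<omega> \<le> t l} = H l"
    and a: "\<And>j. prob {\<omega>\<in>space M. p j \<omega> \<le> t k \<and> \<not> \<theta> j \<omega>} = a"
    and b: "\<And>j. prob {\<omega>\<in>space M. p j \<omega> \<le> t k \<and> \<theta> j \<omega>} = b"
  shows "prob {\<omega>\<in>space M. crosses_last t (\<lambda>j. p j \<omega>) A m k J \<and> card {j\<in>A. p j \<omega> \<le> t k \<and> \<not> \<theta> j \<omega>} = v} =
    real (card A choose (k - m)) * (real (k - m choose v) * a ^ v * b ^ (k - m - v)) *
    stays_below_prob H (card A - (k - m)) k J 0"
proof -
  define S where "S = Sigma {B. B \<subseteq> A \<and> card B = k - m} (\<lambda>B. {D. D \<subseteq> B \<and> card D = v})"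
  define C where "C D j = {..t k} \<times> (if j \<in> D then {False} else {True})" for D and j :: nat
  define E where "E X = {\<omega>\<in>space M. (\<forall>j\<in>fst X. (p j \<omega>, \<theta> j \<omega>) \<in> C (snd X) j) \<and>
    stays_below t (\<lambda>j. p j \<omega>) (A - fst X) k J 0}" for X
  have finS: "finite {B. B \<subseteq> A \<and> card B = k - m}" using A by simp
  have finD: "finite {D. D \<subseteq> B \<and> card D = v}" if "B \<subseteq> A" for B
    using finite_subset[OF that A] by simp
  have S_fin: "finite S" unfolding S_def using finS finD by (intro finite_SigmaI) auto
  have S_D: "B \<subseteq> A" "card B = k - m" "D \<subseteq> B" "card D = v" "finite B" "finite D" if "(B, D) \<in> S" for B D
    using that A finite_subset[of B A] finite_subset[of D B] by (auto simp: S_def)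
  have C: "C D j \<in> sets (borel \<Otimes>\<^sub>M count_space UNIV)" for D j by (auto simp: C_def)
  have E_unique: "B = {j\<in>A. p j \<omega> \<le> t k}" "D = {j\<in>A. p j \<omega> \<le> t k \<and> \<not> \<theta> j \<omega>}"
    if "(B, D) \<in> S" "\<omega> \<in> E (B, D)" for B D \<omega>
  proof -
    have *: "\<forall>j\<in>B. (p j \<omega>, \<theta> j \<omega>) \<in> C D j" "stays_below t (\<lambda>j. p j \<omega>) (A - B) k J 0"
      using that(2) by (auto simp: E_def)
    have **: "p j \<omega> \<le> t k \<and> (j \<in> D \<longleftrightarrow> \<not> \<theta> j \<omega>)" if "j \<in> B" for j
      using *(1) that by (auto simp: C_def split: if_splits)
    show B: "B = {j\<in>A. p j \<omega> \<le> t k}"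
      using S_D[OF that(1)] ** *(2) by (intro stays_below_unique) auto
    show "D = {j\<in>A. p j \<omega> \<le> t k \<and> \<not> \<theta> j \<omega>}"
      using S_D[OF that(1)] ** B by blast
  qed
  have E_sets: "E X \<in> sets M" if "X \<in> S" for X
  proof -
    have "Measurable.pred M (\<lambda>\<omega>. (\<forall>j\<in>fst X. (p j \<omega>, \<theta> j \<omega>) \<in> C (snd X) j) \<and>
      stays_below t (\<lambda>j. p j \<omega>) (A - fst X) k J 0)"
      using A S_D[of "fst X" "snd X"] that
      by (intro pred_intros_logic pred_intros_finite pred_in_cell C pred_stays_below) auto
    thus ?thesis by (auto simp: E_def pred_def)
  qed
  have disj: "disjoint_family_on E S"
    unfolding disjoint_family_on_def
  proof (intro ballI impI)
    fix X Y assume X: "X \<in> S" "Y \<in> S" "X \<noteq> Y"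
    show "E X \<inter> E Y = {}"
    proof (rule ccontr)
      assume "E X \<inter> E Y \<noteq> {}"
      then obtain \<omega> where w: "\<omega> \<in> E X" "\<omega> \<in> E Y" by auto
      obtain B D B' D' where XY: "X = (B, D)" "Y = (B', D')" by (cases X, cases Y)
      have "B = B'" using E_unique(1)[of B D \<omega>] E_unique(1)[of B' D' \<omega>] X w unfolding XY by metis
      moreover have "D = D'" using E_unique(2)[of B D \<omega>] E_unique(2)[of B' D' \<omega>] X w unfolding XY by metis
      ultimately show False using X(3) XY by simp
    qed
  qed
  have "{\<omega>\<in>space M. crosses_last t (\<lambda>j. p j \<omega>) A m k J \<and> card {j\<in>A. p j \<omega> \<le> t k \<and> \<not> \<theta> j \<omega>} = v}
      = (\<Union>X\<in>S. E X)" (is "?L = ?R")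
  proof (intro equalityI subsetI)
    fix \<omega> assume w: "\<omega> \<in> ?L"
    then obtain B where B: "B \<subseteq> A" "card B = k - m" "\<forall>j\<in>B. p j \<omega> \<le> t k"
      "stays_below t (\<lambda>j. p j \<omega>) (A - B) k J 0"
      using crosses_last_iff_stays_below[OF A mk t] by auto
    have Beq: "B = {j\<in>A. p j \<omega> \<le> t k}" by (rule stays_below_unique[OF B(1,3,4)])
    define D where "D = {j\<in>A. p j \<omega> \<le> t k \<and> \<not> \<theta> j \<omega>}"
    have DB: "D \<subseteq> B" "card D = v" using w Beq by (simp_all add: D_def) blast
    hence "(B, D) \<in> S" using B(1,2) by (simp add: S_def)
    moreover have "\<forall>j\<in>B. (p j \<omega>, \<theta> j \<omega>) \<in> C D j"
      using B(1,3) by (auto simp: C_def D_def)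
    hence "\<omega> \<in> E (B, D)" using w B(4) by (simp add: E_def)
    ultimately show "\<omega> \<in> ?R" by blast
  next
    fix \<omega> assume "\<omega> \<in> ?R"
    then obtain B D where BD: "(B, D) \<in> S" "\<omega> \<in> E (B, D)" by auto
    note S = S_D[OF BD(1)] and u = E_unique[OF BD]
    have "\<exists>B. B \<subseteq> A \<and> card B = k - m \<and> (\<forall>a\<in>B. p a \<omega> \<le> t k) \<and> stays_below t (\<lambda>j. p j \<omega>) (A - B) k J 0"
      using S u(1) BD(2) by (intro exI[of _ B]) (auto simp: E_def)
    hence "crosses_last t (\<lambda>j. p j \<omega>) A m k J" using crosses_last_iff_stays_below[OF A mk t] by blast
    moreover have "card {j\<in>A. p j \<omega> \<le> t k \<and> \<not> \<theta> j \<omega>} = v" using S(4) unfolding u(2) .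
    ultimately show "\<omega> \<in> ?L" using BD(2) by (simp add: E_def)
  qed
  also have "prob \<dots> = (\<Sum>X\<in>S. prob (E X))"
    using S_fin disj E_sets by (intro finite_measure_finite_Union) auto
  also have "\<dots> = (\<Sum>X\<in>S. a ^ v * b ^ (k - m - v) * stays_below_prob H (card A - (k - m)) k J 0)"
  proof (intro sum.cong refl)
    fix X assume "X \<in> S"
    then obtain B D where X: "X = (B, D)" "(B, D) \<in> S" by (cases X) auto
    note S = S_D[OF X(2)]
    have "prob (E X) = (\<Prod>j\<in>B. prob {\<omega>\<in>space M. (p j \<omega>, \<theta> j \<omega>) \<in> C D j}) *
        stays_below_prob H (card (A - B)) k J 0"
      unfolding E_def X fst_conv snd_conv using A S C H
      by (intro prob_stays_below[OF t]) auto
    also have "(\<Prod>j\<in>B. prob {\<omega>\<in>space M. (p j \<omega>, \<theta> j \<omega>) \<in> C D j}) = (\<Prod>j\<in>B. if j \<in> D then a else b)"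
      by (intro prod.cong refl) (auto simp: C_def a b)
    also have "\<dots> = a ^ v * b ^ (k - m - v)"
      using S by (simp add: prod.If_cases Int_absorb1 card_Diff_subset flip: Diff_eq)
    also have "card (A - B) = card A - (k - m)" using S by (simp add: card_Diff_subset)
    finally show "prob (E X) = a ^ v * b ^ (k - m - v) * stays_below_prob H (card A - (k - m)) k J 0" .
  qed
  also have "\<dots> = real (card S) * (a ^ v * b ^ (k - m - v) * stays_below_prob H (card A - (k - m)) k J 0)"
    by simp
  also have "card S = (card A choose (k - m)) * (k - m choose v)"
  proof -
    have "card S = (\<Sum>B | B \<subseteq> A \<and> card B = k - m. card {D. D \<subseteq> B \<and> card D = v})"
      unfolding S_def using finS finD by (intro card_SigmaI) auto
    also have "\<dots> = (\<Sum>B | B \<subseteq> A \<and> card B = k - m. (k - m choose v))"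
      using n_subsets[OF finite_subset[OF _ A]] by (intro sum.cong) auto
    also have "\<dots> = (card A choose (k - m)) * (k - m choose v)" using n_subsets[OF A] by simp
    finally show ?thesis .
  qed
  finally show ?thesis by (simp add: mult_ac)
qed

lemma crosses_last_measurable:
  assumes "finite A"
  shows "Measurable.pred M (\<lambda>\<omega>. crosses_last t (\<lambda>j. p j \<omega>) A m k J)"
proof -
  have [measurable]: "(\<lambda>\<omega>. card {a\<in>A. p a \<omega> \<le> u}) \<in> measurable M (count_space UNIV)" for u
    using assms by (intro measurable_card_Collect) auto
  have [measurable]: "Measurable.pred M (\<lambda>\<omega>. card {a\<in>A. p a \<omega> \<le> u} + m < w)"
    "Measurable.pred M (\<lambda>\<omega>. card {a\<in>A. p a \<omega> \<le> u} + m = w)" for u w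
    by measurable
  show ?thesis unfolding crosses_last_def
    by (intro pred_intros_logic pred_intros_finite) auto
qed

lemma prob_crosses_last:
  assumes t: "mono t" and A: "finite A" and mk: "m \<le> k"
    and H: "\<And>l j. l \<le> k + J \<Longrightarrow> prob {\<omega>\<in>space M. p j \<omega> \<le> t l} = H l"
    and tk: "t k \<in> {0..1}"
  shows "prob {\<omega>\<in>space M. crosses_last t (\<lambda>j. p j \<omega>) A m k J} =
    real (card A choose (k - m)) * H k ^ (k - m) * stays_below_prob H (card A - (k - m)) k J 0"
proof -
  let ?E = "\<lambda>v. {\<omega>\<in>space M. crosses_last t (\<lambda>j. p j \<omega>) A m k J \<and> card {j\<in>A. p j \<omega> \<le> t k \<and> \<not> \<theta> j \<omega>} = v}"
  let ?w = "stays_below_prob H (card A - (k - m)) k J 0"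
  have [measurable]: "(\<lambda>\<omega>. card {j\<in>A. p j \<omega> \<le> t k \<and> \<not> \<theta> j \<omega>}) \<in> measurable M (count_space UNIV)"
    using A by (intro measurable_card_Collect) auto
  note [measurable] = crosses_last_measurable[OF A]
  have Ev: "?E v \<in> sets M" for v by measurable
  have v_le: "card {j\<in>A. p j \<omega> \<le> t k \<and> \<not> \<theta> j \<omega>} \<le> k - m"
    if "crosses_last t (\<lambda>j. p j \<omega>) A m k J" for \<omega>
  proof -
    have "card {j\<in>A. p j \<omega> \<le> t k \<and> \<not> \<theta> j \<omega>} \<le> card {j\<in>A. p j \<omega> \<le> t k}"
      using A by (intro card_mono) auto
    thus ?thesis using that by (auto simp: crosses_last_def)
  qed
  have "{\<omega>\<in>space M. crosses_last t (\<lambda>j. p j \<omega>) A m k J} = (\<Union>v\<le>k - m. ?E v)"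
    using v_le by auto
  also have "prob \<dots> = (\<Sum>v\<le>k - m. prob (?E v))"
    using Ev by (intro finite_measure_finite_Union) (auto simp: disjoint_family_on_def)
  also have "\<dots> = (\<Sum>v\<le>k - m. real (card A choose (k - m)) *
      (real (k - m choose v) * ((1 - \<pi>) * t k) ^ v * (\<pi> * G (t k)) ^ (k - m - v)) * ?w)"
    by (intro sum.cong refl prob_crosses_last_joint t A mk H prob_p_le_true_null prob_p_le_false_null tk)
  also have "\<dots> = real (card A choose (k - m)) * ((1 - \<pi>) * t k + \<pi> * G (t k)) ^ (k - m) * ?w"
    by (simp add: binomial_ring sum_distrib_left sum_distrib_right)
  also have "(1 - \<pi>) * t k + \<pi> * G (t k) = H k"
    using H[of k 0] prob_p_le[OF tk, of 0] by (simp add: mixture_cdf_def)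
  finally show ?thesis .
qed

lemma expectation_power_count:
  assumes C: "C \<in> sets (borel \<Otimes>\<^sub>M count_space UNIV)"
    and q: "\<And>j. prob {\<omega>\<in>space M. (p j \<omega>, \<theta> j \<omega>) \<in> C} = q"
  shows "integrable M (\<lambda>\<omega>. z ^ card {j\<in>{..<n}. (p j \<omega>, \<theta> j \<omega>) \<in> C})"
    and "expectation (\<lambda>\<omega>. z ^ card {j\<in>{..<n}. (p j \<omega>, \<theta> j \<omega>) \<in> C}) = (1 - q + q * (z::real)) ^ n"
proof -
  define f where "f x = (if x \<in> C then z else 1)" for x
  have f: "f \<in> borel_measurable (borel \<Otimes>\<^sub>M count_space UNIV)"
    unfolding f_def using C by (intro measurable_If) (auto simp: pred_sets1)
  have ind: "indep_vars (\<lambda>_. borel) (\<lambda>j \<omega>. f (p j \<omega>, \<theta> j \<omega>)) {..<n}"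
    by (intro indep_vars_subset[OF indep_vars_compose2[OF indep f]]) auto
  have eq: "z ^ card {j\<in>{..<n}. (p j \<omega>, \<theta> j \<omega>) \<in> C} = (\<Prod>j<n. f (p j \<omega>, \<theta> j \<omega>))" for \<omega>
    by (simp add: f_def prod.If_cases Int_def)
  have pr: "{\<omega>\<in>space M. (p j \<omega>, \<theta> j \<omega>) \<in> C} \<in> sets M" for j
    using pred_in_cell[OF C, of j] by (simp add: pred_def)
  have f_eq: "f (p j \<omega>, \<theta> j \<omega>) = 1 + (z - 1) * indicator {\<omega>\<in>space M. (p j \<omega>, \<theta> j \<omega>) \<in> C} \<omega>"
    if "\<omega> \<in> space M" for j \<omega> using that by (simp add: f_def)
  have int: "integrable M (\<lambda>\<omega>. f (p j \<omega>, \<theta> j \<omega>))" for j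
    using pr by (subst Bochner_Integration.integrable_cong[OF refl f_eq])
      (auto intro!: integrable_real_indicator simp: emeasure_eq_measure)
  have ex: "expectation (\<lambda>\<omega>. f (p j \<omega>, \<theta> j \<omega>)) = 1 - q + q * z" for j
  proof -
    have "expectation (\<lambda>\<omega>. f (p j \<omega>, \<theta> j \<omega>)) =
      expectation (\<lambda>\<omega>. 1 + (z - 1) * indicator {\<omega>\<in>space M. (p j \<omega>, \<theta> j \<omega>) \<in> C} \<omega>)"
      by (intro Bochner_Integration.integral_cong f_eq refl)
    also have "\<dots> = 1 + (z - 1) * q"
      using pr q[of j] by (subst Bochner_Integration.integral_add)
        (auto intro!: integrable_real_indicator simp: emeasure_eq_measure prob_space)
    finally show ?thesis by (simp add: algebra_simps)
  qed
  show "integrable M (\<lambda>\<omega>. z ^ card {j\<in>{..<n}. (p j \<omega>, \<theta> j \<omega>) \<in> C})"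
    unfolding eq using ind int by (intro indep_vars_integrable) auto
  show "expectation (\<lambda>\<omega>. z ^ card {j\<in>{..<n}. (p j \<omega>, \<theta> j \<omega>) \<in> C}) = (1 - q + q * z) ^ n"
    unfolding eq using ind int by (subst indep_vars_lebesgue_integral) (auto simp: ex)
qed

text \<open>
  Chernoff bounds for both tails of a binomial count, from its probability generating function.
\<close>
lemma prob_count_bounds:
  assumes C: "C \<in> sets (borel \<Otimes>\<^sub>M count_space UNIV)"
    and q: "\<And>j. prob {\<omega>\<in>space M. (p j \<omega>, \<theta> j \<omega>) \<in> C} = q"
  shows "1 \<le> z \<Longrightarrow> prob {\<omega>\<in>space M. k \<le> card {j\<in>{..<n}. (p j \<omega>, \<theta> j \<omega>) \<in> C}} \<le> (1 - q + q * z) ^ n / z ^ k"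
    and "0 < z \<Longrightarrow> z \<le> 1 \<Longrightarrow> prob {\<omega>\<in>space M. card {j\<in>{..<n}. (p j \<omega>, \<theta> j \<omega>) \<in> C} \<le> k} \<le> (1 - q + q * z) ^ n / z ^ k"
proof -
  have *: "prob {\<omega>\<in>space M. P (card {j\<in>{..<n}. (p j \<omega>, \<theta> j \<omega>) \<in> C})} \<le> (1 - q + q * z) ^ n / z ^ k"
    if "0 < z" and P: "\<And>m. P m \<Longrightarrow> z ^ k \<le> z ^ m" for P :: "nat \<Rightarrow> bool" and z
  proof -
    have [measurable]: "(\<lambda>\<omega>. card {j\<in>{..<n}. (p j \<omega>, \<theta> j \<omega>) \<in> C}) \<in> measurable M (count_space UNIV)"
      by (intro measurable_card_Collect pred_in_cell C) auto
    have "prob {\<omega>\<in>space M. P (card {j\<in>{..<n}. (p j \<omega>, \<theta> j \<omega>) \<in> C})} \<le>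
      prob {\<omega>\<in>space M. z ^ k \<le> z ^ card {j\<in>{..<n}. (p j \<omega>, \<theta> j \<omega>) \<in> C}}"
    proof (intro finite_measure_mono)
      show "{\<omega>\<in>space M. z ^ k \<le> z ^ card {j\<in>{..<n}. (p j \<omega>, \<theta> j \<omega>) \<in> C}} \<in> events" by measurable
    qed (use P in blast)
    also have "\<dots> \<le> expectation (\<lambda>\<omega>. z ^ card {j\<in>{..<n}. (p j \<omega>, \<theta> j \<omega>) \<in> C}) / z ^ k"
      using \<open>0 < z\<close>
      by (intro integral_Markov_inequality_measure[where A = "{}"] expectation_power_count(1)[OF C q]) auto
    also have "\<dots> = (1 - q + q * z) ^ n / z ^ k" by (subst expectation_power_count(2)[OF C q]) auto
    finally show ?thesis .
  qed
  show "prob {\<omega>\<in>space M. k \<le> card {j\<in>{..<n}. (p j \<omega>, \<theta> j \<omega>) \<in> C}} \<le> (1 - q + q * z) ^ n / z ^ k" if "1 \<le> z"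
    using that by (intro *) (auto intro: power_increasing)
  show "prob {\<omega>\<in>space M. card {j\<in>{..<n}. (p j \<omega>, \<theta> j \<omega>) \<in> C} \<le> k} \<le> (1 - q + q * z) ^ n / z ^ k" if "0 < z" "z \<le> 1"
    using that by (intro *) (auto intro: power_decreasing)
qed

end

section \<open>Poisson limits and tightness\<close>

lemma tendsto_one_minus_power:
  fixes x :: "nat \<Rightarrow> real"
  assumes lim: "(\<lambda>n. real n * x n) \<longlonglongrightarrow> a" and nn: "\<forall>\<^sub>F n in sequentially. 0 \<le> x n"
  shows "(\<lambda>n. (1 - x n) ^ (n - k)) \<longlonglongrightarrow> exp (- a)"
proof -
  have x0: "x \<longlonglongrightarrow> 0"
  proof -
    have "(\<lambda>n. real n * x n * inverse (real n)) \<longlonglongrightarrow> a * 0"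
      by (intro tendsto_mult lim lim_inverse_n)
    moreover have "\<forall>\<^sub>F n in sequentially. real n * x n * inverse (real n) = x n"
      using eventually_gt_at_top[of 0] by eventually_elim (simp add: field_simps)
    ultimately show ?thesis by (simp add: tendsto_cong)
  qed
  have x1: "\<forall>\<^sub>F n in sequentially. x n < 1" using order_tendstoD(2)[OF x0, of 1] by simp
  have pow: "(\<lambda>n. (1 - x n) ^ n) \<longlonglongrightarrow> exp (- a)"
  proof (rule tendsto_sandwich)
    show "\<forall>\<^sub>F n in sequentially. exp (- (real n * x n / (1 - x n))) \<le> (1 - x n) ^ n"
      using x1 nn
    proof eventually_elim
      case (elim n)
      have "1 + x n / (1 - x n) \<le> exp (x n / (1 - x n))" by (rule exp_ge_add_one_self)
      hence "1 / (1 - x n) \<le> exp (x n / (1 - x n))" using elim by (simp add: field_simps)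
      hence "exp (- (x n / (1 - x n))) \<le> 1 - x n"
        using elim by (simp add: exp_minus field_simps)
      hence "exp (- (x n / (1 - x n))) ^ n \<le> (1 - x n) ^ n" by (intro power_mono) auto
      thus ?case by (simp add: exp_of_nat_mult[symmetric])
    qed
    show "\<forall>\<^sub>F n in sequentially. (1 - x n) ^ n \<le> exp (- (real n * x n))"
      using x1
    proof eventually_elim
      case (elim n)
      have "1 - x n \<le> exp (- x n)" using exp_ge_add_one_self[of "- x n"] by simp
      hence "(1 - x n) ^ n \<le> exp (- x n) ^ n" using elim by (intro power_mono) auto
      thus ?case by (simp add: exp_of_nat_mult[symmetric])
    qed
    have "(\<lambda>n. exp (- (real n * x n / (1 - x n)))) \<longlonglongrightarrow> exp (- (a / (1 - 0)))"
      by (intro tendsto_intros lim x0) simp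
    thus "(\<lambda>n. exp (- (real n * x n / (1 - x n)))) \<longlonglongrightarrow> exp (- a)" by simp
    show "(\<lambda>n. exp (- (real n * x n))) \<longlonglongrightarrow> exp (- a)" by (intro tendsto_intros lim)
  qed
  have "(\<lambda>n. (1 - x n) ^ n / (1 - x n) ^ k) \<longlonglongrightarrow> exp (- a) / (1 - 0) ^ k"
    by (intro tendsto_intros pow x0) simp
  moreover have "\<forall>\<^sub>F n in sequentially. (1 - x n) ^ n / (1 - x n) ^ k = (1 - x n) ^ (n - k)"
    using x1 eventually_ge_at_top[of k] by eventually_elim (simp add: power_diff)
  ultimately show ?thesis by (simp add: tendsto_cong)
qed

lemma tendsto_choose_over_power:
  "(\<lambda>n. real ((n - k) choose y) / real n ^ y) \<longlonglongrightarrow> 1 / fact y"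
proof (induction y)
  case (Suc y)
  have "(\<lambda>n. (real n - real (k + y)) / real n) \<longlonglongrightarrow> 1"
  proof -
    have "(\<lambda>n. 1 - real (k + y) * inverse (real n)) \<longlonglongrightarrow> 1 - real (k + y) * 0"
      by (intro tendsto_intros lim_inverse_n)
    moreover have "\<forall>\<^sub>F n in sequentially. 1 - real (k + y) * inverse (real n) = (real n - real (k + y)) / real n"
      using eventually_gt_at_top[of 0] by eventually_elim (simp add: field_simps)
    ultimately show ?thesis by (simp add: tendsto_cong)
  qed
  hence "(\<lambda>n. real ((n - k) choose y) / real n ^ y * ((real n - real (k + y)) / real n) / real (Suc y))
      \<longlonglongrightarrow> 1 / fact y * 1 / real (Suc y)"
    by (intro tendsto_intros Suc.IH) auto
  moreover have "\<forall>\<^sub>F n in sequentially. real ((n - k) choose y) / real n ^ y * ((real n - real (k + y)) / real n) / real (Suc y)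
     = real ((n - k) choose (Suc y)) / real n ^ Suc y"
    using eventually_gt_at_top[of 0] eventually_ge_at_top[of "k + y"]
  proof eventually_elim
    case (elim n)
    have "Suc y * ((n - k) choose Suc y) = (n - k - y) * ((n - k) choose y)"
      by (metis binomial_absorb_comp binomial_absorption)
    hence "real (Suc y) * real ((n - k) choose Suc y) = real (n - k - y) * real ((n - k) choose y)"
      by (metis of_nat_mult)
    moreover have "real (n - k - y) = real n - real (k + y)" using elim by simp
    ultimately have "real ((n - k) choose Suc y) = (real n - real (k + y)) * real ((n - k) choose y) / real (Suc y)"
      by (metis nonzero_mult_div_cancel_left of_nat_eq_0_iff old.nat.distinct(2))
    thus ?case by (simp add: mult_ac)
  qed
  ultimately have "(\<lambda>n. real ((n - k) choose (Suc y)) / real n ^ Suc y) \<longlonglongrightarrow> 1 / fact y * 1 / real (Suc y)"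
    by (rule Lim_transform_eventually)
  thus ?case by (simp add: field_simps)
qed simp

text \<open>
  The recursion of \<open>stays_below_prob\<close> with independent Poisson counts of mean \<open>c\<close> in the cells; the
  position \<open>i\<close> of the first cell has disappeared because these counts are stationary.
\<close>
fun poisson_stays_below :: "real \<Rightarrow> nat \<Rightarrow> nat \<Rightarrow> real" where
  "poisson_stays_below c 0 s = 1"
| "poisson_stays_below c (Suc J) s =
     (\<Sum>y\<le>s. c ^ y / fact y * exp (- c) * poisson_stays_below c J (Suc (s - y)))"

text \<open>
  If cell probabilities are of order \<open>c / n\<close>, the binomial counts become Poisson. The factor
  \<open>exp (- c i)\<close> is the limiting probability that the first \<open>i\<close> cells are empty.
\<close>
lemma stays_below_prob_tendsto:
  assumes H: "\<And>i. (\<lambda>n. real n * H n i) \<longlonglongrightarrow> c * real i"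
    and nn: "\<And>i. \<forall>\<^sub>F n in sequentially. 0 \<le> H n i"
  shows "(\<lambda>n. stays_below_prob (H n) (n - k) i J s) \<longlonglongrightarrow> exp (- (c * real i)) * poisson_stays_below c J s"
proof (induction J arbitrary: k i s)
  case 0
  show ?case using tendsto_one_minus_power[OF H nn] by simp
next
  case (Suc J)
  have "(\<lambda>n. real ((n - k) choose y) * (H n (Suc i) - H n i) ^ y *
          stays_below_prob (H n) (n - k - y) (Suc i) J (Suc (s - y)))
     \<longlonglongrightarrow> 1 / fact y * (c * real (Suc i) - c * real i) ^ y *
        (exp (- (c * real (Suc i))) * poisson_stays_below c J (Suc (s - y)))" for y
  proof -
    have "(\<lambda>n. real ((n - k) choose y) / real n ^ y * (real n * H n (Suc i) - real n * H n i) ^ y *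
            stays_below_prob (H n) (n - (k + y)) (Suc i) J (Suc (s - y)))
       \<longlonglongrightarrow> 1 / fact y * (c * real (Suc i) - c * real i) ^ y *
          (exp (- (c * real (Suc i))) * poisson_stays_below c J (Suc (s - y)))"
      by (intro tendsto_mult tendsto_power tendsto_diff H Suc.IH tendsto_choose_over_power)
    moreover have "\<forall>\<^sub>F n in sequentially.
       real ((n - k) choose y) / real n ^ y * (real n * H n (Suc i) - real n * H n i) ^ y *
            stays_below_prob (H n) (n - (k + y)) (Suc i) J (Suc (s - y)) =
       real ((n - k) choose y) * (H n (Suc i) - H n i) ^ y *
          stays_below_prob (H n) (n - k - y) (Suc i) J (Suc (s - y))"
      using eventually_gt_at_top[of 0]
    proof eventually_elim
      case (elim n)
      have "(real n * H n (Suc i) - real n * H n i) ^ y = real n ^ y * (H n (Suc i) - H n i) ^ y"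
        by (simp add: right_diff_distrib[symmetric] power_mult_distrib)
      thus ?case using elim by simp
    qed
    ultimately show ?thesis by (rule Lim_transform_eventually)
  qed
  hence "(\<lambda>n. stays_below_prob (H n) (n - k) i (Suc J) s) \<longlonglongrightarrow>
    (\<Sum>y\<le>s. 1 / fact y * (c * real (Suc i) - c * real i) ^ y *
        (exp (- (c * real (Suc i))) * poisson_stays_below c J (Suc (s - y))))"
    unfolding stays_below_prob.simps by (intro tendsto_sum)
  also have "(\<Sum>y\<le>s. 1 / fact y * (c * real (Suc i) - c * real i) ^ y *
        (exp (- (c * real (Suc i))) * poisson_stays_below c J (Suc (s - y)))) =
     exp (- (c * real i)) * poisson_stays_below c (Suc J) s"
    unfolding poisson_stays_below.simps sum_distrib_left
  proof (intro sum.cong refl)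
    fix y
    have "c * real (Suc i) - c * real i = c" by (simp add: algebra_simps)
    moreover have "exp (- (c * real (Suc i))) = exp (- (c * real i)) * exp (- c)"
      by (simp add: exp_add[symmetric] algebra_simps)
    ultimately show "1 / fact y * (c * real (Suc i) - c * real i) ^ y *
        (exp (- (c * real (Suc i))) * poisson_stays_below c J (Suc (s - y))) =
       exp (- (c * real i)) * (c ^ y / fact y * exp (- c) * poisson_stays_below c J (Suc (s - y)))"
      by simp
  qed
  finally show ?case .
qed

text \<open>
  The sum splits into a head of fixed length, which tends to 0 term by term, and a tail, which
  is uniformly small as the \<open>e n k\<close> are bounded and the weights \<open>x n\<close> uniformly tight.
\<close>
lemma tendsto_tight_sum:
  fixes e x :: "nat \<Rightarrow> nat \<Rightarrow> real"
  assumes e: "\<And>k. (\<lambda>n. e n k) \<longlonglongrightarrow> 0" and C: "\<And>n k. k \<le> n \<Longrightarrow> \<bar>e n k\<bar> \<le> C"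
    and x: "\<And>n k. 0 \<le> x n k" "\<And>n k. x n k \<le> 1"
    and T: "\<And>n K. (\<Sum>k\<in>{K<..n}. x n k) \<le> T K" "T \<longlonglongrightarrow> 0"
  shows "(\<lambda>n. \<Sum>k\<le>n. e n k * x n k) \<longlonglongrightarrow> 0"
proof (rule LIMSEQ_I)
  fix \<epsilon> :: real assume "0 < \<epsilon>"
  have C0: "0 \<le> C" using C[of 0 0] by linarith
  have "(\<lambda>K. C * T K) \<longlonglongrightarrow> C * 0" by (intro tendsto_intros T)
  hence "\<forall>\<^sub>F K in sequentially. C * T K < \<epsilon> / 2"
    using order_tendstoD(2)[of "\<lambda>K. C * T K" 0 sequentially "\<epsilon> / 2"] \<open>0 < \<epsilon>\<close> by simp
  then obtain K where K: "C * T K < \<epsilon> / 2" by (auto simp: eventually_sequentially)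
  have "(\<lambda>n. \<Sum>k\<le>K. \<bar>e n k\<bar>) \<longlonglongrightarrow> (\<Sum>k\<le>K. \<bar>0\<bar>)" by (intro tendsto_intros e)
  hence "\<forall>\<^sub>F n in sequentially. (\<Sum>k\<le>K. \<bar>e n k\<bar>) < \<epsilon> / 2"
    using order_tendstoD(2)[of "\<lambda>n. \<Sum>k\<le>K. \<bar>e n k\<bar>" 0 sequentially "\<epsilon> / 2"] \<open>0 < \<epsilon>\<close> by simp
  then obtain n0 where n0: "\<And>n. n \<ge> n0 \<Longrightarrow> (\<Sum>k\<le>K. \<bar>e n k\<bar>) < \<epsilon> / 2"
    by (auto simp: eventually_sequentially)
  show "\<exists>n0. \<forall>n\<ge>n0. norm ((\<Sum>k\<le>n. e n k * x n k) - 0) < \<epsilon>"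
  proof (intro exI[of _ "max n0 K"] allI impI)
    fix n assume n: "max n0 K \<le> n"
    have split: "{..n} = {..K} \<union> {K<..n}" using n by auto
    have "\<bar>\<Sum>k\<le>n. e n k * x n k\<bar> \<le> (\<Sum>k\<le>n. \<bar>e n k\<bar> * x n k)"
      using x(1) by (intro order.trans[OF sum_abs] sum_mono) (simp add: abs_mult)
    also have "\<dots> = (\<Sum>k\<le>K. \<bar>e n k\<bar> * x n k) + (\<Sum>k\<in>{K<..n}. \<bar>e n k\<bar> * x n k)"
      unfolding split by (intro sum.union_disjoint) auto
    also have "(\<Sum>k\<le>K. \<bar>e n k\<bar> * x n k) \<le> (\<Sum>k\<le>K. \<bar>e n k\<bar>)"
      using x by (intro sum_mono mult_left_le) auto
    also have "(\<Sum>k\<in>{K<..n}. \<bar>e n k\<bar> * x n k) \<le> (\<Sum>k\<in>{K<..n}. C * x n k)"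
      using x C by (intro sum_mono mult_right_mono) auto
    also have "\<dots> \<le> C * T K" unfolding sum_distrib_left[symmetric] by (intro mult_left_mono T C0)
    finally show "norm ((\<Sum>k\<le>n. e n k * x n k) - 0) < \<epsilon>" using n0[of n] n K by simp
  qed
qed

lemma mult_exp_one_minus_less_1:
  fixes r :: real
  assumes "0 < r" "r < 1"
  shows "r * exp (1 - r) < 1"
proof -
  have "ln r \<le> r - 1" "ln r \<noteq> r - 1"
    using assms ln_le_minus_one[of r] ln_eq_minus_one[of r] by auto
  hence "exp (ln r) < exp (r - 1)" by simp
  hence "r < exp (r - 1)" using assms by simp
  hence "r * exp (1 - r) < exp (r - 1) * exp (1 - r)" by simp
  thus ?thesis by (simp add: exp_add[symmetric])
qed

section \<open>The law of the number of rejections\<close>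

locale subcritical_BH = random_effects_model M p \<theta> \<pi> G
  for M :: "'a measure" and p :: "nat \<Rightarrow> 'a \<Rightarrow> real" and \<theta> :: "nat \<Rightarrow> 'a \<Rightarrow> bool"
    and \<pi> :: real and G :: "real \<Rightarrow> real" +
  fixes \<alpha> F'0 :: real
  assumes F_0: "mixture_cdf \<pi> G 0 = 0"
    and F_deriv: "(mixture_cdf \<pi> G has_real_derivative F'0) (at_right 0)"
    and \<alpha>: "\<alpha> \<in> {0<..<alpha_star (mixture_cdf \<pi> G)}"
begin

abbreviation "F \<equiv> mixture_cdf \<pi> G"
abbreviation "c \<equiv> \<alpha> * F'0"
definition "ratio = \<alpha> / alpha_star F"
definition "H n i = F (threshold \<alpha> n i)"

lemma F_pos:
  assumes "u \<in> {0<..1}" shows "0 < F u"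
proof -
  have "0 < (1 - \<pi>) * u" using assms \<pi>_range by auto
  thus ?thesis using mixture_cdf_ge[of u] assms by force
qed

lemma F_nonneg: "u \<in> {0..1} \<Longrightarrow> 0 \<le> F u"
  using F_pos[of u] F_0 by (cases "u = 0") auto

lemma alpha_star_le: "u \<in> {0<..1} \<Longrightarrow> alpha_star F \<le> u / F u"
  unfolding alpha_star_def using F_pos
  by (intro cINF_lower bdd_belowI[of _ 0]) (auto intro!: divide_nonneg_nonneg less_imp_le)

lemma alpha_star: "0 < alpha_star F" "alpha_star F \<le> 1" "0 < \<alpha>" "\<alpha> < alpha_star F" "\<alpha> < 1"
  using \<alpha> alpha_star_le[of 1] mixture_cdf_1 by auto

lemma ratio: "0 < ratio" "ratio < 1" using alpha_star by (auto simp: ratio_def)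

lemma F_le: "u \<in> {0..1} \<Longrightarrow> F u \<le> u / alpha_star F"
  using alpha_star_le[of u] F_pos[of u] alpha_star F_0
  by (cases "u = 0") (auto simp: field_simps)

lemma threshold_range: "i \<le> n \<Longrightarrow> threshold \<alpha> n i \<in> {0..1}"
  using alpha_star mult_mono[of \<alpha> 1 "real i" "real n"]
  by (cases "n = 0") (auto simp: threshold_def divide_le_eq)

lemma prob_p_le_threshold: "i \<le> n \<Longrightarrow> prob {\<omega>\<in>space M. p j \<omega> \<le> threshold \<alpha> n i} = H n i"
  unfolding H_def by (intro prob_p_le threshold_range)

text \<open>
  The upper bound with \<open>ratio < 1\<close> is the subcriticality that gives geometric tails; the lower bound
  keeps the factor between \<open>prob_R\<close> and the leave-one-out law away from 0.
\<close>
lemma H_bounds: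
  assumes "i \<le> n"
  shows "0 \<le> H n i" "(1 - \<pi>) * \<alpha> * real i \<le> real n * H n i" "real n * H n i \<le> ratio * real i"
proof -
  show "0 \<le> H n i" unfolding H_def using threshold_range[OF assms] by (rule F_nonneg)
  have n: "real n * threshold \<alpha> n i = \<alpha> * real i" using assms by (auto simp: threshold_def)
  have "real n * ((1 - \<pi>) * threshold \<alpha> n i) \<le> real n * H n i"
    unfolding H_def using mixture_cdf_ge[OF threshold_range[OF assms]] by (intro mult_left_mono) auto
  also have "real n * ((1 - \<pi>) * threshold \<alpha> n i) = (1 - \<pi>) * \<alpha> * real i"
    using n by (simp add: mult_ac)
  finally show "(1 - \<pi>) * \<alpha> * real i \<le> real n * H n i" .
  have "real n * H n i \<le> real n * (threshold \<alpha> n i / alpha_star F)"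
    unfolding H_def using F_le[OF threshold_range[OF assms]] by (intro mult_left_mono) auto
  also have "\<dots> = ratio * real i" using n by (simp add: ratio_def)
  finally show "real n * H n i \<le> ratio * real i" .
qed

lemma tendsto_H: "(\<lambda>n. real n * H n i) \<longlonglongrightarrow> c * real i"
proof (cases "i = 0")
  case True
  thus ?thesis by (simp add: H_def threshold_def F_0)
next
  case False
  have lim: "((\<lambda>u. F u / u) \<longlongrightarrow> F'0) (at_right 0)"
    using F_deriv F_0 by (simp add: has_field_derivative_iff)
  have "filterlim (\<lambda>n. threshold \<alpha> n i) (at_right 0) sequentially"
  proof (rule tendsto_imp_filterlim_at_right)
    have "(\<lambda>n. \<alpha> * real i * inverse (real n)) \<longlonglongrightarrow> \<alpha> * real i * 0"
      by (intro tendsto_intros lim_inverse_n)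
    thus "(\<lambda>n. threshold \<alpha> n i) \<longlonglongrightarrow> 0" by (simp add: threshold_def divide_inverse)
    show "\<forall>\<^sub>F n in sequentially. 0 < threshold \<alpha> n i"
      using eventually_gt_at_top[of 0] by eventually_elim (use False alpha_star in \<open>auto simp: threshold_def\<close>)
  qed
  from filterlim_compose[OF lim this]
  have "(\<lambda>n. F (threshold \<alpha> n i) / threshold \<alpha> n i * (\<alpha> * real i)) \<longlonglongrightarrow> F'0 * (\<alpha> * real i)"
    by (intro tendsto_intros)
  moreover have "\<forall>\<^sub>F n in sequentially. F (threshold \<alpha> n i) / threshold \<alpha> n i * (\<alpha> * real i) = real n * H n i"
    using eventually_gt_at_top[of 0]
    by eventually_elim (use False alpha_star in \<open>auto simp: threshold_def H_def\<close>)
  ultimately have "(\<lambda>n. real n * H n i) \<longlonglongrightarrow> F'0 * (\<alpha> * real i)" by (rule Lim_transform_eventually)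
  thus ?thesis by (simp add: mult_ac)
qed

lemma c_range: "0 < c" "c < 1"
proof -
  have lim: "(\<lambda>n. real n * H n 1) \<longlonglongrightarrow> c" using tendsto_H[of 1] by simp
  have "(1 - \<pi>) * \<alpha> \<le> c"
    by (rule tendsto_lowerbound[OF lim eventually_mono[OF eventually_ge_at_top[of 1]]])
       (use H_bounds(2)[of 1] in auto)
  thus "0 < c" using \<pi>_range alpha_star by (smt (verit) mult_pos_pos)
  have "c \<le> ratio"
    by (rule tendsto_upperbound[OF lim eventually_mono[OF eventually_ge_at_top[of 1]]])
       (use H_bounds(3)[of 1] in auto)
  thus "c < 1" using ratio by simp
qed

abbreviation "R n \<omega> \<equiv> BH_rejections \<alpha> (\<lambda>j. p j \<omega>) n"
abbreviation "V n \<omega> \<equiv> BH_false_rejections \<alpha> (\<lambda>j. p j \<omega>) (\<lambda>j. \<theta> j \<omega>) n"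
text \<open>
  Chernoff's bound for the probability that a Poisson variable with mean \<open>ratio * j\<close> reaches \<open>j\<close>
  is \<open>\<rho> ^ j\<close>.
\<close>
definition "\<rho> = ratio * exp (1 - ratio)"
definition "tail_bound K = \<rho> ^ Suc K / (1 - \<rho>)"

text \<open>
  Up to the factor \<open>1 - c\<close> this is the limit law. A Poisson variable with mean \<open>c k\<close> equals \<open>k\<close>
  with this probability.
\<close>
definition "borel_weight k = (c * real k) ^ k / fact k * exp (- (c * real k))"

lemma \<rho>: "0 < \<rho>" "\<rho> < 1"
  using ratio mult_exp_one_minus_less_1[of ratio] by (auto simp: \<rho>_def)

lemma tail_bound_tendsto: "tail_bound \<longlonglongrightarrow> 0"
proof -
  have "(\<lambda>K. \<rho> ^ Suc K / (1 - \<rho>)) \<longlonglongrightarrow> 0 / (1 - \<rho>)"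
    using \<rho> by (intro tendsto_intros LIMSEQ_Suc LIMSEQ_realpow_zero) auto
  thus ?thesis unfolding tail_bound_def by simp
qed

lemma prob_count_ge_le:
  assumes "j \<le> n"
  shows "prob {\<omega>\<in>space M. j \<le> card {i\<in>{..<n}. p i \<omega> \<le> threshold \<alpha> n j}} \<le> \<rho> ^ j"
proof -
  \<comment> \<open>The generating function is evaluated at \<open>1 / ratio\<close>, where the Poisson Chernoff bound is optimal.\<close>
  have z: "1 \<le> 1 / ratio" using ratio by simp
  have "prob {\<omega>\<in>space M. j \<le> card {i\<in>{..<n}. (p i \<omega>, \<theta> i \<omega>) \<in> {..threshold \<alpha> n j} \<times> UNIV}} \<le>
    (1 - H n j + H n j * (1 / ratio)) ^ n / (1 / ratio) ^ j"
    by (intro prob_count_bounds(1) z) (auto simp: prob_p_le_threshold[OF assms])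
  also have "\<dots> = (1 + H n j * (1 / ratio - 1)) ^ n * ratio ^ j"
    by (simp add: power_divide algebra_simps)
  also have "(1 + H n j * (1 / ratio - 1)) ^ n \<le> exp (H n j * (1 / ratio - 1)) ^ n"
    using H_bounds(1)[OF assms] z by (intro power_mono exp_ge_add_one_self add_nonneg_nonneg mult_nonneg_nonneg) auto
  also have "\<dots> = exp (real n * H n j * (1 / ratio - 1))"
    by (simp add: exp_of_nat_mult[symmetric] mult.assoc)
  also have "\<dots> \<le> exp (ratio * real j * (1 / ratio - 1))"
    using H_bounds(3)[OF assms] z by (intro exp_le_cancel_iff[THEN iffD2] mult_right_mono) auto
  also have "ratio * real j * (1 / ratio - 1) = real j * (1 - ratio)"
    using ratio by (simp add: field_simps)
  also have "exp (real j * (1 - ratio)) * ratio ^ j = \<rho> ^ j"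
    by (simp add: \<rho>_def power_mult_distrib exp_of_nat_mult)
  finally show ?thesis using ratio by simp
qed

lemma prob_late_crossing_le:
  "prob {\<omega>\<in>space M. \<exists>j\<in>{K<..n}. j \<le> card {i\<in>{..<n}. p i \<omega> \<le> threshold \<alpha> n j}} \<le> tail_bound K"
proof -
  let ?E = "\<lambda>j. {\<omega>\<in>space M. j \<le> card {i\<in>{..<n}. p i \<omega> \<le> threshold \<alpha> n j}}"
  have [measurable]: "(\<lambda>\<omega>. card {i\<in>{..<n}. p i \<omega> \<le> u}) \<in> measurable M (count_space UNIV)" for u
    by (intro measurable_card_Collect) auto
  have "{\<omega>\<in>space M. \<exists>j\<in>{K<..n}. j \<le> card {i\<in>{..<n}. p i \<omega> \<le> threshold \<alpha> n j}} = (\<Union>j\<in>{K<..n}. ?E j)"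
    by auto
  also have "prob \<dots> \<le> (\<Sum>j\<in>{K<..n}. prob (?E j))"
    by (intro finite_measure_subadditive_finite) auto
  also have "\<dots> \<le> (\<Sum>j\<in>{K<..n}. \<rho> ^ j)"
    by (intro sum_mono prob_count_ge_le) auto
  also have "(\<Sum>j\<in>{K<..n}. \<rho> ^ j) = (\<Sum>j\<in>{Suc K..n}. \<rho> ^ j)" by (intro sum.cong) auto
  also have "(\<Sum>j\<in>{Suc K..n}. \<rho> ^ j) \<le> tail_bound K"
    using \<rho> by (auto simp: sum_gp tail_bound_def intro!: divide_right_mono)
  finally show ?thesis .
qed

lemma R_eq_iff: "R n \<omega> = k \<longleftrightarrow> k \<le> n \<and> crosses_last (threshold \<alpha> n) (\<lambda>j. p j \<omega>) {..<n} 0 k (n - k)"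
  using alpha_star by (intro BH_rejections_eq_iff) simp

lemma R_le: "R n \<omega> \<le> n"
  using alpha_star by (intro BH_rejections_le) simp

lemma V_eq: "R n \<omega> = k \<Longrightarrow> V n \<omega> = card {j\<in>{..<n}. p j \<omega> \<le> threshold \<alpha> n k \<and> \<not> \<theta> j \<omega>}"
  using alpha_star by (intro BH_false_rejections_eq) simp

lemma R_measurable [measurable]: "R n \<in> measurable M (count_space UNIV)"
proof (subst measurable_count_space_eq2_countable, safe)
  fix k
  have "R n -` {k} \<inter> space M = {\<omega>\<in>space M. k \<le> n \<and> crosses_last (threshold \<alpha> n) (\<lambda>j. p j \<omega>) {..<n} 0 k (n - k)}"
    using R_eq_iff by auto
  also have "\<dots> \<in> sets M"
    using crosses_last_measurable[of "{..<n}" "threshold \<alpha> n" 0 k "n - k"] by (intro sets.sets_Collect) (auto simp: pred_def)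
  finally show "R n -` {k} \<inter> space M \<in> sets M" .
qed auto

lemma V_measurable [measurable]: "V n \<in> measurable M (count_space UNIV)"
proof (subst measurable_count_space_eq2_countable, safe)
  fix v
  have [measurable]: "(\<lambda>\<omega>. card {j\<in>{..<n}. p j \<omega> \<le> u \<and> \<not> \<theta> j \<omega>}) \<in> measurable M (count_space UNIV)" for u
    by (intro measurable_card_Collect) auto
  have "V n -` {v} \<inter> space M = (\<Union>k\<le>n. {\<omega>\<in>space M. R n \<omega> = k \<and> card {j\<in>{..<n}. p j \<omega> \<le> threshold \<alpha> n k \<and> \<not> \<theta> j \<omega>} = v})"
    using R_le V_eq by auto
  also have "\<dots> \<in> sets M" by (intro sets.finite_UN) auto
  finally show "V n -` {v} \<inter> space M \<in> sets M" .
qed auto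

lemma prob_R_V:
  assumes "k \<le> n"
  shows "prob {\<omega>\<in>space M. R n \<omega> = k \<and> V n \<omega> = v} =
    real (n choose k) * (real (k choose v) * ((1 - \<pi>) * threshold \<alpha> n k) ^ v * (\<pi> * G (threshold \<alpha> n k)) ^ (k - v)) *
    stays_below_prob (H n) (n - k) k (n - k) 0"
proof -
  have "(R n \<omega> = k \<and> V n \<omega> = v) \<longleftrightarrow>
    (crosses_last (threshold \<alpha> n) (\<lambda>j. p j \<omega>) {..<n} 0 k (n - k) \<and>
        card {j\<in>{..<n}. p j \<omega> \<le> threshold \<alpha> n k \<and> \<not> \<theta> j \<omega>} = v)" for \<omega>
    using R_eq_iff[of \<omega> n k] V_eq[of \<omega> n k] assms by (cases "R n \<omega> = k") auto
  hence "{\<omega>\<in>space M. R n \<omega> = k \<and> V n \<omega> = v} =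
    {\<omega>\<in>space M. crosses_last (threshold \<alpha> n) (\<lambda>j. p j \<omega>) {..<n} 0 k (n - k) \<and>
        card {j\<in>{..<n}. p j \<omega> \<le> threshold \<alpha> n k \<and> \<not> \<theta> j \<omega>} = v}"
    by simp
  also have "prob \<dots> = real (card {..<n} choose (k - 0)) * (real (k - 0 choose v) *
     ((1 - \<pi>) * threshold \<alpha> n k) ^ v * (\<pi> * G (threshold \<alpha> n k)) ^ (k - 0 - v)) *
    stays_below_prob (H n) (card {..<n} - (k - 0)) k (n - k) 0"
    using assms alpha_star
    by (intro prob_crosses_last_joint mono_threshold prob_p_le_threshold prob_p_le_true_null
        prob_p_le_false_null threshold_range) auto
  finally show ?thesis by simp
qed

definition "prob_R n k = prob {\<omega>\<in>space M. R n \<omega> = k}"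

lemma prob_crosses_last_threshold:
  assumes "card A + m = n" "finite A" "m \<le> k" "k + J \<le> n"
  shows "prob {\<omega>\<in>space M. crosses_last (threshold \<alpha> n) (\<lambda>j. p j \<omega>) A m k J} =
     real ((n - m) choose (k - m)) * H n k ^ (k - m) * stays_below_prob (H n) (n - k) k J 0"
proof -
  have "prob {\<omega>\<in>space M. crosses_last (threshold \<alpha> n) (\<lambda>j. p j \<omega>) A m k J} =
     real (card A choose (k - m)) * H n k ^ (k - m) * stays_below_prob (H n) (card A - (k - m)) k J 0"
    using assms alpha_star
    by (intro prob_crosses_last mono_threshold prob_p_le_threshold threshold_range) auto
  moreover have "card A = n - m" "card A - (k - m) = n - k" using assms by auto
  ultimately show ?thesis by simp
qed

lemma prob_R_eq:
  assumes "k \<le> n"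
  shows "prob_R n k = real (n choose k) * H n k ^ k * stays_below_prob (H n) (n - k) k (n - k) 0"
  using prob_crosses_last_threshold[of "{..<n}" 0 n k "n - k"] assms
  by (simp add: prob_R_def R_eq_iff)

lemma prob_R_nonneg: "0 \<le> prob_R n k" and prob_R_le_1: "prob_R n k \<le> 1"
  by (auto simp: prob_R_def)

lemma sum_prob_R: "finite S \<Longrightarrow> (\<Sum>k\<in>S. prob_R n k) = prob {\<omega>\<in>space M. R n \<omega> \<in> S}"
proof -
  assume S: "finite S"
  have "{\<omega>\<in>space M. R n \<omega> \<in> S} = (\<Union>k\<in>S. {\<omega>\<in>space M. R n \<omega> = k})" by auto
  also have "prob \<dots> = (\<Sum>k\<in>S. prob_R n k)"
    unfolding prob_R_def using S by (intro finite_measure_finite_Union) (auto simp: disjoint_family_on_def)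
  finally show ?thesis by simp
qed

lemma sum_prob_R_atMost: "(\<Sum>k\<le>n. prob_R n k) = 1"
  using sum_prob_R[of "{..n}" n] R_le by (simp add: prob_space)

lemma prob_R_gt_le: "prob {\<omega>\<in>space M. K < R n \<omega>} \<le> tail_bound K"
proof (rule order.trans[OF finite_measure_mono prob_late_crossing_le])
  have [measurable]: "(\<lambda>\<omega>. card {i\<in>{..<n}. p i \<omega> \<le> u}) \<in> measurable M (count_space UNIV)" for u
    by (intro measurable_card_Collect) auto
  show "{\<omega>\<in>space M. \<exists>j\<in>{K<..n}. j \<le> card {i\<in>{..<n}. p i \<omega> \<le> threshold \<alpha> n j}} \<in> sets M"
    by measurable
  show "{\<omega>\<in>space M. K < R n \<omega>} \<subseteq> {\<omega>\<in>space M. \<exists>j\<in>{K<..n}. j \<le> card {i\<in>{..<n}. p i \<omega> \<le> threshold \<alpha> n j}}"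
  proof safe
    fix \<omega> assume "K < R n \<omega>"
    moreover have "R n \<omega> \<le> n \<and> R n \<omega> \<le> card {i\<in>{..<n}. p i \<omega> \<le> threshold \<alpha> n (R n \<omega>)}"
      using R_eq_iff[of \<omega> n "R n \<omega>"] by (auto simp: crosses_last_def)
    ultimately show "\<exists>j\<in>{K<..n}. j \<le> card {i\<in>{..<n}. p i \<omega> \<le> threshold \<alpha> n j}"
      by (intro bexI[of _ "R n \<omega>"]) auto
  qed
qed

lemma sum_prob_R_tail: "(\<Sum>k\<in>{K<..n}. prob_R n k) \<le> tail_bound K"
proof -
  have "(\<Sum>k\<in>{K<..n}. prob_R n k) \<le> prob {\<omega>\<in>space M. K < R n \<omega>}"
    unfolding sum_prob_R[OF finite_greaterThanAtMost] by (intro finite_measure_mono) auto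
  thus ?thesis using prob_R_gt_le[of K n] by simp
qed

definition "prob_R_trunc n k J = real (n choose k) * H n k ^ k * stays_below_prob (H n) (n - k) k J 0"

text \<open>
  Truncation only ignores crossings after index \<open>k + J\<close>.
\<close>
lemma prob_R_trunc_approx:
  assumes "k + J \<le> n"
  shows "\<bar>prob_R n k - prob_R_trunc n k J\<bar> \<le> tail_bound (k + J)"
proof -
  let ?t = "threshold \<alpha> n"
  let ?D = "{\<omega>\<in>space M. crosses_last ?t (\<lambda>j. p j \<omega>) {..<n} 0 k J}"
  let ?L = "{\<omega>\<in>space M. \<exists>j\<in>{k + J<..n}. j \<le> card {i\<in>{..<n}. p i \<omega> \<le> ?t j}}"
  have [measurable]: "(\<lambda>\<omega>. card {i\<in>{..<n}. p i \<omega> \<le> u}) \<in> measurable M (count_space UNIV)" for u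
    by (intro measurable_card_Collect) auto
  have D_sets: "?D \<in> sets M" using crosses_last_measurable[of "{..<n}" ?t 0 k J] by (auto simp: pred_def)
  have L_sets: "?L \<in> sets M" by measurable
  have D: "prob ?D = prob_R_trunc n k J"
    using prob_crosses_last_threshold[of "{..<n}" 0 n k J] assms by (simp add: prob_R_trunc_def)
  have "prob_R n k \<le> prob ?D" unfolding prob_R_def
    using D_sets assms by (intro finite_measure_mono) (auto simp: R_eq_iff crosses_last_def)
  moreover have "prob ?D \<le> prob ({\<omega>\<in>space M. R n \<omega> = k} \<union> ?L)"
  proof (intro finite_measure_mono)
    show "{\<omega>\<in>space M. R n \<omega> = k} \<union> ?L \<in> sets M" by (intro sets.Un L_sets) measurable
    show "?D \<subseteq> {\<omega>\<in>space M. R n \<omega> = k} \<union> ?L"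
    proof
      fix \<omega> assume w: "\<omega> \<in> ?D"
      show "\<omega> \<in> {\<omega>\<in>space M. R n \<omega> = k} \<union> ?L"
      proof (cases "R n \<omega> = k")
        case False
        hence "\<not> crosses_last ?t (\<lambda>j. p j \<omega>) {..<n} 0 k (n - k)"
          using R_eq_iff[of \<omega> n k] assms by simp
        moreover have cl: "crosses_last ?t (\<lambda>j. p j \<omega>) {..<n} 0 k J" using w by simp
        ultimately obtain l where l: "l \<in> {1..n - k}" "\<not> card {i\<in>{..<n}. p i \<omega> \<le> ?t (k + l)} + 0 < k + l"
          unfolding crosses_last_def by blast
        have "l \<notin> {1..J}" using cl l(2) unfolding crosses_last_def by blast
        hence "l > J" using l(1) by simp
        hence "k + l \<in> {k + J<..n}" using l assms by auto
        moreover have "k + l \<le> card {i\<in>{..<n}. p i \<omega> \<le> ?t (k + l)}" using l(2) by linarith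
        ultimately have "\<omega> \<in> ?L" using w by blast
        thus ?thesis by simp
      qed (use w in auto)
    qed
  qed
  moreover have "prob ({\<omega>\<in>space M. R n \<omega> = k} \<union> ?L) \<le> prob_R n k + prob ?L"
    unfolding prob_R_def by (intro measure_Un_le L_sets) measurable
  moreover have "prob ?L \<le> tail_bound (k + J)" by (rule prob_late_crossing_le)
  ultimately show ?thesis unfolding D by simp
qed

lemma eventually_H_nonneg: "\<forall>\<^sub>F n in sequentially. 0 \<le> H n i"
  using eventually_ge_at_top[of i] by eventually_elim (rule H_bounds)

lemma tendsto_binomial_H: "(\<lambda>n. real (n choose k) * H n k ^ k) \<longlonglongrightarrow> (c * real k) ^ k / fact k"
proof -
  have "(\<lambda>n. real ((n - 0) choose k) / real n ^ k * (real n * H n k) ^ k) \<longlonglongrightarrow> 1 / fact k * (c * real k) ^ k"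
    by (intro tendsto_intros tendsto_choose_over_power tendsto_H)
  moreover have "\<forall>\<^sub>F n in sequentially. real ((n - 0) choose k) / real n ^ k * (real n * H n k) ^ k = real (n choose k) * H n k ^ k"
    using eventually_gt_at_top[of 0] by eventually_elim (simp add: power_mult_distrib)
  ultimately show ?thesis using Lim_transform_eventually by force
qed

lemma prob_R_trunc_tendsto:
  "(\<lambda>n. prob_R_trunc n k J) \<longlonglongrightarrow> borel_weight k * poisson_stays_below c J 0"
  unfolding prob_R_trunc_def borel_weight_def mult.assoc[of _ "exp _"]
  by (intro tendsto_mult tendsto_binomial_H stays_below_prob_tendsto tendsto_H eventually_H_nonneg)

lemma borel_weight_0: "borel_weight 0 = 1" by (simp add: borel_weight_def)

lemma borel_weight_nonneg: "0 \<le> borel_weight k" using c_range by (simp add: borel_weight_def)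

text \<open>
  The truncated probabilities converge to \<open>borel_weight k\<close> times a factor that depends on \<open>J\<close>
  but not on \<open>k\<close>, and comparing \<open>k\<close> with 0 eliminates this factor.
\<close>
lemma prob_R_proportional: "(\<lambda>n. prob_R n k - borel_weight k * prob_R n 0) \<longlonglongrightarrow> 0"
proof (rule LIMSEQ_I)
  fix \<epsilon> :: real assume e: "0 < \<epsilon>"
  have "(\<lambda>J. tail_bound (J + k) + borel_weight k * tail_bound J) \<longlonglongrightarrow> 0 + borel_weight k * 0"
    by (intro tendsto_intros tail_bound_tendsto LIMSEQ_ignore_initial_segment)
  hence "\<forall>\<^sub>F J in sequentially. tail_bound (J + k) + borel_weight k * tail_bound J < \<epsilon> / 2"
    using e by (intro order_tendstoD(2)[where y = 0]) auto
  then obtain J where J: "tail_bound (k + J) + borel_weight k * tail_bound J < \<epsilon> / 2"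
    by (auto simp: eventually_sequentially add.commute)
  let ?D = "\<lambda>n. prob_R_trunc n k J - borel_weight k * prob_R_trunc n 0 J"
  have "?D \<longlonglongrightarrow> borel_weight k * poisson_stays_below c J 0 - borel_weight k * (borel_weight 0 * poisson_stays_below c J 0)"
    by (intro tendsto_intros prob_R_trunc_tendsto)
  hence "?D \<longlonglongrightarrow> 0" by (simp add: borel_weight_0)
  from LIMSEQ_D[OF this, of "\<epsilon> / 2"] e obtain n0 where n0: "\<And>n. n \<ge> n0 \<Longrightarrow> \<bar>?D n\<bar> < \<epsilon> / 2" by auto
  show "\<exists>n0. \<forall>n\<ge>n0. norm (prob_R n k - borel_weight k * prob_R n 0 - 0) < \<epsilon>"
  proof (intro exI[of _ "max n0 (k + J)"] allI impI)
    fix n assume n: "max n0 (k + J) \<le> n"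
    let ?a = "prob_R n k - prob_R_trunc n k J" and ?b = "prob_R n 0 - prob_R_trunc n 0 J"
    have a: "\<bar>?a\<bar> \<le> tail_bound (k + J)" using n by (intro prob_R_trunc_approx) auto
    have "\<bar>?b\<bar> \<le> tail_bound J" using n prob_R_trunc_approx[of 0 J n] by simp
    hence b: "\<bar>borel_weight k * ?b\<bar> \<le> borel_weight k * tail_bound J"
      unfolding abs_mult using borel_weight_nonneg by (simp add: mult_left_mono)
    have "prob_R n k - borel_weight k * prob_R n 0 = ?a + ?D n - borel_weight k * ?b"
      by (simp add: algebra_simps)
    moreover have "\<bar>?D n\<bar> < \<epsilon> / 2" using n n0 by simp
    ultimately show "norm (prob_R n k - borel_weight k * prob_R n 0 - 0) < \<epsilon>"
      using a b J unfolding real_norm_def by linarith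
  qed
qed

text \<open>
  The law of the number of rejections when one of the \<open>n\<close> \<open>p\<close>-values is replaced by 0.
\<close>
definition "leave_one_out_prob n k =
  (if k \<in> {1..n} then real ((n - 1) choose (k - 1)) * H n k ^ (k - 1) * stays_below_prob (H n) (n - k) k (n - k) 0 else 0)"

lemma leave_one_out_prob_eq:
  assumes "k \<in> {1..n}"
  shows "leave_one_out_prob n k = prob {\<omega>\<in>space M. crosses_last (threshold \<alpha> n) (\<lambda>j. p j \<omega>) {..<n - 1} 1 k (n - k)}"
  using assms by (subst prob_crosses_last_threshold) (auto simp: leave_one_out_prob_def)

lemma sum_leave_one_out_prob:
  assumes "1 \<le> n"
  shows "(\<Sum>k\<le>n. leave_one_out_prob n k) = 1"
proof -
  let ?E = "\<lambda>k. {\<omega>\<in>space M. crosses_last (threshold \<alpha> n) (\<lambda>j. p j \<omega>) {..<n - 1} 1 k (n - k)}"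
  have ex1: "\<exists>!k. k \<in> {1..n} \<and> crosses_last (threshold \<alpha> n) (\<lambda>j. p j \<omega>) {..<n - 1} 1 k (n - k)" for \<omega>
    using assms alpha_star by (intro ex1_crosses_last mono_threshold) auto
  have "(\<Sum>k\<le>n. leave_one_out_prob n k) = (\<Sum>k\<in>{1..n}. leave_one_out_prob n k)"
    by (intro sum.mono_neutral_right) (auto simp: leave_one_out_prob_def)
  also have "\<dots> = (\<Sum>k\<in>{1..n}. prob (?E k))" by (intro sum.cong refl leave_one_out_prob_eq)
  also have "\<dots> = prob (\<Union>k\<in>{1..n}. ?E k)"
  proof (intro finite_measure_finite_Union[symmetric])
    show "?E ` {1..n} \<subseteq> sets M" using crosses_last_measurable[of "{..<n - 1}"] by (auto simp: pred_def)
    show "disjoint_family_on ?E {1..n}" unfolding disjoint_family_on_def using ex1 by blast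
  qed simp
  also have "(\<Union>k\<in>{1..n}. ?E k) = space M"
  proof -
    have "\<exists>k\<in>{1..n}. crosses_last (threshold \<alpha> n) (\<lambda>j. p j \<omega>) {..<n - 1} 1 k (n - k)" for \<omega>
      using ex1[of \<omega>] by blast
    thus ?thesis by blast
  qed
  finally show ?thesis by (simp add: prob_space)
qed

text \<open>
  Simes' identity: a rejected index can be chosen in \<open>k\<close> ways, its \<open>p\<close>-value is \<open>\<le> t\<^sub>k\<close> with
  probability \<open>H n k\<close>, and moving it to 0 does not change the number of rejections.
\<close>
lemma prob_R_leave_one_out:
  assumes "k \<in> {1..n}"
  shows "prob_R n k = real n * H n k / real k * leave_one_out_prob n k"
proof -
  have "k * (n choose k) = n * ((n - 1) choose (k - 1))"
    using times_binomial_minus1_eq[of k n] assms by auto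
  hence b: "real (n choose k) = real n * real ((n - 1) choose (k - 1)) / real k"
    using assms by (simp add: field_simps flip: of_nat_mult)
  have "H n k ^ k = H n k * H n k ^ (k - 1)" using assms by (simp flip: power_Suc)
  thus ?thesis using assms by (simp add: prob_R_eq leave_one_out_prob_def b)
qed

lemma leave_one_out_prob_nonneg: "0 \<le> leave_one_out_prob n k"
  using leave_one_out_prob_eq[of k n] by (cases "k \<in> {1..n}") (auto simp: leave_one_out_prob_def)

lemma leave_one_out_prob_le_1: "leave_one_out_prob n k \<le> 1"
  using leave_one_out_prob_eq[of k n] by (cases "k \<in> {1..n}") (auto simp: leave_one_out_prob_def)

lemma leave_one_out_prob_le: "leave_one_out_prob n k \<le> prob_R n k / ((1 - \<pi>) * \<alpha>)"
proof (cases "k \<in> {1..n}")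
  case True
  have pos: "0 < (1 - \<pi>) * \<alpha>" using \<pi>_range alpha_star by simp
  have "(1 - \<pi>) * \<alpha> \<le> real n * H n k / real k" using H_bounds(2)[of k n] True by (simp add: field_simps)
  hence "(1 - \<pi>) * \<alpha> * leave_one_out_prob n k \<le> prob_R n k"
    unfolding prob_R_leave_one_out[OF True] using leave_one_out_prob_nonneg by (intro mult_right_mono) auto
  thus ?thesis using pos by (simp add: field_simps)
next
  case False
  have "0 < (1 - \<pi>) * \<alpha>" using \<pi>_range alpha_star by simp
  thus ?thesis unfolding leave_one_out_prob_def if_not_P[OF False] by (intro divide_nonneg_nonneg prob_R_nonneg) simp
qed

text \<open>
  By Simes' identity the probability of at least one rejection is the mean of \<open>n F(t\<^sub>k) / k\<close> under
  the leave-one-out law. This law is tight, and the averaged quantity tends to \<open>c\<close> for every \<open>k\<close>.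
\<close>
lemma prob_R_0_tendsto: "(\<lambda>n. prob_R n 0) \<longlonglongrightarrow> 1 - c"
proof -
  define e where "e n k = (if k \<in> {1..n} then real n * H n k / real k - c else 0)" for n k
  have "(\<lambda>n. \<Sum>k\<le>n. e n k * leave_one_out_prob n k) \<longlonglongrightarrow> 0"
  proof (rule tendsto_tight_sum)
    fix k
    show "(\<lambda>n. e n k) \<longlonglongrightarrow> 0"
    proof (cases "k = 0")
      case False
      have "(\<lambda>n. real n * H n k / real k - c) \<longlonglongrightarrow> c * real k / real k - c"
        using False by (intro tendsto_intros tendsto_H) auto
      moreover have "\<forall>\<^sub>F n in sequentially. real n * H n k / real k - c = e n k"
        using eventually_ge_at_top[of k] by eventually_elim (use False in \<open>auto simp: e_def\<close>)
      ultimately show ?thesis using False Lim_transform_eventually by force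
    qed (simp add: e_def)
  next
    fix n k :: nat
    show "\<bar>e n k\<bar> \<le> 1"
    proof (cases "k \<in> {1..n}")
      case True
      have "0 \<le> real n * H n k / real k" "real n * H n k / real k \<le> ratio"
        using H_bounds[of k n] True by (auto simp: field_simps)
      thus ?thesis using True c_range ratio by (auto simp: e_def)
    qed (auto simp: e_def)
    show "0 \<le> leave_one_out_prob n k" "leave_one_out_prob n k \<le> 1" by (rule leave_one_out_prob_nonneg leave_one_out_prob_le_1)+
  next
    fix n K
    have "(\<Sum>k\<in>{K<..n}. leave_one_out_prob n k) \<le> (\<Sum>k\<in>{K<..n}. prob_R n k / ((1 - \<pi>) * \<alpha>))"
      by (intro sum_mono leave_one_out_prob_le)
    also have "\<dots> \<le> tail_bound K / ((1 - \<pi>) * \<alpha>)"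
      unfolding sum_divide_distrib[symmetric] using \<pi>_range alpha_star sum_prob_R_tail
      by (intro divide_right_mono) auto
    finally show "(\<Sum>k\<in>{K<..n}. leave_one_out_prob n k) \<le> tail_bound K / ((1 - \<pi>) * \<alpha>)" .
  next
    have "(\<lambda>K. tail_bound K / ((1 - \<pi>) * \<alpha>)) \<longlonglongrightarrow> 0 / ((1 - \<pi>) * \<alpha>)"
      using \<pi>_range alpha_star by (intro tendsto_intros tail_bound_tendsto) auto
    thus "(\<lambda>K. tail_bound K / ((1 - \<pi>) * \<alpha>)) \<longlonglongrightarrow> 0" by simp
  qed
  hence "(\<lambda>n. 1 - c - (\<Sum>k\<le>n. e n k * leave_one_out_prob n k)) \<longlonglongrightarrow> 1 - c - 0"
    by (intro tendsto_intros)
  moreover have "\<forall>\<^sub>F n in sequentially. 1 - c - (\<Sum>k\<le>n. e n k * leave_one_out_prob n k) = prob_R n 0"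
    using eventually_ge_at_top[of 1]
  proof eventually_elim
    case (elim n)
    have "(\<Sum>k\<le>n. e n k * leave_one_out_prob n k) = (\<Sum>k\<le>n. (if k = 0 then 0 else prob_R n k) - c * leave_one_out_prob n k)"
    proof (intro sum.cong refl)
      fix k assume "k \<in> {..n}"
      thus "e n k * leave_one_out_prob n k = (if k = 0 then 0 else prob_R n k) - c * leave_one_out_prob n k"
        using prob_R_leave_one_out[of k n] by (cases "k = 0") (auto simp: e_def leave_one_out_prob_def algebra_simps)
    qed
    also have "\<dots> = (\<Sum>k\<le>n. if k = 0 then 0 else prob_R n k) - c"
      unfolding sum_subtractf sum_distrib_left[symmetric] sum_leave_one_out_prob[OF elim] by simp
    also have "(\<Sum>k\<le>n. if k = 0 then 0 else prob_R n k) = (\<Sum>k\<le>n. prob_R n k) - prob_R n 0"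
      by (simp add: sum.remove[of "{..n}" 0])
    finally show ?case by (simp add: sum_prob_R_atMost)
  qed
  ultimately show ?thesis using Lim_transform_eventually by force
qed

lemma prob_R_tendsto: "(\<lambda>n. prob_R n k) \<longlonglongrightarrow> (1 - c) * borel_weight k"
proof -
  have "(\<lambda>n. (prob_R n k - borel_weight k * prob_R n 0) + borel_weight k * prob_R n 0) \<longlonglongrightarrow> 0 + borel_weight k * (1 - c)"
    by (intro tendsto_intros prob_R_proportional prob_R_0_tendsto)
  thus ?thesis by (simp add: mult.commute)
qed

text \<open>
  No mass escapes to infinity, as the laws of the numbers of rejections are uniformly tight.
\<close>
lemma borel_weight_sums: "(\<lambda>k. (1 - c) * borel_weight k) sums 1"
  unfolding sums_def'
proof (rule tendsto_sandwich[of "\<lambda>K. 1 - tail_bound K" _ _ "\<lambda>_. 1"])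
  have lim: "(\<lambda>n. \<Sum>k\<le>K. prob_R n k) \<longlonglongrightarrow> (\<Sum>k\<le>K. (1 - c) * borel_weight k)" for K
    by (intro tendsto_sum prob_R_tendsto)
  have "1 - tail_bound K \<le> (\<Sum>k\<le>K. (1 - c) * borel_weight k)" for K
  proof (rule tendsto_lowerbound[OF lim])
    show "\<forall>\<^sub>F n in sequentially. 1 - tail_bound K \<le> (\<Sum>k\<le>K. prob_R n k)"
      using eventually_ge_at_top[of K]
    proof eventually_elim
      case (elim n)
      have "{..n} = {..K} \<union> {K<..n}" using elim by auto
      hence "1 = (\<Sum>k\<le>K. prob_R n k) + (\<Sum>k\<in>{K<..n}. prob_R n k)"
        using sum_prob_R_atMost[of n] by (simp only:) (subst sum.union_disjoint[symmetric], auto)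
      thus ?case using sum_prob_R_tail[where K = K and n = n] by linarith
    qed
  qed simp
  thus "\<forall>\<^sub>F K in sequentially. 1 - tail_bound K \<le> (\<Sum>k\<in>{0..K}. (1 - c) * borel_weight k)"
    by (simp add: atLeast0AtMost)
  have "(\<Sum>k\<le>K. (1 - c) * borel_weight k) \<le> 1" for K
    by (rule tendsto_upperbound[OF lim]) (auto intro!: always_eventually simp: sum_prob_R)
  thus "\<forall>\<^sub>F K in sequentially. (\<Sum>k\<in>{0..K}. (1 - c) * borel_weight k) \<le> 1"
    by (simp add: atLeast0AtMost)
  have "(\<lambda>K. 1 - tail_bound K) \<longlonglongrightarrow> 1 - 0" by (intro tendsto_intros tail_bound_tendsto)
  thus "(\<lambda>K. 1 - tail_bound K) \<longlonglongrightarrow> 1" by simp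
qed simp

end

section \<open>The last excursion of the exponential walk\<close>

lemma walk_0: "walk c g 0 = 0" by (simp add: walk_def)

lemma walk_Suc_eq: "walk c g (Suc m) = g 0 - c + walk c (\<lambda>i. g (Suc i)) m"
  unfolding walk_def by (rule sum.lessThan_Suc_shift)

lemma walk_add: "walk c g (k + m) = walk c g k + walk c (\<lambda>i. g (k + i)) m"
  by (induction m) (simp_all add: walk_def)

lemma walk_cong: "(\<And>i. i < k \<Longrightarrow> f i = g i) \<Longrightarrow> walk c f k = walk c g k"
  by (simp add: walk_def)

lemma walk_measurable:
  "(\<And>i. i < k \<Longrightarrow> (\<lambda>x. f x i) \<in> borel_measurable M) \<Longrightarrow> (\<lambda>x. walk c (f x) k) \<in> borel_measurable M"
  unfolding walk_def by (intro borel_measurable_sum borel_measurable_diff) auto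

lemma last_negative_time_eq_iff:
  assumes "finite {j. walk c g j < 0}"
  shows "last_negative_time c g = k \<longleftrightarrow>
    (k = 0 \<or> walk c g k < 0) \<and> (\<forall>m. 0 \<le> walk c g (k + Suc m))"
proof (cases "{j. walk c g j < 0} = {}")
  case True
  hence "0 \<le> walk c g j" for j by (auto simp: not_less)
  thus ?thesis using True by (auto simp: last_negative_time_def not_less[symmetric])
next
  case False
  have t: "last_negative_time c g = Max {j. walk c g j < 0}"
    unfolding last_negative_time_def by (rule if_not_P[OF False])
  show ?thesis
  proof
    assume k: "last_negative_time c g = k"
    have "k \<in> {j. walk c g j < 0}" using Max_in[OF assms False] k t by simp
    moreover have "0 \<le> walk c g (k + Suc m)" for m
    proof (rule ccontr)
      assume "\<not> 0 \<le> walk c g (k + Suc m)"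
      hence "k + Suc m \<le> k" using Max_ge[OF assms, of "k + Suc m"] k t by simp
      thus False by simp
    qed
    ultimately show "(k = 0 \<or> walk c g k < 0) \<and> (\<forall>m. 0 \<le> walk c g (k + Suc m))" by auto
  next
    assume k: "(k = 0 \<or> walk c g k < 0) \<and> (\<forall>m. 0 \<le> walk c g (k + Suc m))"
    have le: "j \<le> k" if "walk c g j < 0" for j
    proof (rule ccontr)
      assume "\<not> j \<le> k"
      hence "j = k + Suc (j - k - 1)" by simp
      hence "0 \<le> walk c g j" using k by metis
      thus False using that by simp
    qed
    have "walk c g k < 0"
    proof (cases "k = 0")
      case True
      obtain j where "walk c g j < 0" using False by auto
      moreover hence "j = k" using le[of j] True by simp
      ultimately show ?thesis by simp
    qed (use k in auto)
    thus "last_negative_time c g = k" unfolding t using assms le by (intro Max_eqI) auto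
  qed
qed

text \<open>
  Fubini's theorem for independent variables, without reference to their laws.
\<close>
lemma (in prob_space) emeasure_indep_pair:
  assumes ind: "indep_var S X T Y" and P: "Measurable.pred (S \<Otimes>\<^sub>M T) P"
  shows "emeasure M {\<omega>\<in>space M. P (X \<omega>, Y \<omega>)} =
    (\<integral>\<^sup>+\<omega>. emeasure M {\<omega>'\<in>space M. P (X \<omega>, Y \<omega>')} \<partial>M)"
proof -
  have X[measurable]: "X \<in> measurable M S" and Y[measurable]: "Y \<in> measurable M T"
    and eq: "distr M S X \<Otimes>\<^sub>M distr M T Y = distr M (S \<Otimes>\<^sub>M T) (\<lambda>x. (X x, Y x))"
    using ind by (auto simp: indep_var_distribution_eq)
  interpret Y: prob_space "distr M T Y" by (rule prob_space_distr) simp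
  define A where "A = {z\<in>space (S \<Otimes>\<^sub>M T). P z}"
  have A[measurable]: "A \<in> sets (S \<Otimes>\<^sub>M T)" using P by (simp add: A_def pred_def)
  have A': "A \<in> sets (S \<Otimes>\<^sub>M distr M T Y)" "A \<in> sets (distr M S X \<Otimes>\<^sub>M distr M T Y)"
    using A by (simp_all cong: sets_pair_measure_cong)
  have "{\<omega>\<in>space M. P (X \<omega>, Y \<omega>)} = (\<lambda>x. (X x, Y x)) -` A \<inter> space M"
    using measurable_space[OF X] measurable_space[OF Y] by (auto simp: A_def space_pair_measure)
  hence "emeasure M {\<omega>\<in>space M. P (X \<omega>, Y \<omega>)} = emeasure (distr M (S \<Otimes>\<^sub>M T) (\<lambda>x. (X x, Y x))) A"
    by (simp add: emeasure_distr)
  also have "\<dots> = (\<integral>\<^sup>+x. emeasure (distr M T Y) (Pair x -` A) \<partial>distr M S X)"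
    unfolding eq[symmetric] by (rule Y.emeasure_pair_measure_alt[OF A'(2)])
  also have "\<dots> = (\<integral>\<^sup>+\<omega>. emeasure (distr M T Y) (Pair (X \<omega>) -` A) \<partial>M)"
    using Y.measurable_emeasure_Pair[OF A'(1)] by (intro nn_integral_distr) auto
  also have "\<dots> = (\<integral>\<^sup>+\<omega>. emeasure M {\<omega>'\<in>space M. P (X \<omega>, Y \<omega>')} \<partial>M)"
  proof (intro nn_integral_cong)
    fix \<omega> assume w: "\<omega> \<in> space M"
    have "Pair (X \<omega>) -` A \<in> sets T" by (rule sets_Pair1[OF A])
    hence "emeasure (distr M T Y) (Pair (X \<omega>) -` A) = emeasure M (Y -` (Pair (X \<omega>) -` A) \<inter> space M)"
      by (intro emeasure_distr) auto
    also have "Y -` (Pair (X \<omega>) -` A) \<inter> space M = {\<omega>'\<in>space M. P (X \<omega>, Y \<omega>')}"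
      using measurable_space[OF X w] measurable_space[OF Y] by (auto simp: A_def space_pair_measure)
    finally show "emeasure (distr M T Y) (Pair (X \<omega>) -` A) = emeasure M {\<omega>'\<in>space M. P (X \<omega>, Y \<omega>')}" .
  qed
  finally show ?thesis .
qed

lemma (in prob_space) exponential_prob_ge:
  assumes Y: "distributed M lborel Y (exponential_density 1)" and a: "0 \<le> a"
  shows "prob {\<omega>\<in>space M. a \<le> Y \<omega>} = exp (- a)"
proof -
  have [measurable]: "Y \<in> borel_measurable M" using distributed_measurable[OF Y] by simp
  have "emeasure M (Y -` {a} \<inter> space M) = (\<integral>\<^sup>+x. ennreal (exponential_density 1 x) * indicator {a} x \<partial>lborel)"
    by (rule distributed_emeasure[OF Y]) simp
  also have "\<dots> = 0"
  proof (subst nn_integral_0_iff_AE)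
    show "AE x in lborel. ennreal (exponential_density 1 x) * indicator {a} x = 0"
      using AE_lborel_singleton[of a] by eventually_elim simp
  qed auto
  finally have 0: "prob (Y -` {a} \<inter> space M) = 0" by (simp add: measure_def)
  have "{\<omega>\<in>space M. a \<le> Y \<omega>} = {\<omega>\<in>space M. a < Y \<omega>} \<union> (Y -` {a} \<inter> space M)" by auto
  also have "prob \<dots> = prob {\<omega>\<in>space M. a < Y \<omega>} + prob (Y -` {a} \<inter> space M)"
    by (intro finite_measure_Union) auto
  finally show ?thesis using exponential_distributedD_gt[OF Y a] 0 by simp
qed

text \<open>
  All conditions together say that \<open>Y\<close> is at least the supremum of the \<open>v m\<close>, which is \<open>\<ge> v 0 \<ge> 0\<close>.
  If the supremum is infinite, both events are empty.
\<close>
lemma (in prob_space) exponential_memoryless_family: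
  assumes Y: "distributed M lborel Y (exponential_density 1)" and x: "0 \<le> x" and v: "0 \<le> v (0::nat)"
  shows "emeasure M {\<omega>\<in>space M. \<forall>m. x + v m \<le> Y \<omega>} =
    ennreal (exp (- x)) * emeasure M {\<omega>\<in>space M. \<forall>m. v m \<le> Y \<omega>}"
proof (cases "bdd_above (range v)")
  case True
  define s where "s = (SUP m. v m)"
  have v_le: "v m \<le> s" for m unfolding s_def using True by (intro cSUP_upper) auto
  hence s: "0 \<le> s" using v order.trans by blast
  have iff: "(\<forall>m. z + v m \<le> y) \<longleftrightarrow> z + s \<le> y" for z y
  proof
    assume "\<forall>m. z + v m \<le> y"
    hence "s \<le> y - z" unfolding s_def by (intro cSUP_least) (auto simp: algebra_simps)
    thus "z + s \<le> y" by simp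
  next
    assume "z + s \<le> y"
    thus "\<forall>m. z + v m \<le> y" using v_le by (metis add_left_mono order.trans)
  qed
  have "emeasure M {\<omega>\<in>space M. z + s \<le> Y \<omega>} = ennreal (exp (- (z + s)))" if "0 \<le> z" for z
    using exponential_prob_ge[OF Y, of "z + s"] s that by (simp add: emeasure_eq_measure)
  from this[of x] this[of 0] show ?thesis
    using x iff[of x] iff[of 0] by (simp add: ennreal_mult[symmetric] exp_add[symmetric])
next
  case False
  have "\<not> (\<forall>m. z + v m \<le> y)" for z y
  proof
    assume "\<forall>m. z + v m \<le> y"
    hence "bdd_above (range v)" by (intro bdd_aboveI[of _ "y - z"]) (auto simp: algebra_simps)
    thus False using False by simp
  qed
  hence e: "{\<omega>\<in>space M. \<forall>m. z + v m \<le> Y \<omega>} = {}" for z by blast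
  have "{\<omega>\<in>space M. \<forall>m. v m \<le> Y \<omega>} = {}" using e[of 0] by (simp only: add_0)
  thus ?thesis unfolding e by (simp only: emeasure_empty mult_zero_right)
qed

locale exponential_walk = prob_space N for N :: "'b measure" +
  fixes \<gamma> :: "nat \<Rightarrow> 'b \<Rightarrow> real" and c :: real
  assumes \<gamma>_indep: "indep_vars (\<lambda>_. borel) \<gamma> UNIV"
    and \<gamma>_exp: "\<And>j. distributed N lborel (\<gamma> j) (exponential_density 1)"
    and c: "0 < c" "c < 1"
begin

lemma \<gamma>_measurable [measurable]: "\<gamma> j \<in> borel_measurable N"
  using distributed_measurable[OF \<gamma>_exp, of j] by simp

abbreviation "S k \<omega> \<equiv> walk c (\<lambda>i. \<gamma> i \<omega>) k"
abbreviation "\<tau> \<omega> \<equiv> last_negative_time c (\<lambda>i. \<gamma> i \<omega>)"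

lemma walk_\<gamma>_measurable [measurable]: "(\<lambda>\<omega>. walk c (\<lambda>i. \<gamma> (k + i) \<omega>) j) \<in> borel_measurable N"
  by (rule walk_measurable) measurable

lemma S_measurable [measurable]: "S j \<in> borel_measurable N"
  by (rule walk_measurable) measurable

definition "stay_above_prob k x = emeasure N {\<omega>\<in>space N. \<forall>m. x \<le> walk c (\<lambda>i. \<gamma> (k + i) \<omega>) (Suc m)}"

text \<open>
  Given the later steps, staying above \<open>x\<close> requires the first step to exceed \<open>x\<close> plus a
  quantity that is at least \<open>c\<close>.
\<close>
lemma stay_above_prob_memoryless:
  assumes x: "0 \<le> x"
  shows "stay_above_prob k x = ennreal (exp (- x)) * stay_above_prob k 0"
proof -
  define X where "X \<omega> = restrict (\<lambda>i. \<gamma> i \<omega>) {Suc k..}" for \<omega>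
  define Y where "Y \<omega> = restrict (\<lambda>i. \<gamma> i \<omega>) {k}" for \<omega>
  define v where "v a m = c - walk c (\<lambda>i. a (Suc k + i)) m" for a :: "nat \<Rightarrow> real" and m
  have ind: "indep_var (PiM {Suc k..} (\<lambda>_. borel)) X (PiM {k} (\<lambda>_. borel)) Y"
    unfolding X_def Y_def using \<gamma>_indep by (intro indep_var_restrict) auto
  have stay_above_prob: "stay_above_prob k z = (\<integral>\<^sup>+\<omega>. emeasure N {\<omega>'\<in>space N. \<forall>m. z + v (X \<omega>) m \<le> \<gamma> k \<omega>'} \<partial>N)" for z
  proof -
    define P where "P = (\<lambda>(a, b). \<forall>m. z + v a m \<le> (b k :: real))"
    have [measurable]: "(\<lambda>a. v a m) \<in> borel_measurable (PiM {Suc k..} (\<lambda>_. borel))" for m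
      unfolding v_def by (intro borel_measurable_diff walk_measurable measurable_component_singleton) auto
    have [measurable]: "(\<lambda>b. b k) \<in> borel_measurable (PiM {k} (\<lambda>_. borel))"
      by (intro measurable_component_singleton) auto
    have P: "Measurable.pred (PiM {Suc k..} (\<lambda>_. borel) \<Otimes>\<^sub>M PiM {k} (\<lambda>_. borel)) P"
      unfolding P_def case_prod_beta by measurable
    have "stay_above_prob k z = emeasure N {\<omega>\<in>space N. P (X \<omega>, Y \<omega>)}"
      by (simp add: stay_above_prob_def P_def X_def Y_def v_def walk_Suc_eq algebra_simps)
    also have "\<dots> = (\<integral>\<^sup>+\<omega>. emeasure N {\<omega>'\<in>space N. P (X \<omega>, Y \<omega>')} \<partial>N)"
      by (rule emeasure_indep_pair[OF ind P])
    finally show ?thesis by (simp add: P_def Y_def)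
  qed
  have v0: "0 \<le> v a 0" for a using c by (simp add: v_def walk_0)
  have "stay_above_prob k x = (\<integral>\<^sup>+\<omega>. ennreal (exp (- x)) * emeasure N {\<omega>'\<in>space N. \<forall>m. 0 + v (X \<omega>) m \<le> \<gamma> k \<omega>'} \<partial>N)"
    unfolding stay_above_prob exponential_memoryless_family[where v = "v (X _)", OF \<gamma>_exp x v0] by simp
  also have "\<dots> = ennreal (exp (- x)) * stay_above_prob k 0"
    unfolding stay_above_prob
  proof (rule nn_integral_cmult)
    have [measurable]: "(\<lambda>\<omega>. v (X \<omega>) m) \<in> borel_measurable N" for m
      unfolding v_def X_def by (intro borel_measurable_diff walk_measurable) auto
    show "(\<lambda>\<omega>. emeasure N {\<omega>'\<in>space N. \<forall>m. 0 + v (X \<omega>) m \<le> \<gamma> k \<omega>'}) \<in> borel_measurable N"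
      by measurable
  qed
  finally show ?thesis .
qed

lemma shifted_law:
  "distr N (PiM UNIV (\<lambda>_. borel)) (\<lambda>\<omega> i. \<gamma> (k + i) \<omega>) = PiM UNIV (\<lambda>_. density lborel (exponential_density 1))"
proof -
  let ?D = "density lborel (exponential_density 1) :: real measure"
  let ?B = "PiM UNIV (\<lambda>_. borel) :: (nat \<Rightarrow> real) measure"
  have D: "distr N borel (\<gamma> i) = ?D" for i
  proof -
    have "distr N borel (\<gamma> i) = distr N lborel (\<gamma> i)" by (intro distr_cong) auto
    thus ?thesis using distributed_distr_eq_density[OF \<gamma>_exp, of i] by simp
  qed
  interpret D: prob_space ?D by (rule prob_space_exponential_density) simp
  have sets: "sets (PiM UNIV (\<lambda>_::nat. ?D)) = sets ?B" by (intro sets_PiM_cong) auto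
  have 0: "distr N ?B (\<lambda>\<omega> i. \<gamma> i \<omega>) = PiM UNIV (\<lambda>_. ?D)"
    using indep_vars_iff_distr_eq_PiM'[of UNIV \<gamma> "\<lambda>_. borel"] \<gamma>_indep
    by (simp add: D restrict_UNIV)
  have [measurable]: "(\<lambda>\<omega> i. \<gamma> i \<omega>) \<in> measurable N ?B" "(\<lambda>g i. g (k + i)) \<in> measurable ?B ?B"
    by (auto intro!: measurable_PiM_single' measurable_component_singleton simp: space_PiM)
  have "distr N ?B (\<lambda>\<omega> i. \<gamma> (k + i) \<omega>) = distr (distr N ?B (\<lambda>\<omega> i. \<gamma> i \<omega>)) ?B (\<lambda>g i. g (k + i))"
    by (subst distr_distr) (auto simp: comp_def)
  also have "\<dots> = distr (PiM UNIV (\<lambda>_. ?D)) (PiM UNIV (\<lambda>_. ?D)) (\<lambda>g. \<lambda>i\<in>UNIV. g (k + i))"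
    unfolding 0 using sets by (intro distr_cong) auto
  also have "\<dots> = PiM UNIV (\<lambda>_. ?D)"
    by (rule distr_PiM_reindex) (auto simp: D.prob_space_axioms)
  finally show ?thesis .
qed

lemma stay_above_prob_shift: "stay_above_prob k 0 = stay_above_prob 0 0"
proof -
  let ?B = "PiM UNIV (\<lambda>_. borel) :: (nat \<Rightarrow> real) measure"
  define A where "A = {g\<in>space ?B. \<forall>m. 0 \<le> walk c g (Suc m)}"
  have [measurable]: "(\<lambda>g. walk c g m) \<in> borel_measurable ?B" for m
    by (intro walk_measurable measurable_component_singleton) auto
  have A: "A \<in> sets ?B" unfolding A_def by measurable
  have "stay_above_prob j 0 = emeasure (PiM UNIV (\<lambda>_. density lborel (exponential_density 1))) A" for j
  proof -
    have m: "(\<lambda>\<omega> i. \<gamma> (j + i) \<omega>) \<in> measurable N ?B"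
      by (auto intro!: measurable_PiM_single' simp: space_PiM)
    have "emeasure (distr N ?B (\<lambda>\<omega> i. \<gamma> (j + i) \<omega>)) A = emeasure N ((\<lambda>\<omega> i. \<gamma> (j + i) \<omega>) -` A \<inter> space N)"
      by (rule emeasure_distr[OF m A])
    also have "(\<lambda>\<omega> i. \<gamma> (j + i) \<omega>) -` A \<inter> space N = {\<omega>\<in>space N. \<forall>m. 0 \<le> walk c (\<lambda>i. \<gamma> (j + i) \<omega>) (Suc m)}"
      by (auto simp: A_def space_PiM)
    finally show ?thesis by (simp add: shifted_law stay_above_prob_def)
  qed
  thus ?thesis by metis
qed

text \<open>
  The past up to time \<open>k\<close> enters only through \<open>S k\<close>, and the independent future has to stay above the
  level \<open>- S k > 0\<close>.
\<close>
lemma emeasure_last_negative: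
  "emeasure N {\<omega>\<in>space N. S k \<omega> < 0 \<and> (\<forall>m. 0 \<le> S (k + Suc m) \<omega>)} =
    (\<integral>\<^sup>+\<omega>. ennreal (if S k \<omega> < 0 then exp (S k \<omega>) else 0) \<partial>N) * stay_above_prob 0 0"
proof -
  define X where "X \<omega> = restrict (\<lambda>i. \<gamma> i \<omega>) {..<k}" for \<omega>
  define Y where "Y \<omega> = restrict (\<lambda>i. \<gamma> i \<omega>) {k..}" for \<omega>
  define P where "P = (\<lambda>(a, b). walk c a k < 0 \<and> (\<forall>m. - walk c a k \<le> walk c (\<lambda>i. b (k + i)) (Suc m)))"
  have ind: "indep_var (PiM {..<k} (\<lambda>_. borel)) X (PiM {k..} (\<lambda>_. borel)) Y"
    unfolding X_def Y_def using \<gamma>_indep by (intro indep_var_restrict) auto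
  have [measurable]: "(\<lambda>a. walk c a k) \<in> borel_measurable (PiM {..<k} (\<lambda>_. borel))"
    by (intro walk_measurable measurable_component_singleton) auto
  have [measurable]: "(\<lambda>b. walk c (\<lambda>i. b (k + i)) m) \<in> borel_measurable (PiM {k..} (\<lambda>_. borel))" for m
    by (intro walk_measurable measurable_component_singleton) auto
  have P: "Measurable.pred (PiM {..<k} (\<lambda>_. borel) \<Otimes>\<^sub>M PiM {k..} (\<lambda>_. borel)) P"
    unfolding P_def case_prod_beta by measurable
  have X: "walk c (X \<omega>) k = S k \<omega>" for \<omega> by (rule walk_cong) (simp add: X_def)
  have Y: "walk c (\<lambda>i. Y \<omega> (k + i)) m = walk c (\<lambda>i. \<gamma> (k + i) \<omega>) m" for \<omega> m
    by (rule walk_cong) (simp add: Y_def)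
  have "emeasure N {\<omega>\<in>space N. S k \<omega> < 0 \<and> (\<forall>m. 0 \<le> S (k + Suc m) \<omega>)} = emeasure N {\<omega>\<in>space N. P (X \<omega>, Y \<omega>)}"
  proof -
    have "(\<forall>m. 0 \<le> S (k + Suc m) \<omega>) \<longleftrightarrow> (\<forall>m. - S k \<omega> \<le> walk c (\<lambda>i. \<gamma> (k + i) \<omega>) (Suc m))" for \<omega>
    proof -
      have "0 \<le> S (k + Suc m) \<omega> \<longleftrightarrow> - S k \<omega> \<le> walk c (\<lambda>i. \<gamma> (k + i) \<omega>) (Suc m)" for m
        unfolding walk_add[of c _ k] by linarith
      thus ?thesis by (simp only:)
    qed
    thus ?thesis unfolding P_def case_prod_conv X Y by simp
  qed
  also have "\<dots> = (\<integral>\<^sup>+\<omega>. emeasure N {\<omega>'\<in>space N. P (X \<omega>, Y \<omega>')} \<partial>N)"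
    by (rule emeasure_indep_pair[OF ind P])
  also have "\<dots> = (\<integral>\<^sup>+\<omega>. ennreal (if S k \<omega> < 0 then exp (S k \<omega>) else 0) * stay_above_prob 0 0 \<partial>N)"
  proof (intro nn_integral_cong)
    fix \<omega> assume "\<omega> \<in> space N"
    show "emeasure N {\<omega>'\<in>space N. P (X \<omega>, Y \<omega>')} = ennreal (if S k \<omega> < 0 then exp (S k \<omega>) else 0) * stay_above_prob 0 0"
    proof (cases "S k \<omega> < 0")
      case True
      hence "emeasure N {\<omega>'\<in>space N. P (X \<omega>, Y \<omega>')} = stay_above_prob k (- S k \<omega>)"
        by (simp add: P_def X Y stay_above_prob_def)
      thus ?thesis using True stay_above_prob_memoryless[of "- S k \<omega>" k] stay_above_prob_shift[of k] by simp
    qed (simp add: P_def X)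
  qed
  also have "\<dots> = (\<integral>\<^sup>+\<omega>. ennreal (if S k \<omega> < 0 then exp (S k \<omega>) else 0) \<partial>N) * stay_above_prob 0 0"
    by (intro nn_integral_multc) measurable
  finally show ?thesis .
qed

text \<open>
  Against the Erlang density \<open>x\<^sup>k exp (- x) / k!\<close> the exponentials cancel, which leaves the
  integral of a monomial.
\<close>
lemma nn_integral_exp_negative_part:
  "(\<integral>\<^sup>+\<omega>. ennreal (if S (Suc k) \<omega> < 0 then exp (S (Suc k) \<omega>) else 0) \<partial>N) =
    ennreal ((c * real (Suc k)) ^ Suc k / fact (Suc k) * exp (- (c * real (Suc k))))"
proof -
  define a where "a = c * real (Suc k)"
  have a: "0 < a" using c by (simp add: a_def)
  define g where "g x = ennreal (if x < a then exp (x - a) else 0)" for x :: real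
  have g: "g \<in> borel_measurable lborel" unfolding g_def by measurable
  have "distributed N lborel (\<lambda>\<omega>. \<Sum>i\<in>{..<Suc k}. \<gamma> i \<omega>) (erlang_density (card {..<Suc k} - 1) 1)"
    by (intro exponential_distributed_sum \<gamma>_exp indep_vars_subset[OF \<gamma>_indep]) auto
  hence D: "distributed N lborel (\<lambda>\<omega>. \<Sum>i<Suc k. \<gamma> i \<omega>) (erlang_density k 1)" by simp
  have S: "S (Suc k) \<omega> = (\<Sum>i<Suc k. \<gamma> i \<omega>) - a" for \<omega>
    by (simp add: walk_def a_def sum_subtractf algebra_simps)
  have "(\<integral>\<^sup>+\<omega>. ennreal (if S (Suc k) \<omega> < 0 then exp (S (Suc k) \<omega>) else 0) \<partial>N) = (\<integral>\<^sup>+\<omega>. g (\<Sum>i<Suc k. \<gamma> i \<omega>) \<partial>N)"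
    unfolding S g_def by simp
  also have "\<dots> = (\<integral>\<^sup>+x. erlang_density k 1 x * g x \<partial>lborel)"
    by (rule distributed_nn_integral[OF D g, symmetric])
  also have "\<dots> = (\<integral>\<^sup>+x. ennreal (x ^ k / fact k * exp (- a)) * indicator {0..a} x \<partial>lborel)"
  proof (rule nn_integral_cong_AE)
    show "AE x in lborel. ennreal (erlang_density k 1 x) * g x = ennreal (x ^ k / fact k * exp (- a)) * indicator {0..a} x"
      using AE_lborel_singleton[of a]
    proof eventually_elim
      case (elim x)
      show ?case
      proof (cases "0 \<le> x \<and> x < a")
        case True
        have "erlang_density k 1 x * exp (x - a) = x ^ k / fact k * exp (- a)"
          using True by (simp add: erlang_density_def exp_diff exp_minus field_simps)
        thus ?thesis using True by (simp add: g_def ennreal_mult'[symmetric])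
      next
        case False
        thus ?thesis using elim by (auto simp: g_def erlang_density_def)
      qed
    qed
  qed
  also have "\<dots> = ennreal (a ^ Suc k / fact (Suc k) * exp (- a) - 0 ^ Suc k / fact (Suc k) * exp (- a))"
  proof (rule nn_integral_FTC_Icc)
    fix x assume "x \<in> {0..a}"
    show "((\<lambda>x. x ^ Suc k / fact (Suc k) * exp (- a)) has_real_derivative x ^ k / fact k * exp (- a)) (at x)"
    proof -
      have "((\<lambda>x. x ^ Suc k * (exp (- a) / fact (Suc k))) has_real_derivative
         (real (Suc k) * x ^ (Suc k - Suc 0)) * (exp (- a) / fact (Suc k))) (at x)"
        by (rule DERIV_cmult_right[OF DERIV_pow])
      moreover have "(real (Suc k) * x ^ (Suc k - Suc 0)) * (exp (- a) / fact (Suc k)) = x ^ k / fact k * exp (- a)"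
        by (simp add: fact_Suc field_simps del: of_nat_Suc)
      moreover have "(\<lambda>x. x ^ Suc k * (exp (- a) / fact (Suc k))) = (\<lambda>x. x ^ Suc k / fact (Suc k) * exp (- a))"
        by (simp only: times_divide_eq_right times_divide_eq_left)
      ultimately show ?thesis by (simp only:)
    qed
    show "0 \<le> x ^ k / fact k * exp (- a)" using \<open>x \<in> {0..a}\<close> by simp
  qed (use a in auto)
  finally show ?thesis by (simp add: a_def)
qed

lemma prob_S_negative_le: "prob {\<omega>\<in>space N. S j \<omega> < 0} \<le> (c * exp (1 - c)) ^ j"
proof -
  \<comment> \<open>The exponent that minimises \<open>exp (t * c) / (1 + t)\<close>, the mean of \<open>exp (- t * (\<gamma> i - c))\<close>.\<close>
  define t where "t = 1 / c - 1"
  have t: "0 < t" "1 + t = 1 / c" "t * c = 1 - c" using c by (auto simp: t_def field_simps)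
  define Z where "Z i \<omega> = ennreal (exp (- t * (\<gamma> i \<omega> - c)))" for i \<omega>
  have ind: "indep_vars (\<lambda>_. borel) Z {..<j}"
    unfolding Z_def
    by (rule indep_vars_subset[OF indep_vars_compose2[OF \<gamma>_indep, where Y = "\<lambda>_ x. ennreal (exp (- t * (x - c)))"]]) auto
  have EZ: "(\<integral>\<^sup>+\<omega>. Z i \<omega> \<partial>N) = ennreal (c * exp (1 - c))" for i
  proof -
    have "(\<integral>\<^sup>+\<omega>. Z i \<omega> \<partial>N) = (\<integral>\<^sup>+x. exponential_density 1 x * ennreal (exp (- t * (x - c))) \<partial>lborel)"
      unfolding Z_def by (subst distributed_nn_integral[OF \<gamma>_exp]) auto
    also have "\<dots> = (\<integral>\<^sup>+x. ennreal (c * exp (1 - c)) * ennreal (exponential_density (1 + t) x) \<partial>lborel)"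
    proof (intro nn_integral_cong)
      fix x
      have "- x - t * (x - c) = (1 - c) - x * (1 + t)" using t(3) by (simp add: algebra_simps)
      hence "exp (- x) * exp (- t * (x - c)) = exp (1 - c) * exp (- x * (1 + t))"
        by (simp add: exp_add[symmetric] algebra_simps)
      hence "exponential_density 1 x * exp (- t * (x - c)) = c * exp (1 - c) * exponential_density (1 + t) x"
        using c t by (auto simp: exponential_density_def)
      thus "ennreal (exponential_density 1 x) * ennreal (exp (- t * (x - c))) =
         ennreal (c * exp (1 - c)) * ennreal (exponential_density (1 + t) x)"
        using c t by (simp add: ennreal_mult[symmetric])
    qed
    also have "\<dots> = ennreal (c * exp (1 - c)) * (\<integral>\<^sup>+x. ennreal (exponential_density (1 + t) x) \<partial>lborel)"
      by (intro nn_integral_cmult) auto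
    also have "(\<integral>\<^sup>+x. ennreal (exponential_density (1 + t) x) \<partial>lborel) = 1"
      using nn_integral_erlang_ith_moment[of "1 + t" 0 0] t(1) by simp
    finally show ?thesis by simp
  qed
  have "emeasure N {\<omega>\<in>space N. S j \<omega> < 0} = (\<integral>\<^sup>+\<omega>. indicator {\<omega>\<in>space N. S j \<omega> < 0} \<omega> \<partial>N)"
    by (subst nn_integral_indicator) auto
  also have "\<dots> \<le> (\<integral>\<^sup>+\<omega>. (\<Prod>i<j. Z i \<omega>) \<partial>N)"
  proof (intro nn_integral_mono)
    fix \<omega>
    have "(\<Prod>i<j. Z i \<omega>) = ennreal (\<Prod>i<j. exp (- t * (\<gamma> i \<omega> - c)))"
      unfolding Z_def by (rule prod_ennreal) simp
    also have "(\<Prod>i<j. exp (- t * (\<gamma> i \<omega> - c))) = exp (- t * S j \<omega>)"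
      by (simp add: walk_def exp_sum[symmetric] sum_distrib_left)
    finally have "(\<Prod>i<j. Z i \<omega>) = ennreal (exp (- t * S j \<omega>))" .
    moreover have "1 \<le> exp (- t * S j \<omega>)" if "S j \<omega> < 0"
      using t that by (simp add: mult_le_0_iff)
    ultimately show "indicator {\<omega>\<in>space N. S j \<omega> < 0} \<omega> \<le> (\<Prod>i<j. Z i \<omega>)"
      by (auto simp: indicator_def)
  qed
  also have "\<dots> = (\<Prod>i<j. \<integral>\<^sup>+\<omega>. Z i \<omega> \<partial>N)" by (intro indep_vars_nn_integral ind) auto
  also have "\<dots> = ennreal ((c * exp (1 - c)) ^ j)" using c by (simp add: EZ ennreal_power)
  finally show ?thesis using c by (simp add: emeasure_eq_measure)
qed

lemma AE_finite_negative: "AE \<omega> in N. finite {j. S j \<omega> < 0}"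
proof -
  have "summable (\<lambda>j. (c * exp (1 - c)) ^ j)"
    using c mult_exp_one_minus_less_1[of c] by (intro summable_geometric) auto
  hence "summable (\<lambda>j. prob {\<omega>\<in>space N. S j \<omega> < 0})"
    by (rule summable_comparison_test') (use prob_S_negative_le in auto)
  hence "AE \<omega> in N. eventually (\<lambda>j. \<omega> \<in> space N - {\<omega>\<in>space N. S j \<omega> < 0}) sequentially"
    by (intro borel_cantelli_AE1) (auto simp: emeasure_eq_measure)
  thus ?thesis
  proof eventually_elim
    case (elim \<omega>)
    then obtain n where n: "\<And>j. j \<ge> n \<Longrightarrow> \<omega> \<in> space N - {\<omega>\<in>space N. S j \<omega> < 0}"
      by (auto simp: eventually_sequentially)
    have "{j. S j \<omega> < 0} \<subseteq> {..<n}" using n by (force simp: not_le[symmetric])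
    thus ?case using finite_subset by blast
  qed
qed

lemma \<tau>_measurable [measurable]: "\<tau> \<in> measurable N (count_space UNIV)"
proof (subst measurable_count_space_eq2_countable, safe)
  fix k
  let ?fin = "\<lambda>\<omega>. \<exists>n. \<forall>j. n \<le> j \<longrightarrow> \<not> S j \<omega> < 0"
  have fin: "finite {j. S j \<omega> < 0} \<longleftrightarrow> ?fin \<omega>" for \<omega>
    by (auto simp: finite_nat_set_iff_bounded not_le[symmetric])
  \<comment> \<open>All infinite sets have the same, unspecified maximum, so \<open>\<tau>\<close> is constant on the null set where it is not the last negative time.\<close>
  have inf: "\<tau> \<omega> = Max (UNIV :: nat set)" if "\<not> finite {j. S j \<omega> < 0}" for \<omega>
    using that Max.infinite[OF that] Max.infinite[OF infinite_UNIV_nat]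
    by (auto simp: last_negative_time_def)
  have "\<tau> \<omega> = k \<longleftrightarrow> (?fin \<omega> \<and> (k = 0 \<or> S k \<omega> < 0) \<and> (\<forall>m. 0 \<le> S (k + Suc m) \<omega>)) \<or>
      (\<not> ?fin \<omega> \<and> k = Max (UNIV :: nat set))" for \<omega>
    using last_negative_time_eq_iff[of c "\<lambda>i. \<gamma> i \<omega>" k] inf[of \<omega>] fin[of \<omega>] by metis
  note eq = this
  have "\<tau> -` {k} \<inter> space N = {\<omega>\<in>space N. \<tau> \<omega> = k}" by auto
  also have "\<dots> = {\<omega>\<in>space N. (?fin \<omega> \<and> (k = 0 \<or> S k \<omega> < 0) \<and> (\<forall>m. 0 \<le> S (k + Suc m) \<omega>)) \<or>
      (\<not> ?fin \<omega> \<and> k = Max (UNIV :: nat set))}"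
    unfolding eq ..
  also have "\<dots> \<in> sets N" by measurable
  finally show "\<tau> -` {k} \<inter> space N \<in> sets N" .
qed auto

text \<open>
  For \<open>k = 0\<close> the condition \<open>S k < 0\<close> is absent and \<open>0 ^ 0 = 1\<close> makes the formula correct.
\<close>
lemma prob_\<tau>_proportional:
  "prob {\<omega>\<in>space N. \<tau> \<omega> = k} = enn2real (stay_above_prob 0 0) * ((c * real k) ^ k / fact k * exp (- (c * real k)))"
proof -
  have "emeasure N {\<omega>\<in>space N. \<tau> \<omega> = k} =
      emeasure N {\<omega>\<in>space N. (k = 0 \<or> S k \<omega> < 0) \<and> (\<forall>m. 0 \<le> S (k + Suc m) \<omega>)}"
    using AE_finite_negative
  proof (intro emeasure_eq_AE)
    show "AE \<omega> in N. (\<omega> \<in> {\<omega>\<in>space N. \<tau> \<omega> = k}) \<longleftrightarrow>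
      (\<omega> \<in> {\<omega>\<in>space N. (k = 0 \<or> S k \<omega> < 0) \<and> (\<forall>m. 0 \<le> S (k + Suc m) \<omega>)})"
      using AE_finite_negative by eventually_elim (simp add: last_negative_time_eq_iff)
  qed measurable
  also have "\<dots> = ennreal ((c * real k) ^ k / fact k * exp (- (c * real k))) * stay_above_prob 0 0"
  proof (cases k)
    case 0
    thus ?thesis by (simp add: stay_above_prob_def)
  next
    case (Suc k')
    have "emeasure N {\<omega>\<in>space N. (k = 0 \<or> S k \<omega> < 0) \<and> (\<forall>m. 0 \<le> S (k + Suc m) \<omega>)} =
       emeasure N {\<omega>\<in>space N. S k \<omega> < 0 \<and> (\<forall>m. 0 \<le> S (k + Suc m) \<omega>)}"
      using Suc by simp
    thus ?thesis unfolding emeasure_last_negative unfolding Suc nn_integral_exp_negative_part .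
  qed
  finally have "emeasure N {\<omega>\<in>space N. \<tau> \<omega> = k} = ennreal ((c * real k) ^ k / fact k * exp (- (c * real k))) * stay_above_prob 0 0" .
  thus ?thesis using c by (simp add: measure_def enn2real_mult mult.commute)
qed

lemma prob_\<tau>_sums: "(\<lambda>k. prob {\<omega>\<in>space N. \<tau> \<omega> = k}) sums 1"
proof -
  have "(\<lambda>k. prob {\<omega>\<in>space N. \<tau> \<omega> = k}) sums prob (\<Union>k. {\<omega>\<in>space N. \<tau> \<omega> = k})"
    by (intro finite_measure_UNION) (auto simp: disjoint_family_on_def)
  also have "(\<Union>k. {\<omega>\<in>space N. \<tau> \<omega> = k}) = space N" by auto
  finally show ?thesis by (simp add: prob_space)
qed

end

section \<open>Weak convergence of integer-valued variables\<close>

lemma cdf_distr_nat: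
  assumes "prob_space M" and X[measurable]: "X \<in> measurable M (count_space (UNIV :: nat set))"
  shows "cdf (distr M borel (\<lambda>\<omega>. real (X \<omega>))) x = (\<Sum>k | real k \<le> x. measure M {\<omega>\<in>space M. X \<omega> = k})"
proof -
  interpret prob_space M by fact
  have "{k. real k \<le> x} \<subseteq> {..nat \<lfloor>x\<rfloor>}" by (auto simp: le_nat_iff le_floor_iff)
  hence fin: "finite {k. real k \<le> x}" using finite_subset by blast
  have "cdf (distr M borel (\<lambda>\<omega>. real (X \<omega>))) x = prob ((\<lambda>\<omega>. real (X \<omega>)) -` {..x} \<inter> space M)"
    unfolding cdf_def by (rule measure_distr) auto
  also have "(\<lambda>\<omega>. real (X \<omega>)) -` {..x} \<inter> space M = (\<Union>k\<in>{k. real k \<le> x}. {\<omega>\<in>space M. X \<omega> = k})"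
    by auto
  also have "prob \<dots> = (\<Sum>k | real k \<le> x. prob {\<omega>\<in>space M. X \<omega> = k})"
    using fin by (intro finite_measure_finite_Union) (auto simp: disjoint_family_on_def)
  finally show ?thesis .
qed

lemma weak_conv_m_nat:
  assumes "prob_space M" and X: "\<And>n. X n \<in> measurable M (count_space (UNIV :: nat set))"
    and "prob_space N" and Y: "Y \<in> measurable N (count_space (UNIV :: nat set))"
    and lim: "\<And>k. (\<lambda>n. measure M {\<omega>\<in>space M. X n \<omega> = k}) \<longlonglongrightarrow> measure N {\<omega>\<in>space N. Y \<omega> = k}"
  shows "weak_conv_m (\<lambda>n. distr M borel (\<lambda>\<omega>. real (X n \<omega>))) (distr N borel (\<lambda>\<omega>. real (Y \<omega>)))"
  unfolding weak_conv_m_def weak_conv_def cdf_distr_nat[OF assms(1) X] cdf_distr_nat[OF assms(3) Y]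
  by (intro allI impI tendsto_sum lim)

section \<open>False rejections and power\<close>

context subcritical_BH
begin

lemma V_le_R: "V n \<omega> \<le> R n \<omega>"
proof -
  have "V n \<omega> = card {j\<in>{..<n}. p j \<omega> \<le> threshold \<alpha> n (R n \<omega>) \<and> \<not> \<theta> j \<omega>}" by (rule V_eq) simp
  also have "\<dots> \<le> card {j\<in>{..<n}. p j \<omega> \<le> threshold \<alpha> n (R n \<omega>)}" by (intro card_mono) auto
  also have "\<dots> = R n \<omega>" using R_eq_iff[of \<omega> n "R n \<omega>"] by (simp add: crosses_last_def)
  finally show ?thesis .
qed

abbreviation "false_nulls n \<omega> \<equiv> card {j\<in>{..<n}. \<theta> j \<omega>}"

lemma false_nulls_measurable [measurable]: "false_nulls n \<in> measurable M (count_space UNIV)"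
  by (intro measurable_card_Collect) auto

lemma prob_few_false_nulls_tendsto:
  "(\<lambda>n. prob {\<omega>\<in>space M. real (false_nulls n \<omega>) \<le> \<pi> / 2 * real n}) \<longlonglongrightarrow> 0"
proof (rule tendsto_sandwich)
  let ?q = "exp (- (\<pi> / 2) * (1 - ln 2))"
  show "\<forall>\<^sub>F n in sequentially. 0 \<le> prob {\<omega>\<in>space M. real (false_nulls n \<omega>) \<le> \<pi> / 2 * real n}"
    by simp
  show "\<forall>\<^sub>F n in sequentially. prob {\<omega>\<in>space M. real (false_nulls n \<omega>) \<le> \<pi> / 2 * real n} \<le> ?q ^ n"
  proof (intro always_eventually allI)
    fix n
    define k where "k = nat \<lfloor>\<pi> / 2 * real n\<rfloor>"
    have k: "real k \<le> \<pi> / 2 * real n" using \<pi>_range unfolding k_def by (intro of_nat_floor) simp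
    \<comment> \<open>Evaluating the generating function at 1/2 suffices because \<open>ln 2 < 1\<close>.\<close>
    have "prob {\<omega>\<in>space M. real (false_nulls n \<omega>) \<le> \<pi> / 2 * real n} =
      prob {\<omega>\<in>space M. card {j\<in>{..<n}. (p j \<omega>, \<theta> j \<omega>) \<in> UNIV \<times> {True}} \<le> k}"
      using \<pi>_range by (simp add: k_def le_nat_iff le_floor_iff)
    also have "\<dots> \<le> (1 - \<pi> + \<pi> * (1 / 2)) ^ n / (1 / 2) ^ k"
      by (intro prob_count_bounds(2)) (auto simp: prob_false_null)
    also have "\<dots> = (1 + (- (\<pi> / 2))) ^ n * 2 ^ k" by (simp add: power_divide)
    also have "(1 + (- (\<pi> / 2))) ^ n \<le> exp (- (\<pi> / 2)) ^ n"
      using \<pi>_range by (intro power_mono exp_ge_add_one_self) auto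
    also have "(2::real) ^ k = exp (real k * ln 2)" by (simp add: exp_of_nat_mult)
    also have "\<dots> \<le> exp (\<pi> / 2 * real n * ln 2)" using k by (simp add: mult_right_mono)
    also have "exp (- (\<pi> / 2)) ^ n * exp (\<pi> / 2 * real n * ln 2) = ?q ^ n"
      by (simp add: exp_of_nat_mult[symmetric] exp_add[symmetric] algebra_simps)
    finally show "prob {\<omega>\<in>space M. real (false_nulls n \<omega>) \<le> \<pi> / 2 * real n} \<le> ?q ^ n" by simp
  qed
  have "0 < \<pi> / 2 * (1 - ln 2)" using \<pi>_range ln_2_less_1 by simp
  hence "?q < 1" by simp
  thus "(\<lambda>n. ?q ^ n) \<longlonglongrightarrow> 0" by (intro LIMSEQ_realpow_zero) auto
qed simp

text \<open>
  Outside an event of small probability the numerator is at most \<open>K\<close> and the number of false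
  nulls is at least \<open>\<pi> n / 2\<close>.
\<close>
lemma BH_power_bigo:
  "bigo_prob M (\<lambda>n \<omega>. BH_power \<alpha> (\<lambda>j. p j \<omega>) (\<lambda>j. \<theta> j \<omega>) n) (\<lambda>n. 1 / real n)"
  unfolding bigo_prob_def
proof (intro allI impI)
  fix \<epsilon> :: real assume e: "0 < \<epsilon>"
  have "\<forall>\<^sub>F K in sequentially. tail_bound K < \<epsilon> / 2"
    using e by (intro order_tendstoD(2)[OF tail_bound_tendsto]) auto
  then obtain K where K: "tail_bound K < \<epsilon> / 2" by (auto simp: eventually_sequentially)
  let ?few = "\<lambda>n. {\<omega>\<in>space M. real (false_nulls n \<omega>) \<le> \<pi> / 2 * real n}"
  let ?many = "\<lambda>n. {\<omega>\<in>space M. K < R n \<omega>}"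
  let ?P = "\<lambda>n \<omega>. BH_power \<alpha> (\<lambda>j. p j \<omega>) (\<lambda>j. \<theta> j \<omega>) n"
  let ?bad = "\<lambda>n. {\<omega>\<in>space M. \<bar>?P n \<omega>\<bar> > 2 * real K / \<pi> * \<bar>1 / real n\<bar>}"
  have "\<forall>\<^sub>F n in sequentially. prob (?few n) < \<epsilon> / 2"
    using e by (intro order_tendstoD(2)[OF prob_few_false_nulls_tendsto]) auto
  hence "\<forall>\<^sub>F n in sequentially. prob (?bad n) < \<epsilon>"
    using eventually_gt_at_top[of 0]
  proof eventually_elim
    case (elim n)
    have "?bad n \<subseteq> ?many n \<union> ?few n"
    proof
      fix \<omega> assume w: "\<omega> \<in> ?bad n"
      show "\<omega> \<in> ?many n \<union> ?few n"
      proof (rule ccontr)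
        assume "\<omega> \<notin> ?many n \<union> ?few n"
        hence R: "R n \<omega> \<le> K" and f: "\<pi> / 2 * real n < real (false_nulls n \<omega>)" using w by auto
        have "{j\<in>{..<n}. \<not> \<theta> j \<omega>} = {..<n} - {j\<in>{..<n}. \<theta> j \<omega>}" by auto
        moreover have "card ({..<n} - {j\<in>{..<n}. \<theta> j \<omega>}) = n - false_nulls n \<omega>"
          by (subst card_Diff_subset) auto
        moreover have "false_nulls n \<omega> \<le> card {..<n}" by (intro card_mono) auto
        ultimately have "n - card {j\<in>{..<n}. \<not> \<theta> j \<omega>} = false_nulls n \<omega>" by simp
        hence "?P n \<omega> = (real (R n \<omega>) - real (V n \<omega>)) / real (max (false_nulls n \<omega>) 1)"
          by (simp only: BH_power_def)
        moreover have "\<bar>real (R n \<omega>) - real (V n \<omega>)\<bar> \<le> real K" using R V_le_R[of \<omega> n] by simp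
        moreover have "\<pi> / 2 * real n \<le> real (max (false_nulls n \<omega>) 1)" using f by simp
        moreover have pos: "0 < \<pi> / 2 * real n" using \<pi>_range elim by simp
        ultimately have "\<bar>?P n \<omega>\<bar> \<le> real K / (\<pi> / 2 * real n)"
          by (simp only: abs_divide abs_of_nat) (intro frac_le, auto)
        thus False using w by (simp add: mult.commute)
      qed
    qed
    hence "prob (?bad n) \<le> prob (?many n \<union> ?few n)" by (intro finite_measure_mono) measurable
    also have "\<dots> \<le> prob (?many n) + prob (?few n)" by (intro measure_Un_le) measurable
    also have "prob (?many n) \<le> tail_bound K" by (rule prob_R_gt_le)
    finally show ?case using elim K by linarith
  qed
  thus "\<exists>K. \<forall>\<^sub>F n in sequentially. prob {\<omega>\<in>space M. \<bar>?P n \<omega>\<bar> > K * \<bar>1 / real n\<bar>} < \<epsilon>" by blast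
qed

text \<open>
  The conditional probability of being a true null for a \<open>p\<close>-value that is at most the \<open>k\<close>th threshold.
\<close>
definition "null_share n k = (1 - \<pi>) * threshold \<alpha> n k / H n k"

lemma H_pos: "k \<in> {1..n} \<Longrightarrow> 0 < H n k"
  unfolding H_def using threshold_range[of k n] alpha_star
  by (intro F_pos) (auto simp: threshold_def)

lemma null_share_range:
  assumes "k \<in> {1..n}" shows "0 \<le> null_share n k" "null_share n k \<le> 1"
  using assms H_pos[OF assms] threshold_range[of k n] mixture_cdf_ge[of "threshold \<alpha> n k"] \<pi>_range
  by (auto simp: null_share_def H_def)

text \<open>
  Given the number of rejections, the marks of the rejected points are still independent.
\<close>
lemma prob_R_V_binomial:
  assumes k: "k \<in> {1..n}"
  shows "prob {\<omega>\<in>space M. R n \<omega> = k \<and> V n \<omega> = v} = prob_R n k * pmf (binomial_pmf k (null_share n k)) v"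
proof (cases "v \<le> k")
  case True
  have Hk: "H n k \<noteq> 0" using H_pos[OF k] by simp
  have a: "(1 - \<pi>) * threshold \<alpha> n k = null_share n k * H n k" using Hk by (simp add: null_share_def)
  have b: "\<pi> * G (threshold \<alpha> n k) = (1 - null_share n k) * H n k"
    using Hk by (simp add: null_share_def H_def mixture_cdf_def field_simps)
  have "H n k ^ v * H n k ^ (k - v) = H n k ^ k" using True by (simp flip: power_add)
  hence "(null_share n k * H n k) ^ v * ((1 - null_share n k) * H n k) ^ (k - v) =
     null_share n k ^ v * (1 - null_share n k) ^ (k - v) * H n k ^ k"
    by (simp add: power_mult_distrib mult_ac)
  thus ?thesis using k null_share_range[OF k]
    by (simp add: prob_R_V prob_R_eq a b mult_ac)
next
  case False
  thus ?thesis using k null_share_range[OF k] by (simp add: prob_R_V)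
qed

lemma null_share_tendsto:
  assumes "k \<ge> 1" and F': "F'0 = 1 / alpha_star F"
  shows "(\<lambda>n. null_share n k) \<longlonglongrightarrow> beta_star \<pi> F"
proof -
  have "c \<noteq> 0" using c_range(1) by (rule less_imp_neq[symmetric])
  moreover have "real k \<noteq> 0" using \<open>k \<ge> 1\<close> by simp
  ultimately have "c * real k \<noteq> 0" by (rule no_zero_divisors)
  hence "(\<lambda>n. (1 - \<pi>) * (\<alpha> * real k) / (real n * H n k)) \<longlonglongrightarrow> (1 - \<pi>) * (\<alpha> * real k) / (c * real k)"
    by (intro tendsto_intros tendsto_H)
  moreover have "alpha_star F \<noteq> 0" "\<alpha> \<noteq> 0" using alpha_star by auto
  hence "(1 - \<pi>) * (\<alpha> * real k) / (c * real k) = beta_star \<pi> F"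
    using \<open>k \<ge> 1\<close> unfolding F' by (simp add: beta_star_def)
  moreover have "\<forall>\<^sub>F n in sequentially. (1 - \<pi>) * (\<alpha> * real k) / (real n * H n k) = null_share n k"
    using eventually_gt_at_top[of 0]
    by eventually_elim (simp add: null_share_def threshold_def)
  ultimately show ?thesis using Lim_transform_eventually by force
qed

lemma beta_star_range: "0 \<le> beta_star \<pi> F" "beta_star \<pi> F \<le> 1"
  using \<pi>_range alpha_star by (auto simp: beta_star_def mult_le_one)

lemma prob_R_ge_1: "prob {\<omega>\<in>space M. 1 \<le> R n \<omega>} = (\<Sum>k\<in>{1..n}. prob_R n k)"
proof -
  have "{\<omega>\<in>space M. 1 \<le> R n \<omega>} = {\<omega>\<in>space M. R n \<omega> \<in> {1..n}}" using R_le by auto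
  thus ?thesis by (simp add: sum_prob_R)
qed

lemma prob_R_ge_1_tendsto: "(\<lambda>n. prob {\<omega>\<in>space M. 1 \<le> R n \<omega>}) \<longlonglongrightarrow> c"
proof -
  have "{\<omega>\<in>space M. 1 \<le> R n \<omega>} = {\<omega>\<in>space M. \<not> R n \<omega> = 0}" for n by auto
  hence "prob {\<omega>\<in>space M. 1 \<le> R n \<omega>} = 1 - prob_R n 0" for n
    using prob_neg[of "\<lambda>\<omega>. R n \<omega> = 0"] by (simp add: prob_R_def)
  moreover have "(\<lambda>n. 1 - prob_R n 0) \<longlonglongrightarrow> 1 - (1 - c)" by (intro tendsto_intros prob_R_0_tendsto)
  ultimately show ?thesis by simp
qed

lemma sum_binomial_pmf_mean:
  assumes "0 \<le> q" "q \<le> 1"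
  shows "(\<Sum>v\<le>k. real v * pmf (binomial_pmf k q) v) = real k * q"
  using sum_k_Bernstein[of k q] assms by (simp add: Bernstein_def)

text \<open>
  A binomial variable with parameters \<open>k\<close> and \<open>q\<close> has mean \<open>k q\<close>, so given \<open>R = k\<close> the expected
  proportion of false rejections is \<open>null_share n k\<close>.
\<close>
lemma pFDR_eq:
  assumes pos: "0 < prob {\<omega>\<in>space M. 1 \<le> R n \<omega>}"
  shows "cond_expectation M (\<lambda>\<omega>. real (V n \<omega>) / real (R n \<omega>)) (\<lambda>\<omega>. R n \<omega> \<ge> 1) =
    (\<Sum>k\<in>{1..n}. null_share n k * prob_R n k) / prob {\<omega>\<in>space M. 1 \<le> R n \<omega>}"
proof -
  let ?A = "{\<omega>\<in>space M. 1 \<le> R n \<omega>}"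
  let ?f = "\<lambda>\<omega>. real (V n \<omega>) / real (R n \<omega>)"
  let ?E = "\<lambda>k v. {\<omega>\<in>space M. R n \<omega> = k \<and> V n \<omega> = v}"
  have A: "?A \<in> sets M" by measurable
  have f[measurable]: "?f \<in> borel_measurable M" by measurable
  have E: "?E k v \<in> sets M" for k v by measurable
  have "(\<integral>\<^sup>+\<omega>. ennreal (?f \<omega>) * indicator ?A \<omega> \<partial>M) =
    (\<integral>\<^sup>+\<omega>. (\<Sum>k\<in>{1..n}. \<Sum>v\<le>k. ennreal (real v / real k) * indicator (?E k v) \<omega>) \<partial>M)"
  proof (intro nn_integral_cong)
    fix \<omega> assume w: "\<omega> \<in> space M"
    have "(\<Sum>v\<le>k. ennreal (real v / real k) * indicator (?E k v) \<omega>) =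
       (if k = R n \<omega> then ennreal (?f \<omega>) else 0)" for k
    proof (cases "k = R n \<omega>")
      case True
      have "(\<Sum>v\<le>k. ennreal (real v / real k) * indicator (?E k v) \<omega>) =
        (\<Sum>v\<le>k. if v = V n \<omega> then ennreal (?f \<omega>) else 0)"
        using w True by (intro sum.cong) (auto simp: indicator_def)
      thus ?thesis using V_le_R[of \<omega> n] True by simp
    qed (auto intro!: sum.neutral simp: indicator_def)
    hence "(\<Sum>k\<in>{1..n}. \<Sum>v\<le>k. ennreal (real v / real k) * indicator (?E k v) \<omega>) =
      (\<Sum>k\<in>{1..n}. if k = R n \<omega> then ennreal (?f \<omega>) else 0)" by simp
    also have "\<dots> = ennreal (?f \<omega>) * indicator ?A \<omega>"
      using w R_le[of \<omega> n] by (auto simp: indicator_def)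
    finally show "ennreal (?f \<omega>) * indicator ?A \<omega> =
      (\<Sum>k\<in>{1..n}. \<Sum>v\<le>k. ennreal (real v / real k) * indicator (?E k v) \<omega>)" ..
  qed
  also have "\<dots> = (\<Sum>k\<in>{1..n}. \<Sum>v\<le>k. ennreal (real v / real k) * emeasure M (?E k v))"
  proof -
    note [measurable] = E
    have "(\<integral>\<^sup>+\<omega>. (\<Sum>v\<le>k. ennreal (real v / real k) * indicator (?E k v) \<omega>) \<partial>M) =
       (\<Sum>v\<le>k. ennreal (real v / real k) * emeasure M (?E k v))" for k
      by (subst nn_integral_sum) (measurable, intro sum.cong refl nn_integral_cmult_indicator E)
    moreover have "(\<integral>\<^sup>+\<omega>. (\<Sum>k\<in>{1..n}. \<Sum>v\<le>k. ennreal (real v / real k) * indicator (?E k v) \<omega>) \<partial>M) =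
       (\<Sum>k\<in>{1..n}. \<integral>\<^sup>+\<omega>. (\<Sum>v\<le>k. ennreal (real v / real k) * indicator (?E k v) \<omega>) \<partial>M)"
      by (rule nn_integral_sum) measurable
    ultimately show ?thesis by (simp only:)
  qed
  also have "\<dots> = ennreal (\<Sum>k\<in>{1..n}. \<Sum>v\<le>k. real v / real k * prob (?E k v))"
    by (simp add: emeasure_eq_measure ennreal_mult[symmetric] sum_nonneg)
  also have "(\<Sum>k\<in>{1..n}. \<Sum>v\<le>k. real v / real k * prob (?E k v)) = (\<Sum>k\<in>{1..n}. null_share n k * prob_R n k)"
  proof (intro sum.cong refl)
    fix k assume k: "k \<in> {1..n}"
    have "(\<Sum>v\<le>k. real v / real k * prob (?E k v)) =
      prob_R n k / real k * (\<Sum>v\<le>k. real v * pmf (binomial_pmf k (null_share n k)) v)"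
      unfolding prob_R_V_binomial[OF k] sum_distrib_left by (intro sum.cong) (auto simp: mult_ac)
    also have "\<dots> = null_share n k * prob_R n k"
      unfolding sum_binomial_pmf_mean[OF null_share_range[OF k]] using k by simp
    finally show "(\<Sum>v\<le>k. real v / real k * prob (?E k v)) = null_share n k * prob_R n k" .
  qed
  finally have nn: "(\<integral>\<^sup>+\<omega>. ennreal (?f \<omega>) * indicator ?A \<omega> \<partial>M) = ennreal (\<Sum>k\<in>{1..n}. null_share n k * prob_R n k)" .
  have sum_nn: "0 \<le> (\<Sum>k\<in>{1..n}. null_share n k * prob_R n k)"
    using null_share_range prob_R_nonneg by (intro sum_nonneg mult_nonneg_nonneg) auto
  have "integral\<^sup>L (uniform_measure M ?A) ?f = enn2real (\<integral>\<^sup>+\<omega>. ennreal (?f \<omega>) \<partial>uniform_measure M ?A)"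
    by (intro integral_eq_nn_integral) auto
  also have "(\<integral>\<^sup>+\<omega>. ennreal (?f \<omega>) \<partial>uniform_measure M ?A) = ennreal (\<Sum>k\<in>{1..n}. null_share n k * prob_R n k) / emeasure M ?A"
    using A nn by (subst nn_integral_uniform_measure) auto
  also have "\<dots> = ennreal ((\<Sum>k\<in>{1..n}. null_share n k * prob_R n k) / prob ?A)"
    unfolding emeasure_eq_measure using sum_nn pos by (rule divide_ennreal)
  finally show ?thesis unfolding cond_expectation_def using sum_nn pos by simp
qed

lemma pFDR_tendsto:
  assumes F': "F'0 = 1 / alpha_star F"
  shows "(\<lambda>n. cond_expectation M (\<lambda>\<omega>. real (V n \<omega>) / real (R n \<omega>)) (\<lambda>\<omega>. R n \<omega> \<ge> 1)) \<longlonglongrightarrow> beta_star \<pi> F"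
proof -
  let ?\<beta> = "beta_star \<pi> F"
  let ?A = "\<lambda>n. prob {\<omega>\<in>space M. 1 \<le> R n \<omega>}"
  define e where "e n k = (if k \<in> {1..n} then null_share n k - ?\<beta> else 0)" for n k
  have lim: "(\<lambda>n. \<Sum>k\<le>n. e n k * prob_R n k) \<longlonglongrightarrow> 0"
  proof (rule tendsto_tight_sum[OF _ _ prob_R_nonneg prob_R_le_1 sum_prob_R_tail tail_bound_tendsto])
    fix k
    show "(\<lambda>n. e n k) \<longlonglongrightarrow> 0"
    proof (cases "k = 0")
      case False
      have "(\<lambda>n. null_share n k - ?\<beta>) \<longlonglongrightarrow> ?\<beta> - ?\<beta>"
        using False F' by (intro tendsto_intros null_share_tendsto) auto
      moreover have "\<forall>\<^sub>F n in sequentially. null_share n k - ?\<beta> = e n k"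
        using eventually_ge_at_top[of k] by eventually_elim (use False in \<open>auto simp: e_def\<close>)
      ultimately show ?thesis using Lim_transform_eventually by force
    qed (simp add: e_def)
  next
    fix n k :: nat
    show "\<bar>e n k\<bar> \<le> 1" using null_share_range[of k n] beta_star_range by (auto simp: e_def abs_le_iff)
  qed
  have "(\<lambda>n. ?\<beta> + (\<Sum>k\<le>n. e n k * prob_R n k) / ?A n) \<longlonglongrightarrow> ?\<beta> + 0 / c"
    using c_range by (intro tendsto_intros lim prob_R_ge_1_tendsto) auto
  moreover have "\<forall>\<^sub>F n in sequentially. 0 < ?A n"
    using c_range by (intro order_tendstoD(1)[OF prob_R_ge_1_tendsto])
  hence "\<forall>\<^sub>F n in sequentially. ?\<beta> + (\<Sum>k\<le>n. e n k * prob_R n k) / ?A n =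
    cond_expectation M (\<lambda>\<omega>. real (V n \<omega>) / real (R n \<omega>)) (\<lambda>\<omega>. R n \<omega> \<ge> 1)"
  proof eventually_elim
    case (elim n)
    have "(\<Sum>k\<le>n. e n k * prob_R n k) = (\<Sum>k\<in>{1..n}. e n k * prob_R n k)"
      by (intro sum.mono_neutral_right) (auto simp: e_def)
    also have "\<dots> = (\<Sum>k\<in>{1..n}. null_share n k * prob_R n k - ?\<beta> * prob_R n k)"
      by (intro sum.cong) (auto simp: e_def algebra_simps)
    also have "\<dots> = (\<Sum>k\<in>{1..n}. null_share n k * prob_R n k) - ?\<beta> * ?A n"
      by (simp only: sum_subtractf sum_distrib_left[symmetric] prob_R_ge_1)
    finally show ?case using elim by (simp only: pFDR_eq[OF elim]) (simp add: field_simps)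
  qed
  ultimately show ?thesis using Lim_transform_eventually by force
qed

lemma measure_cond_law_V:
  assumes k: "k \<in> {1..n}" and pos: "prob_R n k \<noteq> 0"
  shows "measure (cond_law M (V n) (\<lambda>\<omega>. R n \<omega> = k)) {v} = pmf (binomial_pmf k (null_share n k)) v"
proof -
  let ?A = "{\<omega>\<in>space M. R n \<omega> = k}"
  have A: "emeasure M ?A \<noteq> 0" "emeasure M ?A \<noteq> \<infinity>"
    using pos by (simp_all add: emeasure_eq_measure prob_R_def)
  have Vm: "V n \<in> measurable (uniform_measure M ?A) (count_space UNIV)"
    using V_measurable[of n] by (simp cong: measurable_cong_sets)
  have V': "V n -` {v} \<inter> space M \<in> sets M" by (rule measurable_sets[OF V_measurable]) simp
  have "measure (cond_law M (V n) (\<lambda>\<omega>. R n \<omega> = k)) {v} = measure (uniform_measure M ?A) (V n -` {v} \<inter> space M)"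
    unfolding cond_law_def using measure_distr[OF Vm, of "{v}"] by simp
  also have "\<dots> = prob (?A \<inter> (V n -` {v} \<inter> space M)) / prob ?A"
    by (rule measure_uniform_measure[OF A V'])
  also have "?A \<inter> (V n -` {v} \<inter> space M) = {\<omega>\<in>space M. R n \<omega> = k \<and> V n \<omega> = v}" by auto
  also have "prob \<dots> / prob ?A = pmf (binomial_pmf k (null_share n k)) v"
    using pos prob_R_V_binomial[OF k, of v] by (simp add: prob_R_def)
  finally show ?thesis .
qed

text \<open>
  Both laws are binomial with the same number of trials, and the probabilities of \<open>0, \<dots>, k\<close> depend
  continuously on the success probability. Values of \<open>k\<close> with \<open>P(R = k) = 0\<close> contribute 0
  whatever the conditional law is there.
\<close>
lemma d_TV_cond_law_V_tendsto:
  assumes F': "F'0 = 1 / alpha_star F"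
  shows "(\<lambda>n. \<Sum>k. d_TV (cond_law M (V n) (\<lambda>\<omega>. R n \<omega> = Suc k))
              (measure_pmf (binomial_pmf (Suc k) (beta_star \<pi> F))) * \<P>(\<omega> in M. R n \<omega> = Suc k)) \<longlonglongrightarrow> 0"
proof -
  let ?\<beta> = "beta_star \<pi> F"
  define e where "e n k = (if k \<in> {1..n} then
     (\<Sum>v\<le>k. \<bar>pmf (binomial_pmf k (null_share n k)) v - pmf (binomial_pmf k ?\<beta>) v\<bar>) else 0)" for n k
  have lim: "(\<lambda>n. \<Sum>k\<le>n. e n k * prob_R n k) \<longlonglongrightarrow> 0"
  proof (rule tendsto_tight_sum[OF _ _ prob_R_nonneg prob_R_le_1 sum_prob_R_tail tail_bound_tendsto])
    fix k
    show "(\<lambda>n. e n k) \<longlonglongrightarrow> 0"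
    proof (cases "k = 0")
      case False
      let ?b = "\<lambda>q v. real (k choose v) * q ^ v * (1 - q) ^ (k - v)"
      have "(\<lambda>n. \<Sum>v\<le>k. \<bar>?b (null_share n k) v - ?b ?\<beta> v\<bar>) \<longlonglongrightarrow> (\<Sum>v\<le>k. \<bar>?b ?\<beta> v - ?b ?\<beta> v\<bar>)"
        using False F' by (intro tendsto_intros null_share_tendsto) auto
      moreover have "\<forall>\<^sub>F n in sequentially. (\<Sum>v\<le>k. \<bar>?b (null_share n k) v - ?b ?\<beta> v\<bar>) = e n k"
        using eventually_ge_at_top[of k]
      proof eventually_elim
        case (elim n)
        hence "k \<in> {1..n}" using False by simp
        thus ?case using null_share_range[of k n] beta_star_range by (simp add: e_def)
      qed
      ultimately show ?thesis using Lim_transform_eventually by force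
    qed (simp add: e_def)
  next
    fix n k :: nat
    have 1: "(\<Sum>v\<le>k. pmf (binomial_pmf k q) v) \<le> 1" for q
      using measure_measure_pmf_finite[of "{..k}" "binomial_pmf k q"] by (metis finite_atMost measure_pmf.prob_le_1)
    have "(\<Sum>v\<le>k. \<bar>pmf (binomial_pmf k (null_share n k)) v - pmf (binomial_pmf k ?\<beta>) v\<bar>) \<le>
      (\<Sum>v\<le>k. pmf (binomial_pmf k (null_share n k)) v + pmf (binomial_pmf k ?\<beta>) v)"
      by (intro sum_mono order.trans[OF abs_triangle_ineq4]) (simp add: pmf_nonneg)
    also have "\<dots> \<le> 2" unfolding sum.distrib using 1[of "null_share n k"] 1[of ?\<beta>] by linarith
    finally show "\<bar>e n k\<bar> \<le> 2" by (simp add: e_def sum_nonneg)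
  qed
  have "(\<Sum>k. d_TV (cond_law M (V n) (\<lambda>\<omega>. R n \<omega> = Suc k))
       (measure_pmf (binomial_pmf (Suc k) ?\<beta>)) * \<P>(\<omega> in M. R n \<omega> = Suc k)) = (\<Sum>k\<le>n. e n k * prob_R n k)" for n
  proof -
    let ?t = "\<lambda>k. d_TV (cond_law M (V n) (\<lambda>\<omega>. R n \<omega> = Suc k))
       (measure_pmf (binomial_pmf (Suc k) ?\<beta>)) * \<P>(\<omega> in M. R n \<omega> = Suc k)"
    have t: "?t k = e n (Suc k) * prob_R n (Suc k)" for k
    proof (cases "prob_R n (Suc k) = 0")
      case False
      have "Suc k \<in> {1..n}"
      proof (rule ccontr)
        assume "\<not> Suc k \<in> {1..n}"
        hence "{\<omega>\<in>space M. R n \<omega> = Suc k} = {}" using R_le by (auto dest: sym)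
        hence "prob_R n (Suc k) = 0" unfolding prob_R_def by (simp only: measure_empty)
        thus False using False by simp
      qed
      note k = this
      have "d_TV (cond_law M (V n) (\<lambda>\<omega>. R n \<omega> = Suc k)) (measure_pmf (binomial_pmf (Suc k) ?\<beta>)) =
        (\<Sum>v. \<bar>pmf (binomial_pmf (Suc k) (null_share n (Suc k))) v - pmf (binomial_pmf (Suc k) ?\<beta>) v\<bar>)"
        unfolding d_TV_def measure_cond_law_V[OF k False] measure_pmf_single ..
      also have "\<dots> = e n (Suc k)"
        unfolding e_def if_P[OF k] using null_share_range[OF k] beta_star_range
        by (intro suminf_finite) auto
      finally show ?thesis by (simp add: prob_R_def)
    qed (simp add: prob_R_def)
    have "(\<Sum>k. ?t k) = (\<Sum>k<n. e n (Suc k) * prob_R n (Suc k))"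
      unfolding t by (intro suminf_finite) (auto simp: e_def)
    also have "\<dots> = (\<Sum>k\<in>Suc ` {..<n}. e n k * prob_R n k)"
      by (subst sum.reindex) auto
    also have "\<dots> = (\<Sum>k\<le>n. e n k * prob_R n k)"
    proof (rule sum.mono_neutral_left)
      show "\<forall>k\<in>{..n} - Suc ` {..<n}. e n k * prob_R n k = 0"
      proof
        fix k assume k: "k \<in> {..n} - Suc ` {..<n}"
        hence "k = 0" by (cases k) auto
        thus "e n k * prob_R n k = 0" by (simp add: e_def)
      qed
    qed auto
    finally show ?thesis .
  qed
  thus ?thesis using lim by simp
qed

end

section \<open>Subcritical limit of the Benjamini-Hochberg procedure\<close>

theorem theorem2p1:
  fixes M :: "'a measure" and p :: "nat \<Rightarrow> 'a \<Rightarrow> real" and \<theta> :: "nat \<Rightarrow> 'a \<Rightarrow> bool"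
    and N :: "'b measure" and \<gamma> :: "nat \<Rightarrow> 'b \<Rightarrow> real"
    and F G :: "real \<Rightarrow> real" and R V :: "nat \<Rightarrow> 'a \<Rightarrow> nat" and \<tau> :: "'b \<Rightarrow> nat"
    and \<pi> \<alpha> F'0 c :: real
  assumes model: "random_effects_model M p \<theta> \<pi> G"
    and F: "F = mixture_cdf \<pi> G"
    and F_cont: "continuous_on {0..1} F" and F_0: "F 0 = 0"
    and F_deriv: "(F has_real_derivative F'0) (at_right 0)"
    and \<alpha>: "\<alpha> \<in> {0<..<alpha_star F}"
    and c: "c = \<alpha> * F'0"
    and R: "R = (\<lambda>n \<omega>. BH_rejections \<alpha> (\<lambda>j. p j \<omega>) n)"
    and V: "V = (\<lambda>n \<omega>. BH_false_rejections \<alpha> (\<lambda>j. p j \<omega>) (\<lambda>j. \<theta> j \<omega>) n)"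
    and N: "prob_space N"
    and \<gamma>_indep: "prob_space.indep_vars N (\<lambda>_. borel) \<gamma> UNIV"
    and \<gamma>_exp: "\<And>j. distributed N lborel (\<gamma> j) (exponential_density 1)"
    and \<tau>: "\<tau> = (\<lambda>\<omega>. last_negative_time c (\<lambda>j. \<gamma> j \<omega>))"
  shows "(AE \<omega> in N. finite {j. walk c (\<lambda>i. \<gamma> i \<omega>) j < 0})
    \<and> weak_conv_m (\<lambda>n. distr M borel (\<lambda>\<omega>. real (R n \<omega>))) (distr N borel (\<lambda>\<omega>. real (\<tau> \<omega>)))
    \<and> (\<forall>k. \<P>(\<omega> in N. \<tau> \<omega> = k)
          = real k ^ k / fact k * (1 - c) * c ^ k * exp (- (real k * c)))
    \<and> bigo_prob M (\<lambda>n \<omega>. BH_power \<alpha> (\<lambda>j. p j \<omega>) (\<lambda>j. \<theta> j \<omega>) n) (\<lambda>n. 1 / real n)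
    \<and> (F'0 = 1 / alpha_star F \<longrightarrow>
         (\<lambda>n. cond_expectation M (\<lambda>\<omega>. real (V n \<omega>) / real (R n \<omega>)) (\<lambda>\<omega>. R n \<omega> \<ge> 1))
           \<longlonglongrightarrow> beta_star \<pi> F
       \<and> (\<lambda>n. \<Sum>k. d_TV (cond_law M (V n) (\<lambda>\<omega>. R n \<omega> = Suc k))
                        (measure_pmf (binomial_pmf (Suc k) (beta_star \<pi> F)))
                    * \<P>(\<omega> in M. R n \<omega> = Suc k))
           \<longlonglongrightarrow> 0)"
proof -
  interpret BH: subcritical_BH M p \<theta> \<pi> G \<alpha> F'0
    using model F_0 F_deriv \<alpha> unfolding F
    by (intro subcritical_BH.intro subcritical_BH_axioms.intro)
  interpret W: exponential_walk N \<gamma> c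
    unfolding c using N \<gamma>_indep \<gamma>_exp BH.c_range
    by (intro exponential_walk.intro exponential_walk_axioms.intro)
  \<comment> \<open>The laws \<open>h A\<^sub>k\<close> of \<open>\<tau>\<close> and \<open>(1 - c) A\<^sub>k\<close>, the limit law, both have total mass 1.\<close>
  define h where "h = enn2real (W.stay_above_prob 0 0)"
  have prob_\<tau>_h: "measure N {\<omega>\<in>space N. \<tau> \<omega> = k} = h * BH.borel_weight k" for k
    unfolding \<tau> W.prob_\<tau>_proportional BH.borel_weight_def h_def c[symmetric] ..
  have "(\<lambda>k. (1 - c) * BH.borel_weight k / (1 - c)) sums (1 / (1 - c))"
    using BH.borel_weight_sums unfolding c by (rule sums_divide)
  hence "BH.borel_weight sums (1 / (1 - c))" using W.c by simp
  hence "(\<lambda>k. h * BH.borel_weight k) sums (h * (1 / (1 - c)))" by (rule sums_mult)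
  moreover have "(\<lambda>k. h * BH.borel_weight k) sums 1"
    using W.prob_\<tau>_sums prob_\<tau>_h unfolding \<tau> by simp
  ultimately have "h * (1 / (1 - c)) = 1" by (rule sums_unique2)
  hence h: "h = 1 - c" using W.c by (simp add: field_simps)
  have prob_\<tau>: "measure N {\<omega>\<in>space N. \<tau> \<omega> = k} = (1 - c) * BH.borel_weight k" for k
    unfolding prob_\<tau>_h h ..
  have 1: "AE \<omega> in N. finite {j. walk c (\<lambda>i. \<gamma> i \<omega>) j < 0}" by (rule W.AE_finite_negative)
  have 2: "weak_conv_m (\<lambda>n. distr M borel (\<lambda>\<omega>. real (R n \<omega>))) (distr N borel (\<lambda>\<omega>. real (\<tau> \<omega>)))"
  proof (rule weak_conv_m_nat)
    show "prob_space M" "prob_space N" by (rule BH.prob_space_axioms N)+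
    show "R n \<in> measurable M (count_space UNIV)" for n unfolding R by (rule BH.R_measurable)
    show "\<tau> \<in> measurable N (count_space UNIV)" unfolding \<tau> by (rule W.\<tau>_measurable)
    show "(\<lambda>n. measure M {\<omega>\<in>space M. R n \<omega> = k}) \<longlonglongrightarrow> measure N {\<omega>\<in>space N. \<tau> \<omega> = k}" for k
      unfolding prob_\<tau> using BH.prob_R_tendsto[of k] by (simp only: R c BH.prob_R_def)
  qed
  have 3: "measure N {\<omega>\<in>space N. \<tau> \<omega> = k} = real k ^ k / fact k * (1 - c) * c ^ k * exp (- (real k * c))" for k
    unfolding prob_\<tau> BH.borel_weight_def c[symmetric] by (simp add: power_mult_distrib mult_ac)
  show ?thesis
    using 1 2 3 BH.BH_power_bigo BH.pFDR_tendsto BH.d_TV_cond_law_V_tendsto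
    unfolding R V F by blast
qed

end
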